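(* Let $\mathbb{E}$ be a reflexive Banach space and let $\mathrm{Gr}(\mathbb{E})$ be the Grassmannian of split subspaces of $\mathbb{E}$ with its standard Banach manifold structure. Then a precotangent bundle $T_*\mathrm{Gr}(\mathbb{E})$ of $\mathrm{Gr}(\mathbb{E})$ exists.
   Context: Precotangent bundle: for a smooth Banach manifold $M$, a precotangent bundle $T_*M$ is a Banach subbundle of the cotangent bundle $T^*M$ such that $({T_*}_pM)^*=T_pM$ for every $p\in M$; the identification is the one given by the canonical pairing, i.e. the evaluation map $T_pM\to({T_*}_pM)^*$, $v\mapsto(\mu\mapsto\mu(v))$, is an isomorphism of Banach spaces. Here a Banach subbundle of a Banach vector bundle $E\to M$ is a subset that around each point, in a suitable local trivialization $E_{|U}\cong U\times Y$ of $E$, corresponds to $U\times Z$ for a closed subspace $Z\subset Y$ (the subspace $Z$ is not required to be complemented). Grassmannian: $\mathrm{Gr}(\mathbb{E})$ is the set of split subspaces of $\mathbb{E}$, i.e. closed subspaces $F\subset\mathbb{E}$ admitting a closed complementary subspace $G$ ($\mathbb{E}=F\oplus G$). Its Banach manifold structure is given by charts indexed by pairs $(F,G)$ of complementary closed subspaces: let $\pi_F(G):\mathbb{E}\to G$ and $\pi_G(F):\mathbb{E}\to F$ be the projections with respect to the decomposition $\mathbb{E}=F\oplus G$ and let $\Omega_G=\{H\in\mathrm{Gr}(\mathbb{E})\mid H\oplus G=\mathbb{E}\}$. The chart is $\phi_{F,G}:\Omega_G\to L(F,G)$, $\phi_{F,G}(H)=\pi_F(G)_{|H}\,(\pi_G(F)_{|H})^{-1}$,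 where $L(F,G)$ is the Banach space of bounded linear maps $F\to G$; its inverse sends $A\in L(F,G)$ to its graph $\{f+Af\mid f\in F\}\subset F\oplus G=\mathbb{E}$. *)

theory Defs
  imports "HOL-Analysis.Analysis" "HOL-Library.Function_Algebras"
begin

section \<open>Normed spaces with explicit carriers\<close>

text \<open>
  The model spaces \<open>L(F,G)\<close> of the Grassmannian depend on the points \<open>F\<close> and \<open>G\<close>, so they cannot
  be types of class \<^class>\<open>banach\<close>.  A normed space is therefore a linear subspace of an ambient
  real vector space together with a norm that is only meaningful on that subspace.  Spaces of
  maps live in function types; a map defined on a carrier is represented by the function that
  vanishes outside of it.
\<close>

instantiation "fun" :: (type, real_vector) real_vector
begin

definition scaleR_fun :: "real \<Rightarrow> ('a \<Rightarrow> 'b) \<Rightarrow> 'a \<Rightarrow> 'b" where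
  "scaleR_fun r f = (\<lambda>x. r *\<^sub>R f x)"

instance
  by standard (simp_all add: scaleR_fun_def fun_eq_iff scaleR_add_right scaleR_add_left)

end

record 'v nspace =
  carr :: "'v set"
  nrm :: "'v \<Rightarrow> real"

definition normed_space :: "'v::real_vector nspace \<Rightarrow> bool" where
  "normed_space X \<longleftrightarrow> subspace (carr X) \<and>
     (\<forall>x\<in>carr X. 0 \<le> nrm X x \<and> (nrm X x = 0 \<longleftrightarrow> x = 0)) \<and>
     (\<forall>x\<in>carr X. \<forall>y\<in>carr X. nrm X (x + y) \<le> nrm X x + nrm X y) \<and>
     (\<forall>r. \<forall>x\<in>carr X. nrm X (r *\<^sub>R x) = \<bar>r\<bar> * nrm X x)"

text \<open>The locale \<^locale>\<open>Metric_space\<close> demands symmetry and nonnegativity also off the carrier,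
  where the norm is arbitrary; hence the case distinction.\<close>

definition ndist :: "'v::real_vector nspace \<Rightarrow> 'v \<Rightarrow> 'v \<Rightarrow> real" where
  "ndist X x y = (if x \<in> carr X \<and> y \<in> carr X then nrm X (x - y) else 0)"

lemma normed_space_Metric_space:
  assumes "normed_space X"
  shows "Metric_space (carr X) (ndist X)"
proof -
  have sub: "subspace (carr X)"
    and pos: "\<And>x. x \<in> carr X \<Longrightarrow> 0 \<le> nrm X x"
    and zero: "\<And>x. x \<in> carr X \<Longrightarrow> nrm X x = 0 \<longleftrightarrow> x = 0"
    and tri: "\<And>x y. x \<in> carr X \<Longrightarrow> y \<in> carr X \<Longrightarrow> nrm X (x + y) \<le> nrm X x + nrm X y"
    and scl: "\<And>r x. x \<in> carr X \<Longrightarrow> nrm X (r *\<^sub>R x) = \<bar>r\<bar> * nrm X x"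
    using assms by (auto simp: normed_space_def)
  note diff = subspace_diff[OF sub]
  show ?thesis
  proof
    show "0 \<le> ndist X x y" for x y
      by (simp add: ndist_def pos diff)
    show "ndist X x y = ndist X y x" for x y
    proof (cases "x \<in> carr X \<and> y \<in> carr X")
      case True
      then show ?thesis
        using scl[of "x - y" "-1"] diff[of x y] by (simp add: ndist_def)
    qed (auto simp: ndist_def)
    show "ndist X x y = 0 \<longleftrightarrow> x = y" if "x \<in> carr X" "y \<in> carr X" for x y
      using that by (simp add: ndist_def zero diff)
    show "ndist X x z \<le> ndist X x y + ndist X y z"
      if "x \<in> carr X" "y \<in> carr X" "z \<in> carr X" for x y z
      using that tri[of "x - y" "y - z"] by (simp add: ndist_def diff)
  qed
qed

definition ntop :: "'v::real_vector nspace \<Rightarrow> 'v topology" where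
  "ntop X = Metric_space.mtopology (carr X) (ndist X)"

definition banach_space :: "'v::real_vector nspace \<Rightarrow> bool" where
  "banach_space X \<longleftrightarrow> normed_space X \<and> Metric_space.mcomplete (carr X) (ndist X)"

definition nspace_of :: "'a::real_normed_vector set \<Rightarrow> 'a nspace" where
  "nspace_of S = \<lparr>carr = S, nrm = norm\<rparr>"

definition nsub :: "'v nspace \<Rightarrow> 'v set \<Rightarrow> 'v nspace" where
  "nsub X S = \<lparr>carr = S, nrm = nrm X\<rparr>"

definition zero_ext :: "'v set \<Rightarrow> ('v \<Rightarrow> 'w::zero) \<Rightarrow> 'v \<Rightarrow> 'w" where
  "zero_ext S f = (\<lambda>x. if x \<in> S then f x else 0)"

definition lin_on :: "'v::real_vector set \<Rightarrow> 'w::real_vector set \<Rightarrow> ('v \<Rightarrow> 'w) \<Rightarrow> bool" where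
  "lin_on V W f \<longleftrightarrow> (\<forall>x\<in>V. f x \<in> W) \<and>
     (\<forall>x\<in>V. \<forall>y\<in>V. f (x + y) = f x + f y) \<and> (\<forall>r. \<forall>x\<in>V. f (r *\<^sub>R x) = r *\<^sub>R f x)"

definition blmaps ::
  "'v::real_vector nspace \<Rightarrow> 'w::real_vector nspace \<Rightarrow> ('v \<Rightarrow> 'w) nspace" where
  "blmaps X Y =
     \<lparr>carr = {f. lin_on (carr X) (carr Y) f \<and> (\<forall>x. x \<notin> carr X \<longrightarrow> f x = 0) \<and>
               (\<exists>K. \<forall>x\<in>carr X. nrm Y (f x) \<le> K * nrm X x)},
      nrm = (\<lambda>f. Sup {nrm Y (f x) | x. x \<in> carr X \<and> nrm X x \<le> 1})\<rparr>"

definition ndual :: "'v::real_vector nspace \<Rightarrow> ('v \<Rightarrow> real) nspace" where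
  "ndual X = blmaps X (nspace_of (UNIV :: real set))"

text \<open>Isomorphism of Banach spaces: a linear bijection bounded in both directions
  (not necessarily isometric).\<close>

definition banach_iso ::
  "'v::real_vector nspace \<Rightarrow> 'w::real_vector nspace \<Rightarrow> ('v \<Rightarrow> 'w) \<Rightarrow> bool" where
  "banach_iso X Y f \<longleftrightarrow> lin_on (carr X) (carr Y) f \<and> bij_betw f (carr X) (carr Y) \<and>
     (\<exists>K. \<forall>x\<in>carr X. nrm Y (f x) \<le> K * nrm X x) \<and>
     (\<exists>K. \<forall>x\<in>carr X. nrm X x \<le> K * nrm Y (f x))"

section \<open>Smooth maps\<close>

text \<open>Bounded \<open>k\<close>-linear maps; the arguments are given as a list of length \<open>k\<close>.\<close>

definition mlmaps ::
  "nat \<Rightarrow> 'v::real_vector nspace \<Rightarrow> 'w::real_vector nspace \<Rightarrow> ('v list \<Rightarrow> 'w) nspace" where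
  "mlmaps k X Y =
     \<lparr>carr = {m. (\<forall>vs. \<not> (length vs = k \<and> set vs \<subseteq> carr X) \<longrightarrow> m vs = 0) \<and>
        (\<forall>us ws. length us + Suc (length ws) = k \<and> set us \<subseteq> carr X \<and> set ws \<subseteq> carr X
           \<longrightarrow> lin_on (carr X) (carr Y) (\<lambda>x. m (us @ x # ws))) \<and>
        (\<forall>vs. length vs = k \<and> set vs \<subseteq> carr X \<longrightarrow> m vs \<in> carr Y) \<and>
        (\<exists>K. \<forall>vs. length vs = k \<and> set vs \<subseteq> carr X
           \<longrightarrow> nrm Y (m vs) \<le> K * prod_list (map (nrm X) vs))},
      nrm = (\<lambda>m. Sup {nrm Y (m vs) | vs.
                length vs = k \<and> set vs \<subseteq> carr X \<and> (\<forall>v\<in>set vs. nrm X v \<le> 1)})\<rparr>"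

definition has_fderiv ::
  "'v::real_vector nspace \<Rightarrow> 'w::real_vector nspace \<Rightarrow> 'v set \<Rightarrow> ('v \<Rightarrow> 'w) \<Rightarrow> 'v \<Rightarrow> ('v \<Rightarrow> 'w) \<Rightarrow> bool"
  where
  "has_fderiv X Y U f x D \<longleftrightarrow> D \<in> carr (blmaps X Y) \<and>
     (\<forall>e>0. \<exists>d>0. \<forall>h\<in>carr X. nrm X h < d \<and> x + h \<in> U
        \<longrightarrow> nrm Y (f (x + h) - f x - D h) \<le> e * nrm X h)"

text \<open>Smooth means infinitely often Frechet differentiable on the open set \<open>U\<close>.  Here \<open>D k x\<close> is
  the \<open>k\<close>-th derivative at \<open>x\<close> as a bounded \<open>k\<close>-linear map, and \<open>D (Suc k)\<close> is the Frechet
  derivative of \<open>D k\<close> under the identification of \<open>L(X, L\<^sup>k(X;Y))\<close> with the bounded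
  \<open>Suc k\<close>-linear maps.\<close>

definition smooth_on ::
  "'v::real_vector nspace \<Rightarrow> 'w::real_vector nspace \<Rightarrow> 'v set \<Rightarrow> ('v \<Rightarrow> 'w) \<Rightarrow> bool" where
  "smooth_on X Y U f \<longleftrightarrow> openin (ntop X) U \<and> (\<forall>x\<in>U. f x \<in> carr Y) \<and>
     (\<exists>D :: nat \<Rightarrow> 'v \<Rightarrow> 'v list \<Rightarrow> 'w.
        (\<forall>x\<in>U. D 0 x [] = f x) \<and>
        (\<forall>k. \<forall>x\<in>U. D k x \<in> carr (mlmaps k X Y) \<and>
           has_fderiv X (mlmaps k X Y) U (D k) x (\<lambda>h vs. D (Suc k) x (h # vs))))"

section \<open>Banach manifolds\<close>

record ('m, 'v) chart =
  cdom :: "'m set"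
  cmap :: "'m \<Rightarrow> 'v"
  cmodel :: "'v nspace"

definition cinv :: "('m, 'v) chart \<Rightarrow> 'v \<Rightarrow> 'm" where
  "cinv c = inv_into (cdom c) (cmap c)"

definition transition :: "('m, 'v) chart \<Rightarrow> ('m, 'v) chart \<Rightarrow> 'v \<Rightarrow> 'v" where
  "transition c d = cmap d \<circ> cinv c"

text \<open>A smooth atlas \<open>A\<close> on the set \<open>M\<close>, whose topology is the one induced by the charts.  As
  usual for Banach manifolds, the model spaces may differ from chart to chart.  (No separation
  axiom is imposed.)\<close>

definition banach_manifold :: "'m set \<Rightarrow> ('m, 'v::real_vector) chart set \<Rightarrow> bool" where
  "banach_manifold M A \<longleftrightarrow> (\<Union>c\<in>A. cdom c) = M \<and>
     (\<forall>c\<in>A. banach_space (cmodel c) \<and> inj_on (cmap c) (cdom c) \<and>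
        openin (ntop (cmodel c)) (cmap c ` cdom c)) \<and>
     (\<forall>c\<in>A. \<forall>d\<in>A.
        smooth_on (cmodel c) (cmodel d) (cmap c ` (cdom c \<inter> cdom d)) (transition c d))"

definition mopen :: "('m, 'v::real_vector) chart set \<Rightarrow> 'm set \<Rightarrow> bool" where
  "mopen A W \<longleftrightarrow> W \<subseteq> (\<Union>c\<in>A. cdom c) \<and>
     (\<forall>c\<in>A. openin (ntop (cmodel c)) (cmap c ` (W \<inter> cdom c)))"

text \<open>A tangent vector at \<open>p\<close> is the family of its coordinate representations in all the charts
  around \<open>p\<close> (and \<open>0\<close> at all other charts); these are related by the derivatives of the
  transition maps.\<close>

definition tangent_space ::
  "('m, 'v::real_vector) chart set \<Rightarrow> 'm \<Rightarrow> (('m, 'v) chart \<Rightarrow> 'v) set" where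
  "tangent_space A p = {\<xi>.
     (\<forall>c. \<not> (c \<in> A \<and> p \<in> cdom c) \<longrightarrow> \<xi> c = 0) \<and>
     (\<forall>c\<in>A. p \<in> cdom c \<longrightarrow> \<xi> c \<in> carr (cmodel c)) \<and>
     (\<forall>c\<in>A. \<forall>d\<in>A. p \<in> cdom c \<inter> cdom d \<longrightarrow>
        (\<exists>D. has_fderiv (cmodel c) (cmodel d) (cmap c ` (cdom c \<inter> cdom d))
               (transition c d) (cmap c p) D \<and> \<xi> d = D (\<xi> c)))}"

text \<open>The tangent space carries no preferred norm; each chart around \<open>p\<close> provides one, and all
  these norms are equivalent.\<close>

definition tangent_nspace ::
  "('m, 'v::real_vector) chart set \<Rightarrow> ('m, 'v) chart \<Rightarrow> 'm \<Rightarrow> (('m, 'v) chart \<Rightarrow> 'v) nspace" where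
  "tangent_nspace A c p = \<lparr>carr = tangent_space A p, nrm = (\<lambda>\<xi>. nrm (cmodel c) (\<xi> c))\<rparr>"

definition tangent_vec ::
  "('m, 'v::real_vector) chart set \<Rightarrow> ('m, 'v) chart \<Rightarrow> 'm \<Rightarrow> 'v \<Rightarrow> ('m, 'v) chart \<Rightarrow> 'v" where
  "tangent_vec A c p = inv_into (tangent_space A p) (\<lambda>\<xi>. \<xi> c)"

section \<open>Banach vector bundles and subbundles\<close>

text \<open>Over a manifold \<open>(M, A)\<close> a bundle is given by its fibres \<open>E p\<close> and a set \<open>T\<close> of
  trivializations; its total space is the set of pairs \<open>(p, e)\<close> with \<open>e \<in> E p\<close>.
  A trivialization over \<open>tdom t\<close> is the map \<open>(p, e) \<mapsto> (p, tmap t p e)\<close> onto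
  \<open>tdom t \<times> carr (tfib t)\<close>.\<close>

record ('m, 'f, 'y) triv =
  tdom :: "'m set"
  tmap :: "'m \<Rightarrow> 'f \<Rightarrow> 'y"
  tfib :: "'y nspace"

definition fibrewise_iso ::
  "('m, 'v::real_vector) chart set \<Rightarrow> ('m \<Rightarrow> 'f::real_vector set)
     \<Rightarrow> ('m, 'f, 'y::real_vector) triv \<Rightarrow> bool" where
  "fibrewise_iso A E t \<longleftrightarrow> mopen A (tdom t) \<and> banach_space (tfib t) \<and>
     (\<forall>p\<in>tdom t. lin_on (E p) (carr (tfib t)) (tmap t p) \<and>
        bij_betw (tmap t p) (E p) (carr (tfib t)))"

definition triv_change ::
  "('m \<Rightarrow> 'f set) \<Rightarrow> ('m, 'f, 'y::zero) triv \<Rightarrow> ('m, 'f, 'y) triv \<Rightarrow> 'm \<Rightarrow> 'y \<Rightarrow> 'y" where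
  "triv_change E t s p = zero_ext (carr (tfib t)) (tmap s p \<circ> inv_into (E p) (tmap t p))"

definition smooth_change ::
  "('m, 'v::real_vector) chart set \<Rightarrow> ('m \<Rightarrow> 'f::real_vector set)
     \<Rightarrow> ('m, 'f, 'y::real_vector) triv \<Rightarrow> ('m, 'f, 'y) triv \<Rightarrow> bool" where
  "smooth_change A E t s \<longleftrightarrow>
     (\<forall>c\<in>A. smooth_on (cmodel c) (blmaps (tfib t) (tfib s))
        (cmap c ` (cdom c \<inter> tdom t \<inter> tdom s)) (\<lambda>x. triv_change E t s (cinv c x)))"

text \<open>The local trivializations of the bundle are all those compatible with \<open>T\<close>, not only the
  members of \<open>T\<close>.  Their fibres share the ambient type of the fibres occurring in \<open>T\<close>, which is
  no restriction up to isomorphism because \<open>T\<close> covers the base.\<close>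

definition local_trivialization ::
  "('m, 'v::real_vector) chart set \<Rightarrow> ('m \<Rightarrow> 'f::real_vector set)
     \<Rightarrow> ('m, 'f, 'y::real_vector) triv set \<Rightarrow> ('m, 'f, 'y) triv \<Rightarrow> bool" where
  "local_trivialization A E T t \<longleftrightarrow> fibrewise_iso A E t \<and>
     (\<forall>s\<in>T. smooth_change A E t s \<and> smooth_change A E s t)"

definition banach_vector_bundle ::
  "'m set \<Rightarrow> ('m, 'v::real_vector) chart set \<Rightarrow> ('m \<Rightarrow> 'f::real_vector set)
     \<Rightarrow> ('m, 'f, 'y::real_vector) triv set \<Rightarrow> bool" where
  "banach_vector_bundle M A E T \<longleftrightarrow> banach_manifold M A \<and>
     (\<forall>p\<in>M. subspace (E p)) \<and> (\<Union>t\<in>T. tdom t) = M \<and>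
     (\<forall>t\<in>T. local_trivialization A E T t)"

definition banach_subbundle ::
  "'m set \<Rightarrow> ('m, 'v::real_vector) chart set \<Rightarrow> ('m \<Rightarrow> 'f::real_vector set)
     \<Rightarrow> ('m, 'f, 'y::real_vector) triv set \<Rightarrow> ('m \<times> 'f) set \<Rightarrow> bool" where
  "banach_subbundle M A E T S \<longleftrightarrow> banach_vector_bundle M A E T \<and> S \<subseteq> Sigma M E \<and>
     (\<forall>p\<in>M. \<exists>t Z. local_trivialization A E T t \<and> p \<in> tdom t \<and>
        subspace Z \<and> closedin (ntop (tfib t)) Z \<and>
        (\<lambda>(q, e). (q, tmap t q e)) ` (S \<inter> (tdom t \<times> UNIV)) = tdom t \<times> Z)"

section \<open>Cotangent and precotangent bundles\<close>

text \<open>By equivalence of the norms, the choice of the chart \<open>c\<close> is immaterial.\<close>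

definition cotangent_space ::
  "('m, 'v::real_vector) chart set \<Rightarrow> 'm \<Rightarrow> ((('m, 'v) chart \<Rightarrow> 'v) \<Rightarrow> real) set" where
  "cotangent_space A p =
     {\<mu>. \<exists>c\<in>A. p \<in> cdom c \<and> \<mu> \<in> carr (ndual (tangent_nspace A c p))}"

text \<open>A chart identifies \<open>T\<^sub>pM\<close> with its model space, hence the cotangent space at \<open>p\<close> with the
  dual of the model space.\<close>

definition cotangent_triv ::
  "('m, 'v::real_vector) chart set \<Rightarrow> ('m, 'v) chart
     \<Rightarrow> ('m, (('m, 'v) chart \<Rightarrow> 'v) \<Rightarrow> real, 'v \<Rightarrow> real) triv" where
  "cotangent_triv A c =
     \<lparr>tdom = cdom c,
      tmap = (\<lambda>p \<mu>. zero_ext (carr (cmodel c)) (\<lambda>v. \<mu> (tangent_vec A c p v))),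
      tfib = ndual (cmodel c)\<rparr>"

definition precotangent_bundle ::
  "'m set \<Rightarrow> ('m, 'v::real_vector) chart set
     \<Rightarrow> ('m \<times> ((('m, 'v) chart \<Rightarrow> 'v) \<Rightarrow> real)) set \<Rightarrow> bool" where
  "precotangent_bundle M A P \<longleftrightarrow>
     banach_subbundle M A (cotangent_space A) (cotangent_triv A ` A) P \<and>
     (\<forall>p\<in>M. \<forall>c\<in>A. p \<in> cdom c \<longrightarrow>
        banach_iso (tangent_nspace A c p)
          (ndual (nsub (ndual (tangent_nspace A c p)) (P `` {p})))
          (\<lambda>\<xi>. zero_ext (P `` {p}) (\<lambda>\<mu>. \<mu> \<xi>)))"

section \<open>The Grassmannian\<close>

definition closed_compl :: "'e::real_normed_vector set \<Rightarrow> 'e set \<Rightarrow> bool" where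
  "closed_compl F G \<longleftrightarrow> subspace F \<and> closed F \<and> subspace G \<and> closed G \<and>
     F \<inter> G = {0} \<and> (\<forall>x. \<exists>f\<in>F. \<exists>g\<in>G. x = f + g)"

definition Gr :: "'e::real_normed_vector set set" where
  "Gr = {F. \<exists>G. closed_compl F G}"

text \<open>\<open>proj_along F G\<close> is the projection onto \<open>G\<close> with kernel \<open>F\<close>.\<close>

definition proj_along :: "'e::real_normed_vector set \<Rightarrow> 'e set \<Rightarrow> 'e \<Rightarrow> 'e" where
  "proj_along F G x = (THE g. g \<in> G \<and> x - g \<in> F)"

definition gr_chart :: "'e::real_normed_vector set \<Rightarrow> 'e set \<Rightarrow> ('e set, 'e \<Rightarrow> 'e) chart" where
  "gr_chart F G =
     \<lparr>cdom = {H \<in> Gr. closed_compl H G},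
      cmap = (\<lambda>H. zero_ext F (\<lambda>f. proj_along F G (inv_into H (proj_along G F) f))),
      cmodel = blmaps (nspace_of F) (nspace_of G)\<rparr>"

definition gr_atlas :: "('e::real_normed_vector set, 'e \<Rightarrow> 'e) chart set" where
  "gr_atlas = {gr_chart F G | F G. closed_compl F G}"

definition reflexive_space :: "'e::banach itself \<Rightarrow> bool" where
  "reflexive_space _ \<longleftrightarrow>
     (\<forall>\<phi> :: ('e \<Rightarrow>\<^sub>L real) \<Rightarrow>\<^sub>L real. \<exists>x :: 'e. \<forall>f. blinfun_apply \<phi> f = blinfun_apply f x)"

end

theory Submission
  imports Defs
begin

text \<open>
  The model space \<open>L(F,G)\<close> is the dual of the closed span \<open>Z\<close> of the functionals \<open>\<gamma> \<otimes> f : A \<mapsto> \<gamma>(A f)\<close> in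
  its dual: a functional \<open>\<phi>\<close> on \<open>Z\<close> yields for each \<open>f\<close> the functional \<open>\<gamma> \<mapsto> \<phi>(\<gamma> \<otimes> f)\<close> on the dual of
  \<open>E\<close>, which by reflexivity is evaluation at a vector \<open>A f\<close>, and \<open>\<phi>\<close> is evaluation at \<open>A\<close>.  Let \<open>\<Pi>\<close> be
  the projection onto \<open>H\<close> along \<open>G'\<close>.  At the point \<open>H\<close> the transition from the chart \<open>(F,G)\<close> to
  \<open>(F',G')\<close> has the derivative \<open>v \<mapsto> (1 - \<Pi>) v \<pi> \<Pi>\<close> with \<open>\<pi>\<close> the projection onto \<open>F\<close> along \<open>G\<close>; its
  transpose maps \<open>\<gamma> \<otimes> f\<close> to \<open>(\<gamma> (1 - \<Pi>)) \<otimes> (\<pi> \<Pi> f)\<close>, so the spaces \<open>Z\<close> fit together to a subbundle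
  which is constant in the charts.  Smoothness of all transitions reduces to that of \<open>\<Pi>\<close> as a function of
  the coordinate of \<open>H\<close>, which solves the differential equation \<open>\<Pi>' h = (1 - \<Pi>) h \<Pi>\<close>.
\<close>

section \<open>Normed spaces with explicit carriers\<close>

text \<open>In a chart the new coordinate involves the inverse of a map between subspaces that vary
  with the point, and iterated derivatives of such an inverse would be unwieldy. They are avoided
  because two values of \<open>\<Pi>\<close> satisfy the exact identity \<open>\<Pi>\<^sub>K -
  \<Pi>\<^sub>H = (1 - \<Pi>\<^sub>K) (R\<^sub>K - R\<^sub>H) \<Pi>\<^sub>H\<close>, where
  \<open>R\<close>, the projection onto the same subspace along \<open>G\<close>, is affine in the
  coordinate. This identity alone bounds \<open>\<Pi>\<close> locally, makes it continuous and
  yields the differential equation; as the right-hand side of the equation is polynomial in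
  \<open>\<Pi>\<close>, the product rule gives explicit derivatives of every order. All of this
  happens among the operators on \<open>E\<close>, into which \<open>L(F,G)\<close> is embedded. The
  image of a chart domain there need not be open, so derivatives are taken within a set.
  Invariantly, the tangent space at \<open>H\<close> consists of the operators from \<open>H\<close>
  to \<open>E/H\<close>, and a chart represents \<open>H\<close> by \<open>F\<close> and
  \<open>E/H\<close> by \<open>G\<close>. This explains the cocycle rule for the derivatives, and
  why their transposes respect functionals built from one vector and one functional.\<close>

lemma normed_spaceD:
  assumes "normed_space X"
  shows "subspace (carr X)"
    and "x \<in> carr X \<Longrightarrow> 0 \<le> nrm X x"
    and "x \<in> carr X \<Longrightarrow> nrm X x = 0 \<longleftrightarrow> x = 0"
    and "x \<in> carr X \<Longrightarrow> y \<in> carr X \<Longrightarrow> nrm X (x + y) \<le> nrm X x + nrm X y"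
    and "x \<in> carr X \<Longrightarrow> nrm X (r *\<^sub>R x) = \<bar>r\<bar> * nrm X x"
    and "x \<in> carr X \<Longrightarrow> y \<in> carr X \<Longrightarrow> x + y \<in> carr X"
    and "x \<in> carr X \<Longrightarrow> y \<in> carr X \<Longrightarrow> x - y \<in> carr X"
    and "x \<in> carr X \<Longrightarrow> r *\<^sub>R x \<in> carr X"
    and "0 \<in> carr X"
    and "nrm X 0 = 0"
    and "x \<in> carr X \<Longrightarrow> - x \<in> carr X"
    and "x \<in> carr X \<Longrightarrow> nrm X (- x) = nrm X x"
    and "x \<in> carr X \<Longrightarrow> y \<in> carr X \<Longrightarrow> nrm X (x - y) \<le> nrm X x + nrm X y"
proof -
  have s: "subspace (carr X)"
    and nz: "\<And>x. x \<in> carr X \<Longrightarrow> 0 \<le> nrm X x \<and> (nrm X x = 0 \<longleftrightarrow> x = 0)"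
    and tri: "\<And>x y. x \<in> carr X \<Longrightarrow> y \<in> carr X \<Longrightarrow> nrm X (x + y) \<le> nrm X x + nrm X y"
    and scl: "\<And>r x. x \<in> carr X \<Longrightarrow> nrm X (r *\<^sub>R x) = \<bar>r\<bar> * nrm X x"
    using assms by (auto simp: normed_space_def)
  show "subspace (carr X)" by (rule s)
  show "x \<in> carr X \<Longrightarrow> 0 \<le> nrm X x" "x \<in> carr X \<Longrightarrow> nrm X x = 0 \<longleftrightarrow> x = 0" for x
    using nz by auto
  show "x \<in> carr X \<Longrightarrow> y \<in> carr X \<Longrightarrow> nrm X (x + y) \<le> nrm X x + nrm X y" for x y by (rule tri)
  show "x \<in> carr X \<Longrightarrow> nrm X (r *\<^sub>R x) = \<bar>r\<bar> * nrm X x" for r x by (rule scl)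
  show "x \<in> carr X \<Longrightarrow> y \<in> carr X \<Longrightarrow> x + y \<in> carr X"
    "x \<in> carr X \<Longrightarrow> y \<in> carr X \<Longrightarrow> x - y \<in> carr X"
    "x \<in> carr X \<Longrightarrow> r *\<^sub>R x \<in> carr X" "0 \<in> carr X" "x \<in> carr X \<Longrightarrow> - x \<in> carr X" for x y r
    using s by (simp_all add: subspace_add subspace_diff subspace_scale subspace_0 subspace_neg)
  show "nrm X 0 = 0" using nz[of 0] subspace_0[OF s] by simp
  show "x \<in> carr X \<Longrightarrow> nrm X (- x) = nrm X x" for x using scl[of x "-1"] by simp
  then show "x \<in> carr X \<Longrightarrow> y \<in> carr X \<Longrightarrow> nrm X (x - y) \<le> nrm X x + nrm X y" for x y
    using tri[of x "- y"] subspace_neg[OF s, of y] by simp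
qed

section \<open>Open sets, closed sets and closures for a norm on a carrier\<close>

lemma openin_ntop:
  assumes "normed_space X"
  shows "openin (ntop X) U \<longleftrightarrow>
    U \<subseteq> carr X \<and> (\<forall>x\<in>U. \<exists>r>0. \<forall>h\<in>carr X. nrm X h < r \<longrightarrow> x + h \<in> U)"
proof -
  interpret Metric_space "carr X" "ndist X" by (rule normed_space_Metric_space[OF assms])
  note X = normed_spaceD[OF assms]
  have *: "mball x r \<subseteq> U \<longleftrightarrow> (\<forall>h\<in>carr X. nrm X h < r \<longrightarrow> x + h \<in> U)" if "x \<in> carr X" for x r
  proof
    assume L: "mball x r \<subseteq> U"
    show "\<forall>h\<in>carr X. nrm X h < r \<longrightarrow> x + h \<in> U"
    proof (intro ballI impI)
      fix h assume "h \<in> carr X" "nrm X h < r"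
      then have "x + h \<in> mball x r" using that X(6,12) by (simp add: ndist_def)
      then show "x + h \<in> U" using L by auto
    qed
  next
    assume R: "\<forall>h\<in>carr X. nrm X h < r \<longrightarrow> x + h \<in> U"
    show "mball x r \<subseteq> U"
    proof
      fix y assume y: "y \<in> mball x r"
      then have "y - x \<in> carr X" "nrm X (y - x) < r"
        using that X(7) X(12)[of "y - x"] by (auto simp: ndist_def)
      then show "y \<in> U" using R by force
    qed
  qed
  show ?thesis
    unfolding ntop_def openin_mtopology
  proof (intro conj_cong refl)
    assume U: "U \<subseteq> carr X"
    show "(\<forall>x. x \<in> U \<longrightarrow> (\<exists>r>0. mball x r \<subseteq> U)) \<longleftrightarrow>
        (\<forall>x\<in>U. \<exists>r>0. \<forall>h\<in>carr X. nrm X h < r \<longrightarrow> x + h \<in> U)"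
      using *[OF subsetD[OF U]] by (simp, blast)
  qed
qed

lemma topspace_ntop: "normed_space X \<Longrightarrow> topspace (ntop X) = carr X"
  unfolding ntop_def by (intro Metric_space.topspace_mtopology normed_space_Metric_space)

lemma closedin_ntopI:
  assumes "normed_space X" "Z \<subseteq> carr X"
    and cl: "\<And>x. x \<in> carr X \<Longrightarrow> (\<And>e. e > 0 \<Longrightarrow> \<exists>z\<in>Z. nrm X (z - x) < e) \<Longrightarrow> x \<in> Z"
  shows "closedin (ntop X) Z"
  unfolding closedin_def topspace_ntop[OF assms(1)] openin_ntop[OF assms(1)]
proof (intro conjI assms ballI)
  note X = normed_spaceD[OF assms(1)]
  fix x assume x: "x \<in> carr X - Z"
  then obtain e where e: "e > 0" "\<And>z. z \<in> Z \<Longrightarrow> \<not> nrm X (z - x) < e" using cl by blast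
  have "x + h \<in> carr X - Z" if "h \<in> carr X" "nrm X h < e" for h
    using that x X(6)[of x h] e(2)[of "x + h"] by auto
  then show "\<exists>r>0. \<forall>h\<in>carr X. nrm X h < r \<longrightarrow> x + h \<in> carr X - Z" using e(1) by blast
qed auto

text \<open>The closure is formed inside the carrier, where the norm is meaningful. The error bound
  is weak (\<open>\<le>\<close>) because operator norms are suprema, and the lemmas that estimate
  them give weak bounds.\<close>

definition nclosure :: "'v::real_vector nspace \<Rightarrow> 'v set \<Rightarrow> 'v set" where
  "nclosure X S = {x \<in> carr X. \<forall>e>0. \<exists>s\<in>S. nrm X (x - s) \<le> e}"

lemma subspace_nclosure:
  assumes "normed_space X" "subspace S" "S \<subseteq> carr X"
  shows "subspace (nclosure X S)"
proof (rule subspaceI)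
  note X = normed_spaceD[OF assms(1)]
  show "0 \<in> nclosure X S"
    using X(9,10) subspace_0[OF assms(2)] by (force simp: nclosure_def)
  fix x assume x: "x \<in> nclosure X S"
  show "x + y \<in> nclosure X S" if y: "y \<in> nclosure X S" for y
    unfolding nclosure_def
  proof (intro CollectI conjI allI impI)
    show "x + y \<in> carr X" using x y X(6) by (simp add: nclosure_def)
    fix e :: real assume "e > 0"
    then have "e / 2 > 0" by simp
    then obtain s t where st: "s \<in> S" "nrm X (x - s) \<le> e / 2" "t \<in> S" "nrm X (y - t) \<le> e / 2"
      using x y unfolding nclosure_def by blast
    then have "nrm X ((x - s) + (y - t)) \<le> e / 2 + e / 2"
      using x y assms(3) by (intro order_trans[OF X(4)] add_mono X(7)) (auto simp: nclosure_def)
    then show "\<exists>u\<in>S. nrm X (x + y - u) \<le> e"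
      using subspace_add[OF assms(2) st(1,3)] by (intro bexI[of _ "s + t"]) (auto simp: algebra_simps)
  qed
  show "r *\<^sub>R x \<in> nclosure X S" for r
    unfolding nclosure_def
  proof (intro CollectI conjI allI impI)
    show "r *\<^sub>R x \<in> carr X" using x X(8) by (simp add: nclosure_def)
    fix e :: real assume e: "e > 0"
    then have d: "e / (\<bar>r\<bar> + 1) > 0" "\<bar>r\<bar> * (e / (\<bar>r\<bar> + 1)) \<le> e" by (auto simp: field_simps)
    then obtain s where s: "s \<in> S" "nrm X (x - s) \<le> e / (\<bar>r\<bar> + 1)"
      using x unfolding nclosure_def by blast
    have "x - s \<in> carr X" using x s(1) assms(3) by (auto simp: nclosure_def intro: X(7))
    then have "nrm X (r *\<^sub>R x - r *\<^sub>R s) \<le> e"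
      using X(5)[of "x - s" r] mult_left_mono[OF s(2), of "\<bar>r\<bar>"] d(2) by (simp add: scaleR_diff_right)
    then show "\<exists>u\<in>S. nrm X (r *\<^sub>R x - u) \<le> e" using subspace_scale[OF assms(2) s(1)] by blast
  qed
qed

lemma subset_nclosure: "normed_space X \<Longrightarrow> S \<subseteq> carr X \<Longrightarrow> S \<subseteq> nclosure X S"
  using normed_spaceD(10) by (force simp: nclosure_def)

lemma closedin_nclosure:
  assumes "normed_space X" "S \<subseteq> carr X"
  shows "closedin (ntop X) (nclosure X S)"
proof (rule closedin_ntopI[OF assms(1)])
  note X = normed_spaceD[OF assms(1)]
  fix x assume x: "x \<in> carr X" and ap: "\<And>e. e > 0 \<Longrightarrow> \<exists>z\<in>nclosure X S. nrm X (z - x) < e"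
  show "x \<in> nclosure X S"
    unfolding nclosure_def
  proof (intro CollectI conjI allI impI x)
    fix e :: real assume "e > 0"
    then have e: "e / 2 > 0" by simp
    then obtain z where z: "z \<in> carr X" "nrm X (z - x) < e / 2" "\<exists>s\<in>S. nrm X (z - s) \<le> e / 2"
      using ap[of "e / 2"] unfolding nclosure_def by blast
    then obtain s where s: "s \<in> S" "nrm X (z - s) \<le> e / 2" by blast
    have "nrm X ((z - s) - (z - x)) \<le> nrm X (z - s) + nrm X (z - x)"
      by (intro X(13) X(7)) (use z(1) s(1) x assms(2) in auto)
    then have "nrm X (x - s) \<le> e" using z(2) s(2) by simp
    then show "\<exists>s\<in>S. nrm X (x - s) \<le> e" using s(1) by blast
  qed
qed (simp add: nclosure_def)

section \<open>Completeness in terms of Cauchy sequences\<close>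

lemma banach_spaceI:
  assumes "normed_space X"
    and lim: "\<And>s::nat \<Rightarrow> _. (\<And>n. s n \<in> carr X) \<Longrightarrow>
      (\<And>e. e > 0 \<Longrightarrow> \<exists>N. \<forall>m\<ge>N. \<forall>n\<ge>N. nrm X (s m - s n) < e) \<Longrightarrow>
      \<exists>l\<in>carr X. \<forall>e>0. \<exists>N. \<forall>n\<ge>N. nrm X (s n - l) < e"
  shows "banach_space X"
  unfolding banach_space_def
proof
  interpret Metric_space "carr X" "ndist X" by (rule normed_space_Metric_space[OF assms(1)])
  show "mcomplete"
    unfolding mcomplete_def
  proof (intro allI impI)
    fix s assume s: "MCauchy s"
    then have c: "s n \<in> carr X" for n by (auto simp: MCauchy_def)
    then have "\<exists>l\<in>carr X. \<forall>e>0. \<exists>N. \<forall>n\<ge>N. nrm X (s n - l) < e"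
      using s by (intro lim) (auto simp: MCauchy_def ndist_def)
    then show "\<exists>x. limitin mtopology s x sequentially"
      using c by (auto simp: limitin_metric ndist_def eventually_sequentially)
  qed
qed (fact assms)

lemma banach_space_lim:
  fixes s :: "nat \<Rightarrow> 'v::real_vector"
  assumes "banach_space X" "\<And>n. s n \<in> carr X"
    and "\<And>e. e > 0 \<Longrightarrow> \<exists>N. \<forall>m\<ge>N. \<forall>n\<ge>N. nrm X (s m - s n) < e"
  obtains l where "l \<in> carr X" "\<And>e. e > 0 \<Longrightarrow> \<exists>N. \<forall>n\<ge>N. nrm X (s n - l) < e"
proof -
  interpret Metric_space "carr X" "ndist X"
    using assms(1) by (simp add: banach_space_def normed_space_Metric_space)
  have "MCauchy s" using assms(2,3) by (auto simp: MCauchy_def ndist_def)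
  then obtain l where "limitin mtopology s l sequentially"
    using assms(1) by (auto simp: banach_space_def mcomplete_def)
  then show thesis
    using assms(2) by (intro that[of l]) (auto simp: limitin_metric ndist_def eventually_sequentially)
qed

lemma normed_space_nspace_of: "subspace F \<Longrightarrow> normed_space (nspace_of F)"
  by (auto simp: normed_space_def nspace_of_def norm_triangle_ineq)

lemma nspace_of_simps [simp]: "carr (nspace_of F) = F" "nrm (nspace_of F) = norm"
  by (simp_all add: nspace_of_def)

lemma banach_space_nspace_of:
  fixes F :: "'a::banach set"
  assumes "subspace F" "closed F"
  shows "banach_space (nspace_of F)"
proof (rule banach_spaceI[OF normed_space_nspace_of[OF assms(1)]])
  fix s :: "nat \<Rightarrow> 'a" assume s: "\<And>n. s n \<in> carr (nspace_of F)"
    and C: "\<And>e. e > 0 \<Longrightarrow> \<exists>N. \<forall>m\<ge>N. \<forall>n\<ge>N. nrm (nspace_of F) (s m - s n) < e"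
  have "Cauchy s" using C by (auto simp: Cauchy_iff)
  then obtain l where l: "s \<longlonglongrightarrow> l" using Cauchy_convergent convergent_def by blast
  then have "l \<in> F" using s assms(2) by (metis closed_sequentially nspace_of_simps(1))
  then show "\<exists>l\<in>carr (nspace_of F). \<forall>e>0. \<exists>N. \<forall>n\<ge>N. nrm (nspace_of F) (s n - l) < e"
    using l by (auto simp: LIMSEQ_iff)
qed

section \<open>Bounded linear maps and dual spaces\<close>

lemma lin_onD:
  assumes "lin_on V W f"
  shows "x \<in> V \<Longrightarrow> f x \<in> W" "x \<in> V \<Longrightarrow> y \<in> V \<Longrightarrow> f (x + y) = f x + f y"
    "x \<in> V \<Longrightarrow> f (r *\<^sub>R x) = r *\<^sub>R f x"
  using assms by (auto simp: lin_on_def)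

lemma lin_on_0: "lin_on V W f \<Longrightarrow> 0 \<in> V \<Longrightarrow> f 0 = 0"
  using lin_onD(3)[of V W f 0 0] by simp

lemma lin_on_diff:
  assumes "lin_on V W f" "subspace V" "x \<in> V" "y \<in> V"
  shows "f (x - y) = f x - f y"
proof -
  have "f (x + (-1) *\<^sub>R y) = f x + (-1) *\<^sub>R f y"
    using assms by (metis lin_onD(2,3) subspace_scale)
  then show ?thesis by simp
qed

lemma blmaps_carrD:
  assumes "f \<in> carr (blmaps X Y)"
  shows "lin_on (carr X) (carr Y) f" "x \<in> carr X \<Longrightarrow> f x \<in> carr Y" "x \<notin> carr X \<Longrightarrow> f x = 0"
  using assms by (auto simp: blmaps_def lin_on_def)

lemma blmaps_carrI:
  assumes "lin_on (carr X) (carr Y) f" "\<And>x. x \<notin> carr X \<Longrightarrow> f x = 0"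
    "\<And>x. x \<in> carr X \<Longrightarrow> nrm Y (f x) \<le> K * nrm X x"
  shows "f \<in> carr (blmaps X Y)"
  using assms by (auto simp: blmaps_def)

lemma blmaps_ext:
  assumes "f \<in> carr (blmaps X Y)" "g \<in> carr (blmaps X Y)" "\<And>x. x \<in> carr X \<Longrightarrow> f x = g x"
  shows "f = g"
  using assms blmaps_carrD(3) by (metis ext)

lemma blmaps_bdd_above:
  assumes "normed_space X" "f \<in> carr (blmaps X Y)"
  shows "bdd_above {nrm Y (f x) | x. x \<in> carr X \<and> nrm X x \<le> 1}"
proof -
  obtain K where K: "\<And>x. x \<in> carr X \<Longrightarrow> nrm Y (f x) \<le> K * nrm X x"
    using assms(2) by (auto simp: blmaps_def)
  show ?thesis
  proof (rule bdd_aboveI[of _ "\<bar>K\<bar>"], clarify)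
    fix x assume x: "x \<in> carr X" "nrm X x \<le> 1"
    then have "nrm Y (f x) \<le> K * nrm X x" using K by simp
    also have "\<dots> \<le> \<bar>K\<bar> * 1"
      by (intro mult_mono) (use x normed_spaceD(2)[OF assms(1)] in auto)
    finally show "nrm Y (f x) \<le> \<bar>K\<bar>" by simp
  qed
qed

lemma blmaps_bound:
  assumes X: "normed_space X" and Y: "normed_space Y"
    and f: "f \<in> carr (blmaps X Y)" and x: "x \<in> carr X"
  shows "nrm Y (f x) \<le> nrm (blmaps X Y) f * nrm X x"
proof -
  note X = normed_spaceD[OF X] and Y = normed_spaceD[OF Y] and f' = blmaps_carrD[OF f]
  show ?thesis
  proof (cases "x = 0")
    case True
    then show ?thesis using lin_on_0[OF f'(1) X(9)] X(10) Y(10) by simp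
  next
    case False
    then have n: "nrm X x > 0" using X(2,3) x by force
    let ?y = "(1 / nrm X x) *\<^sub>R x"
    have y: "?y \<in> carr X" "nrm X ?y \<le> 1" using X(5)[OF x] X(8) x n by auto
    have "nrm Y (f ?y) \<le> nrm (blmaps X Y) f"
      unfolding blmaps_def nspace.simps by (rule cSup_upper[OF _ blmaps_bdd_above[OF assms(1) f]]) (use y in blast)
    moreover have "nrm Y (f ?y) = nrm Y (f x) / nrm X x"
      using lin_onD(3)[OF f'(1) x] Y(5)[OF f'(2)[OF x]] n by simp
    ultimately show ?thesis using n by (simp add: pos_divide_le_eq)
  qed
qed

lemma nrm_blmaps_nonneg:
  assumes "normed_space X" "normed_space Y" "f \<in> carr (blmaps X Y)"
  shows "0 \<le> nrm (blmaps X Y) f"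
proof -
  note X = normed_spaceD[OF assms(1)] and Y = normed_spaceD[OF assms(2)]
  note f' = blmaps_carrD[OF assms(3)]
  have "0 = nrm Y (f 0)" using lin_on_0[OF f'(1) X(9)] Y(10) by simp
  also have "\<dots> \<le> nrm (blmaps X Y) f"
    unfolding blmaps_def nspace.simps
    by (rule cSup_upper[OF _ blmaps_bdd_above[OF assms(1,3)]]) (use X(9,10) in force)
  finally show ?thesis .
qed

lemma nrm_blmaps_le:
  assumes "normed_space X" "normed_space Y" "0 \<le> K"
    and "\<And>x. x \<in> carr X \<Longrightarrow> nrm Y (f x) \<le> K * nrm X x"
  shows "nrm (blmaps X Y) f \<le> K"
  unfolding blmaps_def nspace.simps
proof (rule cSup_least)
  note X = normed_spaceD[OF assms(1)]
  show "{nrm Y (f x) |x. x \<in> carr X \<and> nrm X x \<le> 1} \<noteq> {}" using X(9,10) by force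
  fix r assume "r \<in> {nrm Y (f x) |x. x \<in> carr X \<and> nrm X x \<le> 1}"
  then obtain x where x: "x \<in> carr X" "nrm X x \<le> 1" "r = nrm Y (f x)" by blast
  have "r \<le> K * nrm X x" using assms(4) x by simp
  also have "\<dots> \<le> K * 1" using assms(3) x(2) by (intro mult_left_mono)
  finally show "r \<le> K" by simp
qed

lemma lin_on_add: "lin_on V W f \<Longrightarrow> lin_on V W g \<Longrightarrow> subspace W \<Longrightarrow> lin_on V W (f + g)"
  by (auto simp: lin_on_def subspace_add scaleR_add_right)

lemma lin_on_scale: "lin_on V W f \<Longrightarrow> subspace W \<Longrightarrow> lin_on V W (r *\<^sub>R f)"
  by (auto simp: lin_on_def subspace_scale scaleR_add_right scaleR_fun_def)

lemma normed_space_blmaps: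
  assumes NX: "normed_space X" and NY: "normed_space Y"
  shows "normed_space (blmaps X Y)"
proof -
  note X = normed_spaceD[OF NX] and Y = normed_spaceD[OF NY]
  let ?B = "blmaps X Y"
  note bd = blmaps_bound[OF NX NY] and nn = nrm_blmaps_nonneg[OF NX NY]
  have z: "0 \<in> carr ?B"
    by (rule blmaps_carrI[of _ _ _ 0]) (auto simp: lin_on_def Y(9,10))
  have addb: "nrm Y ((f + g) x) \<le> (nrm ?B f + nrm ?B g) * nrm X x"
    if "f \<in> carr ?B" "g \<in> carr ?B" "x \<in> carr X" for f g x
    using bd[OF that(1,3)] bd[OF that(2,3)] Y(4)[of "f x" "g x"] blmaps_carrD(2)[OF that(1,3)]
      blmaps_carrD(2)[OF that(2,3)] by (simp add: distrib_right)
  have add: "f + g \<in> carr ?B" if "f \<in> carr ?B" "g \<in> carr ?B" for f g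
  proof (rule blmaps_carrI[OF lin_on_add[OF _ _ Y(1)]])
    show "nrm Y ((f + g) x) \<le> (nrm ?B f + nrm ?B g) * nrm X x" if "x \<in> carr X" for x
      by (rule addb) (use that \<open>f \<in> carr ?B\<close> \<open>g \<in> carr ?B\<close> in auto)
  qed (use that in \<open>auto simp: blmaps_carrD\<close>)
  have scb: "nrm Y ((r *\<^sub>R f) x) \<le> (\<bar>r\<bar> * nrm ?B f) * nrm X x"
    if "f \<in> carr ?B" "x \<in> carr X" for f x r
    using mult_left_mono[OF bd[OF that], of "\<bar>r\<bar>"] Y(5)[of "f x"] blmaps_carrD(2)[OF that]
    by (simp add: scaleR_fun_def mult.assoc)
  have sc: "r *\<^sub>R f \<in> carr ?B" if "f \<in> carr ?B" for f r
  proof (rule blmaps_carrI[OF lin_on_scale[OF _ Y(1)]])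
    show "nrm Y ((r *\<^sub>R f) x) \<le> (\<bar>r\<bar> * nrm ?B f) * nrm X x" if "x \<in> carr X" for x
      by (rule scb) (use that \<open>f \<in> carr ?B\<close> in auto)
  qed (use that in \<open>auto simp: scaleR_fun_def blmaps_carrD\<close>)
  have scle: "nrm ?B (r *\<^sub>R f) \<le> \<bar>r\<bar> * nrm ?B f" if "f \<in> carr ?B" for f r
    by (rule nrm_blmaps_le[OF NX NY]) (use that nn scb in auto)
  have "nrm ?B (r *\<^sub>R f) = \<bar>r\<bar> * nrm ?B f" if f: "f \<in> carr ?B" for f r
  proof (cases "r = 0")
    case True
    then show ?thesis using scle[OF f, of 0] nn[OF z] by simp
  next
    case False
    \<comment> \<open>The inequality \<open>scle\<close> is one half of homogeneity; applied with
      the scalar \<open>1/r\<close> it gives the other half.\<close>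
    have "nrm ?B f = nrm ?B ((1/r) *\<^sub>R (r *\<^sub>R f))" using False by simp
    also have "\<dots> \<le> \<bar>1/r\<bar> * nrm ?B (r *\<^sub>R f)" by (rule scle[OF sc[OF f]])
    finally have "\<bar>r\<bar> * nrm ?B f \<le> nrm ?B (r *\<^sub>R f)" using False by (simp add: field_simps)
    then show ?thesis using scle[OF f, of r] by simp
  qed
  moreover have "nrm ?B (f + g) \<le> nrm ?B f + nrm ?B g" if "f \<in> carr ?B" "g \<in> carr ?B" for f g
    by (rule nrm_blmaps_le[OF NX NY]) (use that nn addb in \<open>auto intro: add_nonneg_nonneg\<close>)
  moreover have "f = 0" if f: "f \<in> carr ?B" and "nrm ?B f = 0" for f
  proof (rule blmaps_ext[OF f z])
    fix x assume x: "x \<in> carr X"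
    then have "nrm Y (f x) \<le> 0" using bd[OF f x] that(2) by simp
    then show "f x = 0 x" using Y(2,3)[OF blmaps_carrD(2)[OF f x]] by simp
  qed
  moreover have "nrm ?B 0 = 0" using scle[OF z, of 0] nn[OF z] by simp
  ultimately show ?thesis
    using z add sc nn unfolding normed_space_def subspace_def by auto
qed

text \<open>Completeness of \<open>Y\<close> provides a pointwise limit. The Cauchy property makes
  the convergence uniform relative to \<open>nrm X x\<close>, which gives both boundedness of the
  limit and convergence in the operator norm.\<close>

lemma banach_space_blmaps:
  assumes NX: "normed_space X" and BY: "banach_space Y"
  shows "banach_space (blmaps X Y)"
proof -
  have NY: "normed_space Y" using BY by (simp add: banach_space_def)
  note X = normed_spaceD[OF NX] and Y = normed_spaceD[OF NY]
  let ?B = "blmaps X Y"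
  have NB: "normed_space ?B" by (rule normed_space_blmaps[OF NX NY])
  note B = normed_spaceD[OF NB] and bd = blmaps_bound[OF NX NY]
  show ?thesis
  proof (rule banach_spaceI[OF NB])
    fix s :: "nat \<Rightarrow> _" assume s: "\<And>n. s n \<in> carr ?B"
      and C: "\<And>e. e > 0 \<Longrightarrow> \<exists>N. \<forall>m\<ge>N. \<forall>n\<ge>N. nrm ?B (s m - s n) < e"
    have db: "nrm Y (s m x - s n x) \<le> nrm ?B (s m - s n) * nrm X x" if "x \<in> carr X" for m n x
      using bd[OF B(7)[OF s s] that] by simp
    have sY: "s n x \<in> carr Y" if "x \<in> carr X" for n x using blmaps_carrD(2)[OF s that] .
    have "\<exists>l\<in>carr Y. (\<lambda>n. nrm Y (s n x - l)) \<longlonglongrightarrow> 0" if x: "x \<in> carr X" for x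
    proof (rule banach_space_lim[OF BY, of "\<lambda>n. s n x"])
      fix e :: real assume e: "e > 0"
      have p: "nrm X x + 1 > 0" using X(2)[OF x] by simp
      obtain N where N: "\<forall>m\<ge>N. \<forall>n\<ge>N. nrm ?B (s m - s n) < e / (nrm X x + 1)"
        using C[of "e / (nrm X x + 1)"] e p by auto
      show "\<exists>N. \<forall>m\<ge>N. \<forall>n\<ge>N. nrm Y (s m x - s n x) < e"
      proof (intro exI[of _ N] allI impI)
        fix m n assume "N \<le> m" "N \<le> n"
        then have l: "nrm ?B (s m - s n) < e / (nrm X x + 1)" using N by blast
        have "nrm Y (s m x - s n x) \<le> nrm ?B (s m - s n) * nrm X x" by (rule db[OF x])
        also have "\<dots> \<le> nrm ?B (s m - s n) * (nrm X x + 1)"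
          using B(2)[OF B(7)[OF s s]] by (intro mult_left_mono) auto
        also have "\<dots> < e" using l p by (simp add: pos_less_divide_eq)
        finally show "nrm Y (s m x - s n x) < e" .
      qed
    next
      fix l assume l: "l \<in> carr Y" "\<And>e. e > 0 \<Longrightarrow> \<exists>N. \<forall>n\<ge>N. nrm Y (s n x - l) < e"
      have "\<bar>nrm Y (s n x - l)\<bar> = nrm Y (s n x - l)" for n using Y(2)[OF Y(7)[OF sY[OF x] l(1)]] by simp
      then have "(\<lambda>n. nrm Y (s n x - l)) \<longlonglongrightarrow> 0" using l(2) by (simp add: LIMSEQ_iff)
      then show ?thesis using l(1) by blast
    qed (use sY x in auto)
    then obtain l where l: "\<And>x. x \<in> carr X \<Longrightarrow> l x \<in> carr Y"
      and lim: "\<And>x. x \<in> carr X \<Longrightarrow> (\<lambda>n. nrm Y (s n x - l x)) \<longlonglongrightarrow> 0" by metis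
    define L where "L = zero_ext (carr X) l"
    have L: "L x = l x" if "x \<in> carr X" for x using that by (simp add: L_def zero_ext_def)
    have uni: "\<exists>N. \<forall>n\<ge>N. \<forall>x\<in>carr X. nrm Y (s n x - L x) \<le> e * nrm X x" if e: "e > 0" for e
    proof -
      obtain N where N: "\<forall>m\<ge>N. \<forall>n\<ge>N. nrm ?B (s m - s n) < e" using C[OF e] by blast
      show ?thesis
      proof (intro exI[of _ N] allI impI ballI)
        fix n x assume n: "N \<le> n" and x: "x \<in> carr X"
        \<comment> \<open>With \<open>n\<close> fixed and \<open>m\<close> tending to infinity the
          last summand vanishes.\<close>
        have "nrm Y (s n x - L x) \<le> e * nrm X x + nrm Y (s m x - l x)" if m: "m \<ge> N" for m
        proof -
          have "nrm Y (s n x - L x) \<le> nrm Y (s n x - s m x) + nrm Y (s m x - l x)"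
            using Y(4)[of "s n x - s m x" "s m x - l x"] Y(7) sY[OF x] l[OF x] L[OF x] by simp
          moreover have "nrm ?B (s n - s m) * nrm X x \<le> e * nrm X x"
            using N n m X(2)[OF x] by (intro mult_right_mono) (auto simp: less_imp_le)
          ultimately show ?thesis using db[OF x, of n m] by linarith
        qed
        moreover have "(\<lambda>m. e * nrm X x + nrm Y (s m x - l x)) \<longlonglongrightarrow> e * nrm X x + 0"
          by (intro tendsto_intros lim x)
        ultimately show "nrm Y (s n x - L x) \<le> e * nrm X x"
          using LIMSEQ_le_const[of _ "e * nrm X x + 0"] by auto
      qed
    qed
    \<comment> \<open>The type behind \<open>Y\<close> carries no topology of its own. Uniqueness of
      limits is replaced by the fact that a vector whose norm is bounded by a null sequence is
      zero.\<close>
    have uniq: "a = b" if ab: "a \<in> carr Y" "b \<in> carr Y"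
      and t: "t \<longlonglongrightarrow> 0" and le: "\<And>n::nat. nrm Y (a - b) \<le> t n" for a b t
    proof -
      have "nrm Y (a - b) \<le> 0" by (rule LIMSEQ_le_const[OF t]) (use le in blast)
      then show ?thesis using Y(2,3)[OF Y(7)[OF ab]] by simp
    qed
    have linL: "lin_on (carr X) (carr Y) L"
      unfolding lin_on_def
    proof (intro conjI ballI allI)
      show "L x \<in> carr Y" if "x \<in> carr X" for x using l L that by simp
      show "L (x + y) = L x + L y" if x: "x \<in> carr X" and y: "y \<in> carr X" for x y
      proof (rule uniq)
        note xy = X(6)[OF x y]
        show "L (x + y) \<in> carr Y" "L x + L y \<in> carr Y" using L l Y(6) x y xy by auto
        show "(\<lambda>n. nrm Y (s n x - l x) + nrm Y (s n y - l y) + nrm Y (s n (x+y) - l (x+y))) \<longlonglongrightarrow> 0"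
          using tendsto_add[OF tendsto_add[OF lim[OF x] lim[OF y]] lim[OF xy]] by simp
        fix n
        have *: "L (x + y) - (L x + L y) = (s n x - l x) + (s n y - l y) - (s n (x+y) - l (x+y))"
          using L x y xy lin_onD(2)[OF blmaps_carrD(1)[OF s[of n]] x y] by simp
        show "nrm Y (L (x + y) - (L x + L y)) \<le>
            nrm Y (s n x - l x) + nrm Y (s n y - l y) + nrm Y (s n (x+y) - l (x+y))"
          unfolding * using sY l x y xy Y(7)
          by (intro order_trans[OF Y(13)] add_mono Y(4) order_refl) (auto intro!: Y(6,7))
      qed
      show "L (r *\<^sub>R x) = r *\<^sub>R L x" if x: "x \<in> carr X" for r x
      proof (rule uniq)
        note rx = X(8)[OF x, of r]
        show "L (r *\<^sub>R x) \<in> carr Y" "r *\<^sub>R L x \<in> carr Y" using L l Y(8) x rx by auto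
        show "(\<lambda>n. \<bar>r\<bar> * nrm Y (s n x - l x) + nrm Y (s n (r *\<^sub>R x) - l (r *\<^sub>R x))) \<longlonglongrightarrow> 0"
          using tendsto_add[OF tendsto_mult_left[OF lim[OF x], of "\<bar>r\<bar>"] lim[OF rx]] by simp
        fix n
        have *: "L (r *\<^sub>R x) - r *\<^sub>R L x = r *\<^sub>R (s n x - l x) - (s n (r *\<^sub>R x) - l (r *\<^sub>R x))"
          using L x rx lin_onD(3)[OF blmaps_carrD(1)[OF s[of n]] x] by (simp add: scaleR_diff_right)
        have "nrm Y (L (r *\<^sub>R x) - r *\<^sub>R L x) \<le> nrm Y (r *\<^sub>R (s n x - l x)) + nrm Y (s n (r *\<^sub>R x) - l (r *\<^sub>R x))"
          unfolding * using sY l x rx by (intro Y(13) Y(8) Y(7))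
        then show "nrm Y (L (r *\<^sub>R x) - r *\<^sub>R L x) \<le> \<bar>r\<bar> * nrm Y (s n x - l x) + nrm Y (s n (r *\<^sub>R x) - l (r *\<^sub>R x))"
          using Y(5)[OF Y(7)[OF sY[OF x] l[OF x]]] by simp
      qed
    qed
    obtain N where N: "\<forall>n\<ge>N. \<forall>x\<in>carr X. nrm Y (s n x - L x) \<le> 1 * nrm X x" using uni[of 1] by auto
    have LB: "L \<in> carr ?B"
    proof (rule blmaps_carrI[OF linL, of "nrm ?B (s N) + 1"])
      fix x assume x: "x \<in> carr X"
      have "nrm Y (L x) = nrm Y (s N x - (s N x - L x))" by simp
      also have "\<dots> \<le> nrm Y (s N x) + nrm Y (s N x - L x)"
        using sY x lin_onD(1)[OF linL x] by (intro Y(13) Y(7)) auto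
      also have "\<dots> \<le> nrm ?B (s N) * nrm X x + 1 * nrm X x"
        using bd[OF s x] N x by (intro add_mono) auto
      finally show "nrm Y (L x) \<le> (nrm ?B (s N) + 1) * nrm X x" by (simp add: distrib_right)
    qed (simp add: L_def zero_ext_def)
    show "\<exists>l\<in>carr ?B. \<forall>e>0. \<exists>N. \<forall>n\<ge>N. nrm ?B (s n - l) < e"
    proof (intro bexI[OF _ LB] allI impI)
      fix e :: real assume e: "e > 0"
      then obtain N where N: "\<forall>n\<ge>N. \<forall>x\<in>carr X. nrm Y (s n x - L x) \<le> e/2 * nrm X x"
        using uni[of "e/2"] by auto
      have "nrm ?B (s n - L) \<le> e/2" if "n \<ge> N" for n
        by (rule nrm_blmaps_le[OF NX NY]) (use N e that in auto)
      then show "\<exists>N. \<forall>n\<ge>N. nrm ?B (s n - L) < e" using e by (intro exI[of _ N]) fastforce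
    qed
  qed
qed

lemma normed_space_ndual: "normed_space X \<Longrightarrow> normed_space (ndual X)"
  unfolding ndual_def by (intro normed_space_blmaps normed_space_nspace_of subspace_UNIV)

lemma banach_space_ndual: "normed_space X \<Longrightarrow> banach_space (ndual X)"
  unfolding ndual_def by (intro banach_space_blmaps banach_space_nspace_of subspace_UNIV closed_UNIV)

lemma ndual_bound:
  "normed_space X \<Longrightarrow> \<mu> \<in> carr (ndual X) \<Longrightarrow> x \<in> carr X \<Longrightarrow> \<bar>\<mu> x\<bar> \<le> nrm (ndual X) \<mu> * nrm X x"
  unfolding ndual_def
  using blmaps_bound[OF _ normed_space_nspace_of[OF subspace_UNIV], of X \<mu> x] by simp

lemma ndual_le:
  "normed_space X \<Longrightarrow> 0 \<le> K \<Longrightarrow> (\<And>x. x \<in> carr X \<Longrightarrow> \<bar>\<mu> x\<bar> \<le> K * nrm X x) \<Longrightarrow> nrm (ndual X) \<mu> \<le> K"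
  unfolding ndual_def by (rule nrm_blmaps_le[OF _ normed_space_nspace_of[OF subspace_UNIV]]) auto

lemma ndual_carrI:
  assumes "lin_on (carr X) UNIV \<mu>" "\<And>x. x \<notin> carr X \<Longrightarrow> \<mu> x = 0"
    "\<And>x. x \<in> carr X \<Longrightarrow> \<bar>\<mu> x\<bar> \<le> K * nrm X x"
  shows "\<mu> \<in> carr (ndual X)"
  unfolding ndual_def using assms by (intro blmaps_carrI[of _ _ _ K]) auto

lemma ndual_carrD:
  assumes "\<mu> \<in> carr (ndual X)"
  shows "lin_on (carr X) UNIV \<mu>" "x \<notin> carr X \<Longrightarrow> \<mu> x = 0"
  using assms blmaps_carrD[of \<mu> X "nspace_of UNIV"] by (auto simp: ndual_def)

lemma ndual_ext:
  "\<mu> \<in> carr (ndual X) \<Longrightarrow> \<nu> \<in> carr (ndual X) \<Longrightarrow> (\<And>x. x \<in> carr X \<Longrightarrow> \<mu> x = \<nu> x) \<Longrightarrow> \<mu> = \<nu>"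
  unfolding ndual_def by (rule blmaps_ext)

lemma normed_space_nsub:
  "normed_space X \<Longrightarrow> subspace S \<Longrightarrow> S \<subseteq> carr X \<Longrightarrow> normed_space (nsub X S)"
  unfolding normed_space_def nsub_def by (auto simp: subset_iff)

lemma nsub_simps [simp]: "carr (nsub X S) = S" "nrm (nsub X S) = nrm X"
  by (simp_all add: nsub_def)

section \<open>Preduals of the model spaces and precotangent bundles\<close>

lemma scaleR_fun_apply: "(r *\<^sub>R f) x = r *\<^sub>R f x"
  by (simp add: scaleR_fun_def)

text \<open>As \<open>U\<close> is open, all sufficiently short multiples of a direction
  \<open>v\<close> are admissible increments. Comparing the two remainders along them bounds
  \<open>D v - D' v\<close> by \<open>2 * e * nrm X v\<close> for every \<open>e\<close>. The lemma
  is needed because a tangent vector refers to some derivative of a transition, which has to be the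
  known one.\<close>

lemma has_fderiv_unique:
  assumes NX: "normed_space X" and NY: "normed_space Y"
    and U: "openin (ntop X) U" "x \<in> U" and f: "\<And>x. x \<in> U \<Longrightarrow> f x \<in> carr Y"
    and D: "has_fderiv X Y U f x D" and D': "has_fderiv X Y U f x D'"
  shows "D = D'"
proof (rule blmaps_ext[of _ X Y])
  note X = normed_spaceD[OF NX] and Y = normed_spaceD[OF NY]
  show B: "D \<in> carr (blmaps X Y)" "D' \<in> carr (blmaps X Y)"
    using D D' by (auto simp: has_fderiv_def)
  fix v assume v: "v \<in> carr X"
  have Dv: "D h \<in> carr Y" "D' h \<in> carr Y" if "h \<in> carr X" for h
    using B that by (auto intro: blmaps_carrD)
  have le: "nrm Y (D v - D' v) \<le> 2 * e * nrm X v" if e: "e > 0" for e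
  proof -
    obtain d where d: "d > 0" "\<forall>h\<in>carr X. nrm X h < d \<and> x + h \<in> U
        \<longrightarrow> nrm Y (f (x + h) - f x - D h) \<le> e * nrm X h"
      using D e by (auto simp: has_fderiv_def)
    obtain d' where d': "d' > 0" "\<forall>h\<in>carr X. nrm X h < d' \<and> x + h \<in> U
        \<longrightarrow> nrm Y (f (x + h) - f x - D' h) \<le> e * nrm X h"
      using D' e by (auto simp: has_fderiv_def)
    obtain r where r: "r > 0" "\<forall>h\<in>carr X. nrm X h < r \<longrightarrow> x + h \<in> U"
      using U by (auto simp: openin_ntop[OF NX])
    define m where "m = min d (min d' r)"
    \<comment> \<open>Adding 1 keeps the divisor positive for \<open>v = 0\<close>; halving
      \<open>m\<close> makes the increment strictly shorter than \<open>m\<close>.\<close>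
    define q where "q = nrm X v + 1"
    define t where "t = m / 2 / q"
    have p: "q > 0" "m > 0" using X(2)[OF v] d d' r by (auto simp: m_def q_def)
    then have t: "t > 0" by (simp add: t_def)
    define h where "h = t *\<^sub>R v"
    have h: "h \<in> carr X" "nrm X h = t * nrm X v" using X(8)[OF v] X(5)[OF v] t by (auto simp: h_def)
    have "nrm X h \<le> t * q" unfolding h(2) q_def using t by (intro mult_left_mono) auto
    also have "\<dots> = m / 2" using p by (simp add: t_def)
    also have "\<dots> < m" using p by simp
    finally have hm: "nrm X h < m" .
    then have xh: "x + h \<in> U" using r(2) h(1) by (simp add: m_def)
    let ?a = "f (x + h) - f x - D h" and ?b = "f (x + h) - f x - D' h"
    have "t *\<^sub>R (D v - D' v) = ?b - ?a"
      using lin_onD(3)[OF blmaps_carrD(1)[OF B(1)] v, of t]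
        lin_onD(3)[OF blmaps_carrD(1)[OF B(2)] v, of t] by (simp add: h_def scaleR_diff_right)
    then have "t * nrm Y (D v - D' v) = nrm Y (?b - ?a)"
      using Y(5)[OF Y(7)[OF Dv[OF v]], of t] t by simp
    also have "\<dots> \<le> nrm Y ?b + nrm Y ?a"
      by (intro Y(13) Y(7) f xh U Dv h)
    also have "\<dots> \<le> e * nrm X h + e * nrm X h"
      using d(2) d'(2) h(1) hm xh by (intro add_mono) (auto simp: m_def)
    finally have "t * nrm Y (D v - D' v) \<le> t * (2 * e * nrm X v)" by (simp add: h(2) mult_ac)
    then show ?thesis using t by simp
  qed
  have "nrm Y (D v - D' v) \<le> 0"
  proof (rule field_le_epsilon)
    fix e :: real assume e: "e > 0"
    have p: "nrm X v + 1 > 0" using X(2)[OF v] by simp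
    have "nrm Y (D v - D' v) \<le> 2 * (e / 2 / (nrm X v + 1)) * nrm X v"
      using le[of "e / 2 / (nrm X v + 1)"] e p by simp
    also have "\<dots> \<le> e" using e p X(2)[OF v] by (simp add: field_simps)
    finally show "nrm Y (D v - D' v) \<le> 0 + e" by simp
  qed
  then show "D v = D' v" using Y(2,3)[OF Y(7)[OF Dv[OF v]]] by simp
qed

lemma smooth_on_cong:
  assumes "smooth_on X Y U f" "\<And>x. x \<in> U \<Longrightarrow> f x = g x"
  shows "smooth_on X Y U g"
  using assms by (simp add: smooth_on_def)

text \<open>\<open>J c d p\<close> is the derivative at \<open>p\<close> of the transition from \<open>c\<close> to \<open>d\<close>; a formula for it,
  rather than its mere existence, makes the transitions of the cotangent bundle accessible.\<close>

locale atlas_cocycle =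
  fixes M :: "'m set" and A :: "('m, 'v::real_vector) chart set"
    and J :: "('m, 'v) chart \<Rightarrow> ('m, 'v) chart \<Rightarrow> 'm \<Rightarrow> 'v \<Rightarrow> 'v"
  assumes manifold: "banach_manifold M A"
    and J_fderiv: "c \<in> A \<Longrightarrow> d \<in> A \<Longrightarrow> p \<in> cdom c \<Longrightarrow> p \<in> cdom d \<Longrightarrow>
      has_fderiv (cmodel c) (cmodel d) (cmap c ` (cdom c \<inter> cdom d)) (transition c d) (cmap c p) (J c d p)"
    and J_id: "c \<in> A \<Longrightarrow> p \<in> cdom c \<Longrightarrow> v \<in> carr (cmodel c) \<Longrightarrow> J c c p v = v"
    and J_comp: "c \<in> A \<Longrightarrow> d \<in> A \<Longrightarrow> e \<in> A \<Longrightarrow> p \<in> cdom c \<Longrightarrow> p \<in> cdom d \<Longrightarrow> p \<in> cdom e \<Longrightarrow>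
      v \<in> carr (cmodel c) \<Longrightarrow> J d e p (J c d p v) = J c e p v"
begin

definition tvec :: "('m, 'v) chart \<Rightarrow> 'm \<Rightarrow> 'v \<Rightarrow> ('m, 'v) chart \<Rightarrow> 'v" where
  "tvec c p v = (\<lambda>d. if d \<in> A \<and> p \<in> cdom d then J c d p v else 0)"

text \<open>The coordinate change of covectors from \<open>c\<close> to \<open>d\<close>. It
  transposes the derivative in the opposite direction, hence \<open>J d c p\<close> and not
  \<open>J c d p\<close>.\<close>

definition codiff :: "('m, 'v) chart \<Rightarrow> ('m, 'v) chart \<Rightarrow> 'm \<Rightarrow> ('v \<Rightarrow> real) \<Rightarrow> 'v \<Rightarrow> real" where
  "codiff c d p = zero_ext (carr (ndual (cmodel c)))
     (\<lambda>\<mu>. zero_ext (carr (cmodel d)) (\<lambda>v. \<mu> (J d c p v)))"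

text \<open>The inverse of the coordinate map \<open>coord c p\<close> introduced below: it turns a
  functional on the model space into one on the tangent space.\<close>

definition pull :: "('m, 'v) chart \<Rightarrow> 'm \<Rightarrow> ('v \<Rightarrow> real) \<Rightarrow> (('m, 'v) chart \<Rightarrow> 'v) \<Rightarrow> real" where
  "pull c p \<nu> = zero_ext (tangent_space A p) (\<lambda>\<xi>. \<nu> (\<xi> c))"

lemma banach_model: "c \<in> A \<Longrightarrow> banach_space (cmodel c)"
  using manifold by (simp add: banach_manifold_def)

lemma normed_model: "c \<in> A \<Longrightarrow> normed_space (cmodel c)"
  using banach_model by (simp add: banach_space_def)

lemma smooth_transition:
  "c \<in> A \<Longrightarrow> d \<in> A \<Longrightarrow>
    smooth_on (cmodel c) (cmodel d) (cmap c ` (cdom c \<inter> cdom d)) (transition c d)"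
  using manifold by (simp add: banach_manifold_def)

lemma inj_chart: "c \<in> A \<Longrightarrow> inj_on (cmap c) (cdom c)"
  using manifold by (simp add: banach_manifold_def)

lemma cover: "p \<in> M \<Longrightarrow> \<exists>c\<in>A. p \<in> cdom c" and cdom_subset: "c \<in> A \<Longrightarrow> cdom c \<subseteq> M"
  using manifold by (auto simp: banach_manifold_def)

lemma J_blmaps:
  "c \<in> A \<Longrightarrow> d \<in> A \<Longrightarrow> p \<in> cdom c \<Longrightarrow> p \<in> cdom d \<Longrightarrow> J c d p \<in> carr (blmaps (cmodel c) (cmodel d))"
  using J_fderiv by (simp add: has_fderiv_def)

lemma J_carr:
  "c \<in> A \<Longrightarrow> d \<in> A \<Longrightarrow> p \<in> cdom c \<Longrightarrow> p \<in> cdom d \<Longrightarrow> v \<in> carr (cmodel c) \<Longrightarrow> J c d p v \<in> carr (cmodel d)"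
  using J_blmaps blmaps_carrD(2) by metis

section \<open>Tangent spaces parametrized by one chart\<close>

lemma tvec_tangent:
  assumes "c \<in> A" "p \<in> cdom c" "v \<in> carr (cmodel c)"
  shows "tvec c p v \<in> tangent_space A p"
  unfolding tangent_space_def
proof (clarsimp, intro conjI allI ballI impI)
  show "tvec c p v d = 0" if "d \<in> A \<longrightarrow> p \<notin> cdom d" for d using that by (auto simp: tvec_def)
  show "tvec c p v d \<in> carr (cmodel d)" if "d \<in> A" "p \<in> cdom d" for d
    using that assms J_carr by (simp add: tvec_def)
  show "\<exists>D. has_fderiv (cmodel d) (cmodel e) (cmap d ` (cdom d \<inter> cdom e)) (transition d e) (cmap d p) D
          \<and> tvec c p v e = D (tvec c p v d)"
    if "d \<in> A" "e \<in> A" "p \<in> cdom d \<and> p \<in> cdom e" for d e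
    using that assms J_fderiv[of d e p] J_comp[of c d e p v] by (auto simp: tvec_def)
qed

lemma tvec_self: "c \<in> A \<Longrightarrow> p \<in> cdom c \<Longrightarrow> v \<in> carr (cmodel c) \<Longrightarrow> tvec c p v c = v"
  by (simp add: tvec_def J_id)

lemma tangent_carr: "\<xi> \<in> tangent_space A p \<Longrightarrow> c \<in> A \<Longrightarrow> p \<in> cdom c \<Longrightarrow> \<xi> c \<in> carr (cmodel c)"
  by (simp add: tangent_space_def)

text \<open>The definition of \<open>tangent_space\<close> offers only some derivative that relates
  the two coordinates; uniqueness of derivatives on the open overlap makes it
  \<open>J c d p\<close>. Hence one coordinate determines the whole tangent vector.\<close>

lemma tangent_eq_J:
  assumes "\<xi> \<in> tangent_space A p" "c \<in> A" "p \<in> cdom c" "d \<in> A" "p \<in> cdom d"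
  shows "\<xi> d = J c d p (\<xi> c)"
proof -
  obtain D where D: "has_fderiv (cmodel c) (cmodel d) (cmap c ` (cdom c \<inter> cdom d))
      (transition c d) (cmap c p) D" "\<xi> d = D (\<xi> c)"
    using assms unfolding tangent_space_def by blast
  have "D = J c d p"
    by (rule has_fderiv_unique[OF normed_model normed_model _ _ _ D(1) J_fderiv])
      (use smooth_transition[of c d] assms in \<open>auto simp: smooth_on_def\<close>)
  then show ?thesis using D by simp
qed

lemma tangent_eq_tvec:
  assumes "\<xi> \<in> tangent_space A p" "c \<in> A" "p \<in> cdom c"
  shows "\<xi> = tvec c p (\<xi> c)"
proof
  fix d show "\<xi> d = tvec c p (\<xi> c) d"
  proof (cases "d \<in> A \<and> p \<in> cdom d")
    case True
    then show ?thesis using tangent_eq_J[OF assms, of d] by (simp add: tvec_def)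
  next
    case False
    then have "\<xi> d = 0" using assms(1) unfolding tangent_space_def by blast
    then show ?thesis using False by (auto simp: tvec_def)
  qed
qed

lemma tangent_eqI:
  assumes "\<xi> \<in> tangent_space A p" "\<eta> \<in> tangent_space A p" "c \<in> A" "p \<in> cdom c" "\<xi> c = \<eta> c"
  shows "\<xi> = \<eta>"
proof -
  have "\<xi> = tvec c p (\<xi> c)" by (rule tangent_eq_tvec[OF assms(1,3,4)])
  also have "\<dots> = tvec c p (\<eta> c)" by (simp add: assms(5))
  also have "\<dots> = \<eta>" by (rule tangent_eq_tvec[OF assms(2,3,4), symmetric])
  finally show ?thesis .
qed

lemma tangent_vec_eq:
  assumes "c \<in> A" "p \<in> cdom c" "v \<in> carr (cmodel c)"
  shows "tangent_vec A c p v = tvec c p v"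
proof -
  have "inj_on (\<lambda>\<xi>. \<xi> c) (tangent_space A p)"
    by (rule inj_onI) (rule tangent_eqI[OF _ _ assms(1,2)])
  from inv_into_f_f[OF this tvec_tangent[OF assms]] show ?thesis
    by (simp add: tangent_vec_def tvec_self assms)
qed

text \<open>Closure under sums is not immediate, since the definition quantifies over a derivative
  for each vector separately. It follows from the parametrization by \<open>tvec c p\<close>, which
  is linear because each \<open>J c d p\<close> is.\<close>

lemma subspace_tangent: 
  assumes "c \<in> A" "p \<in> cdom c"
  shows "subspace (tangent_space A p)"
proof -
  note N = normed_spaceD[OF normed_model[OF assms(1)]]
  have L: "lin_on (carr (cmodel c)) (carr (cmodel d)) (J c d p)" if "d \<in> A" "p \<in> cdom d" for d
    using J_blmaps assms that blmaps_carrD(1) by metis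
  have *: "\<xi> \<in> tangent_space A p \<longleftrightarrow> (\<exists>v\<in>carr (cmodel c). \<xi> = tvec c p v)" for \<xi>
    using tangent_eq_tvec[of \<xi> p c] tvec_tangent tangent_carr[of \<xi> p c] assms by blast
  show ?thesis
  proof (rule subspaceI)
    have "0 = tvec c p 0" using lin_on_0[OF L] N(9) by (auto simp: tvec_def fun_eq_iff)
    then show "0 \<in> tangent_space A p" using *[THEN iffD2, OF bexI, OF _ N(9)] by simp
    show "\<xi> + \<eta> \<in> tangent_space A p" if x: "\<xi> \<in> tangent_space A p" and y: "\<eta> \<in> tangent_space A p" for \<xi> \<eta>
    proof -
      obtain v w where vw: "v \<in> carr (cmodel c)" "w \<in> carr (cmodel c)" "\<xi> = tvec c p v" "\<eta> = tvec c p w"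
        using *[THEN iffD1, OF x] *[THEN iffD1, OF y] by (elim bexE)
      have "\<xi> + \<eta> = tvec c p (v + w)"
        using lin_onD(2)[OF L] vw by (auto simp: tvec_def fun_eq_iff)
      then show ?thesis using *[THEN iffD2, OF bexI, OF _ N(6)[OF vw(1,2)]] by simp
    qed
    show "r *\<^sub>R \<xi> \<in> tangent_space A p" if x: "\<xi> \<in> tangent_space A p" for r \<xi>
    proof -
      obtain v where v: "v \<in> carr (cmodel c)" "\<xi> = tvec c p v"
        using *[THEN iffD1, OF x] by (elim bexE)
      have "r *\<^sub>R \<xi> = tvec c p (r *\<^sub>R v)"
        using lin_onD(3)[OF L] v by (auto simp: tvec_def fun_eq_iff scaleR_fun_def)
      then show ?thesis using *[THEN iffD2, OF bexI, OF _ N(8)[OF v(1)]] by simp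
    qed
  qed
qed

lemma tangent_nspace_simps [simp]:
  "carr (tangent_nspace A c p) = tangent_space A p"
  "nrm (tangent_nspace A c p) \<xi> = nrm (cmodel c) (\<xi> c)"
  by (simp_all add: tangent_nspace_def)

lemma normed_tangent:
  assumes "c \<in> A" "p \<in> cdom c"
  shows "normed_space (tangent_nspace A c p)"
proof -
  note N = normed_spaceD[OF normed_model[OF assms(1)]]
  note C = tangent_carr[OF _ assms]
  have "\<xi> = 0" if x: "\<xi> \<in> tangent_space A p" and "nrm (cmodel c) (\<xi> c) = 0" for \<xi>
  proof -
    have "\<xi> c = 0 c" using that N(3)[OF C[OF x]] by simp
    then show ?thesis
      by (rule tangent_eqI[OF x subspace_0[OF subspace_tangent[OF assms]] assms])
  qed
  then show ?thesis
    unfolding normed_space_def using subspace_tangent[OF assms] N C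
    by (auto simp: scaleR_fun_def)
qed

text \<open>The norms that two charts induce on the tangent space are equivalent because
  \<open>J d c p\<close> is bounded, so boundedness of a functional does not depend on the
  chart.\<close>

lemma ndual_tangent_mono:
  assumes "c \<in> A" "p \<in> cdom c" "d \<in> A" "p \<in> cdom d" "\<mu> \<in> carr (ndual (tangent_nspace A c p))"
  shows "\<mu> \<in> carr (ndual (tangent_nspace A d p))"
proof (rule ndual_carrI)
  note mu = ndual_carrD[OF assms(5)]
  show "lin_on (carr (tangent_nspace A d p)) UNIV \<mu>" using mu(1) by simp
  show "\<mu> \<xi> = 0" if "\<xi> \<notin> carr (tangent_nspace A d p)" for \<xi> using that mu(2) by simp
  fix \<xi> assume x: "\<xi> \<in> carr (tangent_nspace A d p)"
  let ?K = "nrm (ndual (tangent_nspace A c p)) \<mu>" and ?L = "nrm (blmaps (cmodel d) (cmodel c)) (J d c p)"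
  have "\<bar>\<mu> \<xi>\<bar> \<le> ?K * nrm (cmodel c) (\<xi> c)"
    using ndual_bound[OF normed_tangent assms(5)] assms x by simp
  also have "\<dots> = ?K * nrm (cmodel c) (J d c p (\<xi> d))"
    using tangent_eq_J[of \<xi> p d c] assms x by simp
  also have "\<dots> \<le> ?K * (?L * nrm (cmodel d) (\<xi> d))"
    using assms x normed_spaceD(2)[OF normed_space_ndual[OF normed_tangent] assms(5)]
    by (intro mult_left_mono blmaps_bound normed_model J_blmaps tangent_carr) auto
  finally show "\<bar>\<mu> \<xi>\<bar> \<le> (?K * ?L) * nrm (tangent_nspace A d p) \<xi>" by simp
qed

section \<open>Cotangent vectors in coordinates and the cotangent bundle\<close>

lemma cotangent_space_eq:
  assumes "c \<in> A" "p \<in> cdom c"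
  shows "cotangent_space A p = carr (ndual (tangent_nspace A c p))"
  unfolding cotangent_space_def using ndual_tangent_mono[of _ p c] assms by auto

abbreviation coord :: "('m, 'v) chart \<Rightarrow> 'm \<Rightarrow> ((('m, 'v) chart \<Rightarrow> 'v) \<Rightarrow> real) \<Rightarrow> 'v \<Rightarrow> real" where
  "coord c \<equiv> tmap (cotangent_triv A c)"

lemma coord_apply:
  assumes "c \<in> A" "p \<in> cdom c"
  shows "coord c p \<mu> = zero_ext (carr (cmodel c)) (\<lambda>v. \<mu> (tvec c p v))"
  using assms by (auto simp: cotangent_triv_def zero_ext_def tangent_vec_eq)

lemma coord_carr:
  assumes "c \<in> A" "p \<in> cdom c" "\<mu> \<in> carr (ndual (tangent_nspace A c p))"
  shows "coord c p \<mu> \<in> carr (ndual (cmodel c))"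
    and "nrm (ndual (cmodel c)) (coord c p \<mu>) \<le> nrm (ndual (tangent_nspace A c p)) \<mu>"
proof -
  note N = normed_spaceD[OF normed_model[OF assms(1)]]
  note T = tvec_tangent[OF assms(1,2)] and mu = ndual_carrD[OF assms(3)]
  have E: "\<xi> = \<eta>" if "\<xi> \<in> tangent_space A p" "\<eta> \<in> tangent_space A p" "\<xi> c = \<eta> c" for \<xi> \<eta>
    by (rule tangent_eqI[OF that(1,2) assms(1,2) that(3)])
  note S = subspace_tangent[OF assms(1,2)] and Se = tvec_self[OF assms(1,2)]
  have b: "\<bar>coord c p \<mu> v\<bar> \<le> nrm (ndual (tangent_nspace A c p)) \<mu> * nrm (cmodel c) v"
    if "v \<in> carr (cmodel c)" for v
    using ndual_bound[OF normed_tangent assms(3), of "tvec c p v"] that T Se assms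
    by (simp add: coord_apply zero_ext_def)
  have add: "tvec c p (v + w) = tvec c p v + tvec c p w"
    if "v \<in> carr (cmodel c)" "w \<in> carr (cmodel c)" for v w
    by (rule E) (use that T S Se N(6) in \<open>auto intro: subspace_add\<close>)
  have scl: "tvec c p (r *\<^sub>R v) = r *\<^sub>R tvec c p v" if "v \<in> carr (cmodel c)" for v r
    by (rule E) (simp_all add: that T Se N(8) subspace_scale[OF S] scaleR_fun_def[of r "tvec _ _ _"]
        subspace_scale[OF S, unfolded scaleR_fun_def])
  show "coord c p \<mu> \<in> carr (ndual (cmodel c))"
  proof (rule ndual_carrI[OF _ _ b])
    show "lin_on (carr (cmodel c)) UNIV (coord c p \<mu>)"
      using lin_onD(2,3)[OF mu(1)] T add scl N(6,8) assms
      by (auto simp: lin_on_def coord_apply zero_ext_def)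
  qed (use assms in \<open>auto simp: coord_apply zero_ext_def\<close>)
  show "nrm (ndual (cmodel c)) (coord c p \<mu>) \<le> nrm (ndual (tangent_nspace A c p)) \<mu>"
    using assms by (intro ndual_le normed_model b normed_spaceD(2)[OF normed_space_ndual[OF normed_tangent]])
qed

lemma pull_carr:
  assumes "c \<in> A" "p \<in> cdom c" "\<nu> \<in> carr (ndual (cmodel c))"
  shows "pull c p \<nu> \<in> carr (ndual (tangent_nspace A c p))"
    and "nrm (ndual (tangent_nspace A c p)) (pull c p \<nu>) \<le> nrm (ndual (cmodel c)) \<nu>"
proof -
  note C = tangent_carr[OF _ assms(1,2)] and S = subspace_tangent[OF assms(1,2)]
  have b: "\<bar>pull c p \<nu> \<xi>\<bar> \<le> nrm (ndual (cmodel c)) \<nu> * nrm (tangent_nspace A c p) \<xi>"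
    if "\<xi> \<in> carr (tangent_nspace A c p)" for \<xi>
    using ndual_bound[OF normed_model[OF assms(1)] assms(3) C[of \<xi>]] that
    by (simp add: pull_def zero_ext_def)
  show "pull c p \<nu> \<in> carr (ndual (tangent_nspace A c p))"
  proof (rule ndual_carrI[OF _ _ b])
    show "lin_on (carr (tangent_nspace A c p)) UNIV (pull c p \<nu>)"
      using lin_onD(2,3)[OF ndual_carrD(1)[OF assms(3)]] C S
      by (auto simp: lin_on_def pull_def zero_ext_def scaleR_fun_def subspace_add
          dest: subspace_scale[OF S, unfolded scaleR_fun_def])
  qed (auto simp: pull_def zero_ext_def)
  show "nrm (ndual (tangent_nspace A c p)) (pull c p \<nu>) \<le> nrm (ndual (cmodel c)) \<nu>"
    using assms by (intro ndual_le normed_tangent b normed_spaceD(2)[OF normed_space_ndual[OF normed_model]])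
qed

text \<open>Lifting a functional through one chart and reading it in another is the coordinate
  change. This is how the abstract \<open>triv_change\<close> becomes the formula
  \<open>codiff\<close>.\<close>

lemma coord_pull:
  assumes "c \<in> A" "p \<in> cdom c" "d \<in> A" "p \<in> cdom d" "\<nu> \<in> carr (ndual (cmodel c))"
  shows "coord d p (pull c p \<nu>) = codiff c d p \<nu>"
  using assms tvec_tangent[of d p]
  by (auto simp: fun_eq_iff coord_apply codiff_def zero_ext_def pull_def) (simp add: tvec_def)

lemma codiff_carr:
  assumes "c \<in> A" "p \<in> cdom c" "d \<in> A" "p \<in> cdom d" "\<nu> \<in> carr (ndual (cmodel c))"
  shows "codiff c d p \<nu> \<in> carr (ndual (cmodel d))"
  using coord_carr(1)[OF assms(3,4) ndual_tangent_mono[OF assms(1-4) pull_carr(1)[OF assms(1,2,5)]]]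
  by (simp add: coord_pull[OF assms])

lemma coord_pull_self:
  assumes "c \<in> A" "p \<in> cdom c" "\<nu> \<in> carr (ndual (cmodel c))"
  shows "coord c p (pull c p \<nu>) = \<nu>"
  using assms J_id ndual_carrD(2)[OF assms(3)]
  by (auto simp: coord_pull codiff_def zero_ext_def fun_eq_iff)

lemma pull_coord:
  assumes "c \<in> A" "p \<in> cdom c" "\<mu> \<in> carr (ndual (tangent_nspace A c p))"
  shows "pull c p (coord c p \<mu>) = \<mu>"
proof
  fix \<xi> show "pull c p (coord c p \<mu>) \<xi> = \<mu> \<xi>"
    using assms tangent_carr tangent_eq_tvec[of \<xi> p c, symmetric] ndual_carrD(2)[OF assms(3)]
    by (cases "\<xi> \<in> tangent_space A p") (simp_all add: pull_def coord_apply zero_ext_def)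
qed

lemma coord_bij:
  assumes "c \<in> A" "p \<in> cdom c"
  shows "bij_betw (coord c p) (cotangent_space A p) (carr (ndual (cmodel c)))"
  unfolding cotangent_space_eq[OF assms]
  by (rule bij_betwI[of _ _ _ "pull c p"])
    (use assms coord_carr pull_carr coord_pull_self pull_coord in auto)

lemma coord_lin:
  assumes "c \<in> A" "p \<in> cdom c"
  shows "lin_on (cotangent_space A p) (carr (ndual (cmodel c))) (coord c p)"
  unfolding lin_on_def
  using coord_carr[OF assms] assms
  by (auto simp: coord_apply zero_ext_def fun_eq_iff scaleR_fun_def cotangent_space_eq)

lemma cotangent_triv_simps [simp]:
  "tdom (cotangent_triv A c) = cdom c" "tfib (cotangent_triv A c) = ndual (cmodel c)"
  by (simp_all add: cotangent_triv_def)

lemma triv_change_eq: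
  assumes "c \<in> A" "p \<in> cdom c" "d \<in> A" "p \<in> cdom d"
  shows "triv_change (cotangent_space A) (cotangent_triv A c) (cotangent_triv A d) p = codiff c d p"
proof
  fix \<nu> :: "'v \<Rightarrow> real"
  show "triv_change (cotangent_space A) (cotangent_triv A c) (cotangent_triv A d) p \<nu> = codiff c d p \<nu>"
  proof (cases "\<nu> \<in> carr (ndual (cmodel c))")
    case True
    have "inv_into (cotangent_space A p) (coord c p) \<nu> = pull c p \<nu>"
      by (rule inv_into_f_eq[OF bij_betw_imp_inj_on[OF coord_bij[OF assms(1,2)]]])
        (simp_all only: coord_pull_self[OF assms(1,2) True] cotangent_space_eq[OF assms(1,2)] pull_carr(1)[OF assms(1,2) True])
    then show ?thesis using True assms by (simp add: triv_change_def zero_ext_def coord_pull)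
  qed (simp add: triv_change_def zero_ext_def codiff_def)
qed

text \<open>The image of an overlap is the domain of a transition, and openness of the domain is
  part of \<open>smooth_on\<close>.\<close>

lemma mopen_cdom:
  assumes "c \<in> A" shows "mopen A (cdom c)"
  unfolding mopen_def
proof (intro conjI ballI)
  show "openin (ntop (cmodel d)) (cmap d ` (cdom c \<inter> cdom d))" if "d \<in> A" for d
    using smooth_transition[OF that assms] by (simp add: smooth_on_def Int_commute)
qed (use assms in blast)

end

text \<open>The third chart \<open>e\<close> occurs because a change of trivialization has to be
  smooth in every chart of the base, independently of the two charts that define the
  trivializations.\<close>

locale smooth_atlas_cocycle = atlas_cocycle +
  assumes smooth_codiff: "c \<in> A \<Longrightarrow> d \<in> A \<Longrightarrow> e \<in> A \<Longrightarrow>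
    smooth_on (cmodel e) (blmaps (ndual (cmodel c)) (ndual (cmodel d)))
      (cmap e ` (cdom e \<inter> cdom c \<inter> cdom d)) (\<lambda>x. codiff c d (cinv e x))"
begin

lemma smooth_change_cotangent:
  assumes "c \<in> A" "d \<in> A"
  shows "smooth_change A (cotangent_space A) (cotangent_triv A c) (cotangent_triv A d)"
  unfolding smooth_change_def cotangent_triv_simps
proof
  fix e assume e: "e \<in> A"
  show "smooth_on (cmodel e) (blmaps (ndual (cmodel c)) (ndual (cmodel d)))
      (cmap e ` (cdom e \<inter> cdom c \<inter> cdom d))
      (\<lambda>x. triv_change (cotangent_space A) (cotangent_triv A c) (cotangent_triv A d) (cinv e x))"
  proof (rule smooth_on_cong[OF smooth_codiff[OF assms e]])
    fix x assume "x \<in> cmap e ` (cdom e \<inter> cdom c \<inter> cdom d)"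
    then obtain p where "p \<in> cdom e" "p \<in> cdom c" "p \<in> cdom d" "x = cmap e p" by auto
    then show "codiff c d (cinv e x) =
        triv_change (cotangent_space A) (cotangent_triv A c) (cotangent_triv A d) (cinv e x)"
      using inj_chart[OF e] assms by (simp add: cinv_def triv_change_eq)
  qed
qed

lemma local_trivialization_cotangent:
  assumes "c \<in> A"
  shows "local_trivialization A (cotangent_space A) (cotangent_triv A ` A) (cotangent_triv A c)"
  unfolding local_trivialization_def fibrewise_iso_def
  using assms
  by (auto simp: mopen_cdom coord_lin coord_bij smooth_change_cotangent banach_space_ndual normed_model)

lemma banach_vector_bundle_cotangent:
  "banach_vector_bundle M A (cotangent_space A) (cotangent_triv A ` A)"
  unfolding banach_vector_bundle_def
proof (intro conjI ballI manifold)
  show "subspace (cotangent_space A p)" if "p \<in> M" for p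
    using cover[OF that] cotangent_space_eq normed_spaceD(1)[OF normed_space_ndual[OF normed_tangent]] by metis
  show "(\<Union>t\<in>cotangent_triv A ` A. tdom t) = M" using cover cdom_subset by auto
qed (use local_trivialization_cotangent in auto)

end

text \<open>\<open>Z c\<close> is a predual of the model space of \<open>c\<close>, realised inside its dual.\<close>

locale predual_cocycle = smooth_atlas_cocycle +
  fixes Z :: "('a, 'b) chart \<Rightarrow> ('b \<Rightarrow> real) set"
  assumes subspace_Z: "c \<in> A \<Longrightarrow> subspace (Z c)"
    and Z_subset: "c \<in> A \<Longrightarrow> Z c \<subseteq> carr (ndual (cmodel c))"
    and closed_Z: "c \<in> A \<Longrightarrow> closedin (ntop (ndual (cmodel c))) (Z c)"
    and codiff_Z: "c \<in> A \<Longrightarrow> d \<in> A \<Longrightarrow> p \<in> cdom c \<Longrightarrow> p \<in> cdom d \<Longrightarrow> \<mu> \<in> Z c \<Longrightarrow> codiff c d p \<mu> \<in> Z d"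
    and norming_Z: "c \<in> A \<Longrightarrow> \<exists>K. \<forall>C v. v \<in> carr (cmodel c) \<and> 0 \<le> C \<and>
      (\<forall>\<mu>\<in>Z c. \<bar>\<mu> v\<bar> \<le> C * nrm (ndual (cmodel c)) \<mu>) \<longrightarrow> nrm (cmodel c) v \<le> K * C"
    and dual_Z: "c \<in> A \<Longrightarrow> lin_on (Z c) UNIV \<phi> \<Longrightarrow>
      (\<And>\<mu>. \<mu> \<in> Z c \<Longrightarrow> \<bar>\<phi> \<mu>\<bar> \<le> C * nrm (ndual (cmodel c)) \<mu>) \<Longrightarrow> \<exists>v\<in>carr (cmodel c). \<forall>\<mu>\<in>Z c. \<phi> \<mu> = \<mu> v"
begin

section \<open>The subbundle cut out by the preduals \<open>Z c\<close>\<close>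

definition precotangent where
  "precotangent = {(p, \<mu>). p \<in> M \<and> \<mu> \<in> cotangent_space A p \<and>
     (\<forall>c\<in>A. p \<in> cdom c \<longrightarrow> coord c p \<mu> \<in> Z c)}"

text \<open>Invariance of the spaces \<open>Z\<close> under the coordinate changes reduces the
  condition in all charts to the condition in one.\<close>

lemma precotangent_iff:
  assumes "c \<in> A" "p \<in> cdom c"
  shows "(p, \<mu>) \<in> precotangent \<longleftrightarrow> \<mu> \<in> carr (ndual (tangent_nspace A c p)) \<and> coord c p \<mu> \<in> Z c"
proof
  assume "\<mu> \<in> carr (ndual (tangent_nspace A c p)) \<and> coord c p \<mu> \<in> Z c"
  then have mu: "\<mu> \<in> carr (ndual (tangent_nspace A c p))" "coord c p \<mu> \<in> Z c" by auto
  have "coord d p \<mu> \<in> Z d" if "d \<in> A" "p \<in> cdom d" for d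
    using coord_pull[OF assms that coord_carr(1)[OF assms mu(1)]] pull_coord[OF assms mu(1)]
      codiff_Z[OF assms(1) that(1) assms(2) that(2) mu(2)] by simp
  then show "(p, \<mu>) \<in> precotangent"
    using mu cdom_subset assms by (auto simp: precotangent_def cotangent_space_eq[OF assms])
qed (use assms in \<open>auto simp: precotangent_def cotangent_space_eq[OF assms]\<close>)

text \<open>Two properties of \<open>Z c\<close> are carried to the fibre by
  \<open>pull c p\<close>. That it norms the model space gives the lower bound and therefore
  injectivity; that every bounded functional on it is an evaluation gives surjectivity.\<close>

lemma banach_iso_precotangent:
  assumes "c \<in> A" "p \<in> cdom c"
  defines "S \<equiv> precotangent `` {p}"
  shows "banach_iso (tangent_nspace A c p) (ndual (nsub (ndual (tangent_nspace A c p)) S))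
    (\<lambda>\<xi>. zero_ext S (\<lambda>\<mu>. \<mu> \<xi>))"
proof -
  let ?T = "tangent_nspace A c p"
  let ?N = "nsub (ndual ?T) S"
  let ?ev = "\<lambda>\<xi>. zero_ext S (\<lambda>\<mu>. \<mu> \<xi>)"
  note NT = normed_tangent[OF assms(1,2)]
  note ND = normed_space_ndual[OF NT]
  have S: "\<mu> \<in> S \<longleftrightarrow> \<mu> \<in> carr (ndual ?T) \<and> coord c p \<mu> \<in> Z c" for \<mu>
    unfolding S_def Image_singleton_iff by (rule precotangent_iff[OF assms(1,2)])
  have subS: "subspace S"
  proof -
    note L = coord_lin[OF assms(1,2), unfolded cotangent_space_eq[OF assms(1,2)]]
    note s = subspace_Z[OF assms(1)] and n = normed_spaceD[OF ND]
    show ?thesis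
      by (rule subspaceI) (simp_all add: S lin_onD(2,3)[OF L] lin_on_0[OF L n(9)] n(6,8,9)
          subspace_add[OF s] subspace_scale[OF s] subspace_0[OF s])
  qed
  have SD: "S \<subseteq> carr (ndual ?T)" using S by auto
  have NN: "normed_space ?N" by (rule normed_space_nsub[OF ND subS SD])
  have NNd: "normed_space (ndual ?N)" by (rule normed_space_ndual[OF NN])
  note nT = normed_spaceD[OF NT]
  have evb: "\<bar>?ev \<xi> \<mu>\<bar> \<le> nrm ?T \<xi> * nrm ?N \<mu>" if "\<xi> \<in> carr ?T" "\<mu> \<in> S" for \<xi> \<mu>
    using ndual_bound[OF NT _ that(1), of \<mu>] that SD by (auto simp: zero_ext_def mult.commute)
  have evc: "?ev \<xi> \<in> carr (ndual ?N)" if x: "\<xi> \<in> carr ?T" for \<xi>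
  proof (rule ndual_carrI)
    show "lin_on (carr ?N) UNIV (?ev \<xi>)"
      using subspace_add[OF subS] subspace_scale[OF subS]
      by (auto simp: lin_on_def zero_ext_def) (simp_all add: scaleR_fun_def)
    show "?ev \<xi> \<mu> = 0" if "\<mu> \<notin> carr ?N" for \<mu> using that by (simp add: zero_ext_def)
    show "\<bar>?ev \<xi> \<mu>\<bar> \<le> nrm ?T \<xi> * nrm ?N \<mu>" if "\<mu> \<in> carr ?N" for \<mu> 
      using evb[OF x] that by simp
  qed
  have lin: "lin_on (carr ?T) (carr (ndual ?N)) ?ev"
    unfolding lin_on_def
  proof (intro conjI ballI allI evc)
    show "?ev (x + y) = ?ev x + ?ev y" if "x \<in> carr ?T" "y \<in> carr ?T" for x y
      using that SD lin_onD(2)[OF ndual_carrD(1)[of _ ?T]] by (auto simp: zero_ext_def fun_eq_iff)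
    show "?ev (r *\<^sub>R x) = r *\<^sub>R ?ev x" if "x \<in> carr ?T" for r x
      using that SD lin_onD(3)[OF ndual_carrD(1)[of _ ?T]]
      by (auto simp: zero_ext_def fun_eq_iff scaleR_fun_apply)
  qed
  have Zc: "\<nu> \<in> carr (ndual (cmodel c))" if "\<nu> \<in> Z c" for \<nu>
    using that Z_subset[OF assms(1)] by auto
  have pS: "pull c p \<nu> \<in> S" if "\<nu> \<in> Z c" for \<nu>
    using that by (simp add: S pull_carr(1)[OF assms(1,2) Zc] coord_pull_self[OF assms(1,2) Zc])
  have pn: "nrm ?N (pull c p \<nu>) \<le> nrm (ndual (cmodel c)) \<nu>" if "\<nu> \<in> Z c" for \<nu>
    using pull_carr(2)[OF assms(1,2) Zc[OF that]] by simp
  obtain K where K: "\<And>C v. v \<in> carr (cmodel c) \<Longrightarrow> 0 \<le> C \<Longrightarrow>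
      (\<And>\<mu>. \<mu> \<in> Z c \<Longrightarrow> \<bar>\<mu> v\<bar> \<le> C * nrm (ndual (cmodel c)) \<mu>) \<Longrightarrow> nrm (cmodel c) v \<le> K * C"
    using norming_Z[OF assms(1)] by blast
  have low: "nrm ?T \<xi> \<le> K * nrm (ndual ?N) (?ev \<xi>)" if x: "\<xi> \<in> carr ?T" for \<xi>
    unfolding tangent_nspace_simps
  proof (rule K)
    have n0: "0 \<le> nrm (ndual ?N) (?ev \<xi>)" by (rule normed_spaceD(2)[OF NNd evc[OF x]])
    then show "0 \<le> nrm (ndual ?N) (?ev \<xi>)" .
    show "\<xi> c \<in> carr (cmodel c)" using x assms(1,2) tangent_carr by simp
    fix \<nu> assume \<nu>: "\<nu> \<in> Z c"
    have "\<bar>\<nu> (\<xi> c)\<bar> = \<bar>?ev \<xi> (pull c p \<nu>)\<bar>"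
      using x pS[OF \<nu>] by (simp add: zero_ext_def pull_def)
    also have "\<dots> \<le> nrm (ndual ?N) (?ev \<xi>) * nrm ?N (pull c p \<nu>)"
      by (rule ndual_bound[OF NN evc[OF x]]) (use pS[OF \<nu>] in simp)
    also have "\<dots> \<le> nrm (ndual ?N) (?ev \<xi>) * nrm (ndual (cmodel c)) \<nu>"
      by (rule mult_left_mono[OF pn[OF \<nu>] n0])
    finally show "\<bar>\<nu> (\<xi> c)\<bar> \<le> nrm (ndual ?N) (?ev \<xi>) * nrm (ndual (cmodel c)) \<nu>" .
  qed
  have inj: "inj_on ?ev (carr ?T)"
  proof (rule inj_onI)
    fix x y assume xy: "x \<in> carr ?T" "y \<in> carr ?T" "?ev x = ?ev y"
    have d: "x - y \<in> carr ?T" by (rule nT(7)[OF xy(1,2)])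
    have "?ev (x - y) = 0" using lin_on_diff[OF lin nT(1) xy(1,2)] xy(3) by simp
    then have "nrm ?T (x - y) \<le> 0" using low[OF d] normed_spaceD(10)[OF NNd] by simp
    then show "x = y" using nT(2,3)[OF d] by simp
  qed
  have surj: "\<exists>\<xi>\<in>carr ?T. ?ev \<xi> = \<Phi>" if P: "\<Phi> \<in> carr (ndual ?N)" for \<Phi>
  proof -
    note PL = ndual_carrD(1)[OF P, unfolded nsub_simps]
    have "\<exists>v\<in>carr (cmodel c). \<forall>\<nu>\<in>Z c. \<Phi> (pull c p \<nu>) = \<nu> v"
    proof (rule dual_Z[OF assms(1), of _ "nrm (ndual ?N) \<Phi>"])
      have pa: "pull c p (\<mu> + \<nu>) = pull c p \<mu> + pull c p \<nu>" "pull c p (r *\<^sub>R \<mu>) = r *\<^sub>R pull c p \<mu>" for \<mu> \<nu> r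
        by (auto simp: pull_def zero_ext_def fun_eq_iff scaleR_fun_def)
      show "lin_on (Z c) UNIV (\<lambda>\<nu>. \<Phi> (pull c p \<nu>))"
        unfolding lin_on_def pa using pS lin_onD(2,3)[OF PL] by auto
      fix \<nu> assume \<nu>: "\<nu> \<in> Z c"
      have "\<bar>\<Phi> (pull c p \<nu>)\<bar> \<le> nrm (ndual ?N) \<Phi> * nrm ?N (pull c p \<nu>)"
        by (rule ndual_bound[OF NN P]) (use pS[OF \<nu>] in simp)
      also have "\<dots> \<le> nrm (ndual ?N) \<Phi> * nrm (ndual (cmodel c)) \<nu>"
        by (rule mult_left_mono[OF pn[OF \<nu>] normed_spaceD(2)[OF NNd P]])
      finally show "\<bar>\<Phi> (pull c p \<nu>)\<bar> \<le> nrm (ndual ?N) \<Phi> * nrm (ndual (cmodel c)) \<nu>" .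
    qed
    then obtain v where v: "v \<in> carr (cmodel c)" "\<And>\<nu>. \<nu> \<in> Z c \<Longrightarrow> \<Phi> (pull c p \<nu>) = \<nu> v" by blast
    have x: "tvec c p v \<in> carr ?T" using tvec_tangent assms(1,2) v by simp
    have "?ev (tvec c p v) = \<Phi>"
    proof (rule ndual_ext[OF evc[OF x] P])
      fix \<mu> assume "\<mu> \<in> carr ?N"
      then have m: "\<mu> \<in> S" "\<mu> \<in> carr (ndual ?T)" "coord c p \<mu> \<in> Z c" using S by auto
      have "\<Phi> \<mu> = coord c p \<mu> v" using v(2)[OF m(3)] pull_coord[OF assms(1,2) m(2)] by simp
      then show "?ev (tvec c p v) \<mu> = \<Phi> \<mu>" using m v assms(1,2) by (simp add: zero_ext_def coord_apply)
    qed
    then show ?thesis using x by blast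
  qed
  show ?thesis
    unfolding banach_iso_def
  proof (intro conjI lin)
    show "bij_betw ?ev (carr ?T) (carr (ndual ?N))"
      unfolding bij_betw_def using inj surj evc by (auto simp: image_iff)
    have "nrm (ndual ?N) (?ev \<xi>) \<le> 1 * nrm ?T \<xi>" if "\<xi> \<in> carr ?T" for \<xi>
      by (rule ndual_le[OF NN]) (use nT(2)[OF that] evb[OF that] in auto)
    then show "\<exists>K. \<forall>\<xi>\<in>carr ?T. nrm (ndual ?N) (?ev \<xi>) \<le> K * nrm ?T \<xi>" by blast
    show "\<exists>K. \<forall>\<xi>\<in>carr ?T. nrm ?T \<xi> \<le> K * nrm (ndual ?N) (?ev \<xi>)" using low by blast
  qed
qed

theorem precotangent_bundle: "precotangent_bundle M A precotangent"
  unfolding precotangent_bundle_def banach_subbundle_def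
proof (intro conjI ballI impI banach_vector_bundle_cotangent banach_iso_precotangent)
  show "precotangent \<subseteq> Sigma M (cotangent_space A)" by (auto simp: precotangent_def)
  fix p assume "p \<in> M"
  then obtain c where c: "c \<in> A" "p \<in> cdom c" using cover by blast
  have im: "(\<lambda>(q, e). (q, coord c q e)) ` (precotangent \<inter> (cdom c \<times> UNIV)) = cdom c \<times> Z c" (is "?l = _")
  proof
    show "?l \<subseteq> cdom c \<times> Z c" using precotangent_iff[OF c(1)] by auto
    show "cdom c \<times> Z c \<subseteq> ?l"
    proof clarify
      fix q \<nu> assume q: "q \<in> cdom c" "\<nu> \<in> Z c"
      then have n: "\<nu> \<in> carr (ndual (cmodel c))" using Z_subset c by auto
      have "(q, pull c q \<nu>) \<in> precotangent \<inter> (cdom c \<times> UNIV)"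
        using precotangent_iff[OF c(1) q(1)] pull_carr(1)[OF c(1) q(1) n]
          coord_pull_self[OF c(1) q(1) n] q by simp
      then show "(q, \<nu>) \<in> ?l"
        using coord_pull_self[OF c(1) q(1) n] by (intro image_eqI[of _ _ "(q, pull c q \<nu>)"]) auto
    qed
  qed
  show "\<exists>t Z. local_trivialization A (cotangent_space A) (cotangent_triv A ` A) t \<and> p \<in> tdom t \<and>
      subspace Z \<and> closedin (ntop (tfib t)) Z \<and>
      (\<lambda>(q, e). (q, tmap t q e)) ` (precotangent \<inter> (tdom t \<times> UNIV)) = tdom t \<times> Z"
    using local_trivialization_cotangent c subspace_Z closed_Z im
    by (intro exI[of _ "cotangent_triv A c"] exI[of _ "Z c"]) simp
qed

end

section \<open>Norming functionals and bounded projections\<close>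

definition sublinear :: "('a::real_normed_vector \<Rightarrow> real) \<Rightarrow> bool" where
  "sublinear p \<longleftrightarrow> (\<forall>x y. p (x + y) \<le> p x + p y) \<and> (\<forall>r>0. \<forall>x. p (r *\<^sub>R x) = r * p x) \<and>
     (\<forall>x. p x \<le> norm x)"

lemma sublinearD:
  assumes "sublinear p"
  shows "p (x + y) \<le> p x + p y" "r > 0 \<Longrightarrow> p (r *\<^sub>R x) = r * p x" "p x \<le> norm x"
    "p 0 = 0" "- p (- x) \<le> p x" "- norm x \<le> p x"
proof -
  show add: "p (x + y) \<le> p x + p y" and scl: "r > 0 \<Longrightarrow> p (r *\<^sub>R x) = r * p x" and n: "p x \<le> norm x"
    for x y r using assms by (auto simp: sublinear_def)
  show z: "p 0 = 0" using scl[of 2 0] by simp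
  show "- p (- x) \<le> p x" using add[of x "- x"] z by simp
  then show "- norm x \<le> p x" using n[of "- x"] by simp
qed

text \<open>A device for making a sublinear functional additive: the infimum is a sublinear minorant
  of \<open>p\<close>, and if \<open>p\<close> is minimal the two agree, which gives
  \<open>p x + p y \<le> p (x + y)\<close>. The infimum is finite because subadditivity bounds it
  below by \<open>- p (- x)\<close>.\<close>

lemma sublinear_shift:
  fixes p :: "'a::real_normed_vector \<Rightarrow> real" and y :: 'a
  assumes p: "sublinear p"
  defines "q \<equiv> \<lambda>x. INF t\<in>{0..}. p (x + t *\<^sub>R y) - t * p y"
  shows "sublinear q" "q x \<le> p x" "q x \<le> p (x + y) - p y"
proof -
  note P = sublinearD[OF p]
  have scl0: "p (t *\<^sub>R z) = t * p z" if "t \<ge> 0" for t z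
    using that P(2,4) by (cases "t = 0") auto
  have bdd: "bdd_below ((\<lambda>t. p (x + t *\<^sub>R y) - t * p y) ` {0..})" for x
  proof (rule bdd_belowI2[of _ "- p (- x)"])
    fix t :: real assume "t \<in> {0..}"
    then show "- p (- x) \<le> p (x + t *\<^sub>R y) - t * p y"
      using P(1)[of "x + t *\<^sub>R y" "- x"] scl0[of t y] by simp
  qed
  have le: "q x \<le> p (x + t *\<^sub>R y) - t * p y" if "t \<ge> 0" for x t
    unfolding q_def by (rule cINF_lower[OF bdd]) (use that in simp)
  have ge: "c \<le> q x" if "\<And>t. t \<ge> 0 \<Longrightarrow> c \<le> p (x + t *\<^sub>R y) - t * p y" for c x
    unfolding q_def by (rule cINF_greatest) (use that in auto)
  have lep: "q x \<le> p x" for x using le[of 0 x] by simp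
  have hom: "r * q x \<le> q (r *\<^sub>R x)" if r: "r > 0" for r x
  proof (rule ge)
    fix t :: real assume t: "t \<ge> 0"
    have "r * q x \<le> r * (p (x + (t/r) *\<^sub>R y) - (t/r) * p y)"
      using r t by (intro mult_left_mono le) auto
    also have "\<dots> = p (r *\<^sub>R (x + (t/r) *\<^sub>R y)) - t * p y"
      using r P(2)[OF r] by (simp add: right_diff_distrib)
    finally show "r * q x \<le> p (r *\<^sub>R x + t *\<^sub>R y) - t * p y"
      using r by (simp add: scaleR_add_right)
  qed
  show "sublinear q"
    unfolding sublinear_def
  proof (intro conjI allI impI)
    show "q x \<le> norm x" for x using lep[of x] P(3)[of x] by simp
    show "q (r *\<^sub>R x) = r * q x" if r: "r > 0" for r x
      using hom[OF r, of x] hom[of "1/r" "r *\<^sub>R x"] r by (simp add: field_simps)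
    show "q (x + z) \<le> q x + q z" for x z
    proof -
      have "q (x + z) - q z \<le> q x"
      proof (rule ge)
        fix t :: real assume t: "t \<ge> 0"
        have "q (x + z) - (p (x + t *\<^sub>R y) - t * p y) \<le> q z"
        proof (rule ge)
          fix s :: real assume s: "s \<ge> 0"
          \<comment> \<open>The parameters of the two infima add up: \<open>t + s\<close> is
            admissible for \<open>x + z\<close>.\<close>
          show "q (x + z) - (p (x + t *\<^sub>R y) - t * p y) \<le> p (z + s *\<^sub>R y) - s * p y"
            using le[of "t + s" "x + z"] P(1)[of "x + t *\<^sub>R y" "z + s *\<^sub>R y"] t s
            by (simp add: algebra_simps)
        qed
        then show "q (x + z) - q z \<le> p (x + t *\<^sub>R y) - t * p y" by simp
      qed
      then show ?thesis by simp
    qed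
  qed
  show "q x \<le> p x" by (rule lep)
  show "q x \<le> p (x + y) - p y" using le[of 1 x] by simp
qed

text \<open>Zorn's lemma for the reversed order, where a chain is bounded by its pointwise infimum.
  The bound \<open>p x \<le> norm x\<close> contained in \<open>sublinear\<close> implies
  \<open>- norm x \<le> p x\<close>, so these infima are finite.\<close>

lemma minimal_sublinear:
  assumes "sublinear p"
  obtains m where "sublinear m" "m \<le> p" "\<And>q. sublinear q \<Longrightarrow> q \<le> m \<Longrightarrow> q = m"
proof -
  define S where "S = {q. sublinear q \<and> q \<le> p}"
  have "\<exists>m\<in>S. \<forall>q\<in>S. q \<le> m \<longrightarrow> q = m"
  proof (rule predicate_Zorn[where P = "\<lambda>a b. b \<le> a"])
    show "partial_order_on S (relation_of (\<lambda>a b. b \<le> a) S)"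
      by (auto simp: partial_order_on_def preorder_on_def refl_on_def trans_def antisym_def relation_of_def)
    fix C assume "C \<in> Chains (relation_of (\<lambda>a b. b \<le> a) S)"
    then have C: "\<And>a b. a \<in> C \<Longrightarrow> b \<in> C \<Longrightarrow> a \<le> b \<or> b \<le> a" "C \<subseteq> S"
      by (auto simp: Chains_def relation_of_def)
    show "\<exists>u\<in>S. \<forall>a\<in>C. u \<le> a"
    proof (cases "C = {}")
      case True
      then show ?thesis using assms by (intro bexI[of _ p]) (auto simp: S_def)
    next
      case False
      define u where "u = (\<lambda>x. INF a\<in>C. a x)"
      have sl: "sublinear a" "a \<le> p" if "a \<in> C" for a using that C(2) by (auto simp: S_def)
      have bdd: "bdd_below ((\<lambda>a. a x) ` C)" for x
        by (rule bdd_belowI[of _ "- norm x"]) (use sublinearD(6)[OF sl(1)] in auto)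
      have le: "u x \<le> a x" if "a \<in> C" for a x unfolding u_def by (rule cINF_lower[OF bdd that])
      have ge: "c \<le> u x" if "\<And>a. a \<in> C \<Longrightarrow> c \<le> a x" for c x
        unfolding u_def by (rule cINF_greatest[OF False that])
      have hom: "r * u x \<le> u (r *\<^sub>R x)" if "r > 0" for r x
      proof (rule ge)
        fix a assume a: "a \<in> C"
        show "r * u x \<le> a (r *\<^sub>R x)"
          using mult_left_mono[OF le[OF a, of x], of r] sublinearD(2)[OF sl(1)[OF a] that] that by simp
      qed
      have "sublinear u"
        unfolding sublinear_def
      proof (intro conjI allI impI)
        obtain a where "a \<in> C" using False by blast
        then show "u x \<le> norm x" for x using le[of a x] sublinearD(3)[OF sl(1), of a x] by simp
        show "u (r *\<^sub>R x) = r * u x" if r: "r > 0" for r x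
          using hom[OF r, of x] hom[of "1/r" "r *\<^sub>R x"] r by (simp add: field_simps)
        show "u (x + y) \<le> u x + u y" for x y
        proof -
          \<comment> \<open>Here comparability in the chain is used: the smaller of \<open>a\<close>
            and \<open>b\<close> serves in both summands.\<close>
          have *: "u (x + y) \<le> a x + b y" if ab: "a \<in> C" "b \<in> C" for a b
          proof -
            obtain c where c: "c \<in> C" "c \<le> a" "c \<le> b" using C(1)[OF ab] ab by auto
            have "u (x + y) \<le> c x + c y"
              using le[OF c(1), of "x + y"] sublinearD(1)[OF sl(1)[OF c(1)], of x y] by simp
            also have "\<dots> \<le> a x + b y" using c by (intro add_mono) (auto simp: le_fun_def)
            finally show ?thesis .
          qed
          have "u (x + y) - u y \<le> u x"
          proof (rule ge)
            fix a assume a: "a \<in> C"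
            have "u (x + y) - a x \<le> u y" by (rule ge) (use *[OF a] in \<open>simp add: algebra_simps\<close>)
            then show "u (x + y) - u y \<le> a x" by simp
          qed
          then show ?thesis by simp
        qed
      qed
      moreover have "u \<le> p" using le False sl(2) by (meson all_not_in_conv le_funI le_funD order_trans)
      ultimately show ?thesis using le by (intro bexI[of _ u]) (auto simp: S_def le_fun_def)
    qed
  qed
  then obtain m where m: "m \<in> S" "\<And>q. q \<in> S \<Longrightarrow> q \<le> m \<Longrightarrow> q = m" by blast
  show thesis
  proof (rule that)
    show "sublinear m" "m \<le> p" using m(1) by (auto simp: S_def)
    fix q assume "sublinear q" "q \<le> m"
    then show "q = m" using m \<open>m \<le> p\<close> by (intro m(2)) (auto simp: S_def)
  qed
qed

text \<open>Hahn--Banach: a minimal sublinear functional is linear, since it coincides with all its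
  shifts.\<close>

lemma norming_functional:
  fixes x :: "'a::real_normed_vector"
  obtains \<gamma> :: "'a \<Rightarrow>\<^sub>L real" where "norm \<gamma> \<le> 1" "blinfun_apply \<gamma> x = norm x"
proof -
  have "sublinear (norm :: 'a \<Rightarrow> real)" by (simp add: sublinear_def norm_triangle_ineq)
  note sh = sublinear_shift[OF this, where y = x]
  \<comment> \<open>The minimal functional is sought below the shift of the norm at \<open>x\<close>
    and not merely below the norm. This forces \<open>m (- x) \<le> - norm x\<close>, hence
    \<open>m x = norm x\<close>.\<close>
  obtain m where m: "sublinear m" "m \<le> (\<lambda>z. INF t\<in>{0..}. norm (z + t *\<^sub>R x) - t * norm x)"
    and min: "\<And>q. sublinear q \<Longrightarrow> q \<le> m \<Longrightarrow> q = m"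
    using minimal_sublinear[OF sh(1)] by blast
  note M = sublinearD[OF m(1)]
  have sup: "m u + m v \<le> m (u + v)" for u v
  proof -
    note s = sublinear_shift[OF m(1), where y = v]
    have "m = (\<lambda>z. INF t\<in>{0..}. m (z + t *\<^sub>R v) - t * m v)"
      by (rule min[OF s(1), symmetric]) (use s(2) in \<open>simp add: le_fun_def\<close>)
    then have "m u \<le> m (u + v) - m v" using s(3)[of u] by metis
    then show ?thesis by simp
  qed
  then have add: "m (u + v) = m u + m v" for u v using M(1)[of u v] by (simp add: order_antisym)
  have neg: "m (- u) = - m u" for u using add[of u "- u"] M(4) by simp
  have scl: "m (r *\<^sub>R u) = r * m u" for r u
  proof (cases "r > 0")
    case False
    then show ?thesis
      using M(2)[of "- r" u] neg[of "r *\<^sub>R u"] M(4) by (cases "r = 0") auto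
  qed (use M(2) in simp)
  have abs: "\<bar>m u\<bar> \<le> norm u" for u using M(3)[of u] M(6)[of u] by simp
  have bl: "bounded_linear m"
    by (rule bounded_linear_intro[of m 1]) (use add scl abs in auto)
  have "m (- x) \<le> norm (- x + x) - norm x" using m(2) sh(3)[of "- x"] by (meson le_funD order_trans)
  then have "norm x \<le> m x" using neg[of x] by simp
  then have "m x = norm x" using abs[of x] by simp
  then show thesis
    using abs by (intro that[of "Blinfun m"])
      (auto simp: bounded_linear_Blinfun_apply[OF bl] intro!: norm_blinfun_bound)
qed

lemma functionals_separate:
  fixes x y :: "'a::real_normed_vector"
  assumes "\<And>\<gamma> :: 'a \<Rightarrow>\<^sub>L real. blinfun_apply \<gamma> x = blinfun_apply \<gamma> y"
  shows "x = y"
proof -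
  obtain \<gamma> :: "'a \<Rightarrow>\<^sub>L real" where "blinfun_apply \<gamma> (x - y) = norm (x - y)"
    using norming_functional[of "x - y"] by blast
  then show ?thesis using assms[of \<gamma>] by (simp add: blinfun.diff_right)
qed

section \<open>Closed complements and continuity of their projections\<close>

lemma closed_compl_sym: "closed_compl F G \<Longrightarrow> closed_compl G F"
  unfolding closed_compl_def by (metis add.commute inf_commute)

lemma closed_complD:
  assumes "closed_compl F G"
  shows "subspace F" "subspace G" "closed F" "closed G"
    "x \<in> F \<Longrightarrow> x \<in> G \<Longrightarrow> x = 0" "\<exists>f\<in>F. \<exists>g\<in>G. x = f + g"
  using assms unfolding closed_compl_def by blast+

lemma proj_along_unique:
  assumes "closed_compl F G" "g \<in> G" "x - g \<in> F"
  shows "proj_along F G x = g"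
  unfolding proj_along_def
proof (rule the_equality)
  note C = closed_complD[OF assms(1)]
  fix h assume h: "h \<in> G \<and> x - h \<in> F"
  have "h - g \<in> G" using h assms C by (simp add: subspace_diff)
  moreover have "h - g \<in> F" using subspace_diff[OF C(1) assms(3), of "x - h"] h by simp
  ultimately show "h = g" using C(5)[of "h - g"] by simp
qed (use assms in simp)

lemma proj_along_in:
  assumes "closed_compl F G"
  shows "proj_along F G x \<in> G" "x - proj_along F G x \<in> F"
proof -
  obtain f g where "f \<in> F" "g \<in> G" "x = f + g" using closed_complD(6)[OF assms] by blast
  moreover from this have "proj_along F G x = g" by (intro proj_along_unique assms) auto
  ultimately show "proj_along F G x \<in> G" "x - proj_along F G x \<in> F" by auto
qed

lemma linear_proj_along:
  assumes "closed_compl F G" shows "linear (proj_along F G)"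
proof (rule linearI)
  note C = closed_complD[OF assms] and P = proj_along_in[OF assms]
  fix x y show "proj_along F G (x + y) = proj_along F G x + proj_along F G y"
    by (rule proj_along_unique[OF assms])
      (use P subspace_add[OF C(2)] subspace_add[OF C(1) P(2)[of x] P(2)[of y]] in \<open>auto simp: algebra_simps\<close>)
  fix r show "proj_along F G (r *\<^sub>R x) = r *\<^sub>R proj_along F G x"
    by (rule proj_along_unique[OF assms])
      (use P subspace_scale[OF C(2)] subspace_scale[OF C(1) P(2)[of x]] in \<open>auto simp: algebra_simps\<close>)
qed

text \<open>The Baire argument of the open mapping theorem, applied to \<open>F \<times> G \<rightarrow> E\<close>.\<close>

lemma bounded_linear_proj_along:
  fixes F G :: "'e::banach set"
  assumes FG: "closed_compl F G"
  shows "bounded_linear (proj_along F G)"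
proof -
  let ?p = "proj_along F G"
  note C = closed_complD[OF FG] and P = proj_along_in[OF FG]
  interpret p: linear ?p by (rule linear_proj_along[OF FG])
  define B where "B n = {x. norm (?p x) \<le> real n}" for n :: nat
  have "\<exists>n. euclidean interior_of (closure (B n)) \<noteq> {}"
  proof (rule ccontr)
    assume "\<nexists>n. euclidean interior_of (closure (B n)) \<noteq> {}"
    then have "euclidean interior_of (\<Union>(range (\<lambda>n. closure (B n)))) = {}"
      by (intro Baire_category_alt disjI1 completely_metrizable_space_euclidean) auto
    moreover have "x \<in> (\<Union>(range (\<lambda>n. closure (B n))))" for x
    proof -
      obtain n where "norm (?p x) \<le> real n" using real_arch_simple by blast
      then show ?thesis using closure_subset[of "B n"] by (auto simp: B_def)
    qed
    then have "\<Union>(range (\<lambda>n. closure (B n))) = UNIV" by blast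
    ultimately show False using interior_of_topspace[of "euclidean :: 'e topology"] by simp
  qed
  then obtain n T a where T: "open T" "a \<in> T" "T \<subseteq> closure (B n)" by (auto simp: interior_of_def)
  then obtain r where r: "r > 0" "ball a r \<subseteq> closure (B n)" by (meson openE subset_trans)
  \<comment> \<open>Twice \<open>n\<close>, since a point near 0 is approximated by a difference of
    two elements of \<open>B n\<close>, one near \<open>a + x\<close> and one near
    \<open>a\<close>.\<close>
  define K where "K = 2 * real n"
  have approx1: "\<exists>y. norm (?p y) \<le> K \<and> norm (x - y) < d" if x: "norm x < r" and d: "d > 0" for x d
  proof -
    have "a + x \<in> closure (B n)" "a \<in> closure (B n)" using r x by (auto simp: subset_iff dist_norm)
    then obtain y z where yz: "y \<in> B n" "dist y (a + x) < d/2" "z \<in> B n" "dist z a < d/2"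
      using d by (metis closure_approachable half_gt_zero)
    have "norm (?p (y - z)) \<le> K"
      using norm_triangle_ineq4[of "?p y" "?p z"] yz by (simp add: p.diff B_def K_def)
    moreover have eq: "x - (y - z) = (z - a) - (y - (a + x))" by simp
    have "norm (x - (y - z)) \<le> norm (z - a) + norm (y - (a + x))"
      unfolding eq by (rule norm_triangle_ineq4)
    then have "norm (x - (y - z)) < d" using yz(2,4) by (simp add: dist_norm)
    ultimately show ?thesis by blast
  qed
  have approx: "\<exists>y. norm (?p y) \<le> K * s \<and> norm (x - y) < r * s / 2" if x: "norm x < r * s" and s: "s > 0" for x s
  proof -
    have "norm ((1/s) *\<^sub>R x) < r" using x s by (simp add: field_simps)
    then obtain y where y: "norm (?p y) \<le> K" "norm ((1/s) *\<^sub>R x - y) < r/2"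
      using approx1[of "(1/s) *\<^sub>R x" "r/2"] r by auto
    have eq: "x - s *\<^sub>R y = s *\<^sub>R ((1/s) *\<^sub>R x - y)" using s by (simp add: scaleR_diff_right)
    have "norm (x - s *\<^sub>R y) = s * norm ((1/s) *\<^sub>R x - y)" unfolding eq using s by simp
    then have "norm (x - s *\<^sub>R y) < r * s / 2"
      using mult_strict_left_mono[OF y(2) s] by (simp add: mult.commute)
    moreover have "norm (?p (s *\<^sub>R y)) \<le> K * s" using y s by (simp add: p.scaleR mult.commute)
    ultimately show ?thesis by blast
  qed
  then obtain Y where Y: "\<And>x s. norm x < r * s \<Longrightarrow> s > 0 \<Longrightarrow>
      norm (?p (Y x s)) \<le> K * s \<and> norm (x - Y x s) < r * s / 2" by metis
  have bound: "norm (?p x) \<le> 2 * (K * s)" if x: "norm x < r * s" and s: "s > 0" for x s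
  proof -
    \<comment> \<open>\<open>X k\<close> is what remains of \<open>x\<close> after \<open>k\<close>
      corrections. Each correction has a projection of norm at most \<open>K * s / 2^k\<close>, and
      the bound on the remainder is halved.\<close>
    define X where "X = rec_nat x (\<lambda>k z. z - Y z (s / 2^k))"
    have X: "X 0 = x" "X (Suc k) = X k - Y (X k) (s / 2^k)" for k by (simp_all add: X_def)
    define y where "y k = Y (X k) (s / 2^k)" for k
    have Xb: "norm (X k) < r * (s / 2^k)" for k
    proof (induction k)
      case (Suc k)
      then show ?case using Y[of "X k" "s / 2^k"] s by (simp add: X)
    qed (use x X in simp)
    have py: "norm (?p (y k)) \<le> K * s * (1/2)^k" for k
      using Y[OF Xb, of k] s by (simp add: y_def power_one_over field_simps)
    have gs: "(\<lambda>k. K * s * (1/2)^k) sums (K * s * 2)"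
      using sums_mult[OF geometric_sums[of "1/2::real"], of "K * s"] by simp
    have sm: "summable (\<lambda>k. ?p (y k))"
      by (rule summable_comparison_test'[OF sums_summable[OF gs], of 0]) (use py in auto)
    define g where "g = (\<Sum>k. ?p (y k))"
    have gl: "(\<lambda>n. \<Sum>k<n. ?p (y k)) \<longlonglongrightarrow> g" unfolding g_def by (rule summable_LIMSEQ[OF sm])
    have gG: "g \<in> G"
      by (rule closed_sequentially[OF C(4) _ gl]) (use P C in \<open>auto intro: subspace_sum\<close>)
    have Xs: "X n = x - (\<Sum>k<n. y k)" for n by (induction n) (auto simp: X y_def)
    have X0: "X \<longlonglongrightarrow> 0"
    proof (rule Lim_null_comparison)
      show "\<forall>\<^sub>F k in sequentially. norm (X k) \<le> r * s * (1/2)^k"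
        using Xb by (intro always_eventually allI less_imp_le) (simp add: power_one_over)
      show "(\<lambda>k. r * s * (1/2)^k) \<longlonglongrightarrow> 0"
        by (intro tendsto_mult_right_zero LIMSEQ_power_zero) auto
    qed
    have "(\<lambda>n. (x - X n) - (\<Sum>k<n. ?p (y k))) \<longlonglongrightarrow> (x - 0) - g"
      by (intro tendsto_diff X0 gl tendsto_const)
    moreover have "(x - X n) - (\<Sum>k<n. ?p (y k)) = (\<Sum>k<n. y k - ?p (y k))" for n
      by (simp add: Xs sum_subtractf)
    ultimately have fl: "(\<lambda>n. \<Sum>k<n. y k - ?p (y k)) \<longlonglongrightarrow> x - g" by simp
    have "x - g \<in> F"
      by (rule closed_sequentially[OF C(3) _ fl]) (use P C in \<open>auto intro: subspace_sum\<close>)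
    then have "?p x = g" by (intro proj_along_unique FG gG)
    moreover have "norm g \<le> (\<Sum>k. K * s * (1/2)^k)"
      unfolding g_def by (rule norm_suminf_le[OF py sums_summable[OF gs]])
    ultimately show ?thesis using sums_unique[OF gs] by (simp add: mult_ac)
  qed
  show ?thesis
  proof (rule bounded_linear_intro[of _ "4 * K / r"])
    fix x
    show "norm (?p x) \<le> norm x * (4 * K / r)"
    proof (cases "x = 0")
      case False
      \<comment> \<open>The choice \<open>s = 2 * norm x / r\<close> makes the requirement
        \<open>norm x < r * s\<close> strict.\<close>
      then have "norm (?p x) \<le> 2 * (K * (2 * norm x / r))" using r by (intro bound) auto
      then show ?thesis by (simp add: mult_ac)
    qed (simp add: p.zero)
  qed (simp_all add: p.add p.scaleR)
qed

section \<open>Smoothness through explicit higher derivatives\<close>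

abbreviation norm_prod :: "'a::real_normed_vector list \<Rightarrow> real" where
  "norm_prod vs \<equiv> prod_list (map norm vs)"

lemma prod_list_nonneg: "(\<And>x. x \<in> set xs \<Longrightarrow> 0 \<le> f x) \<Longrightarrow> 0 \<le> prod_list (map f xs)"
  for f :: "'a \<Rightarrow> real"
  by (induction xs) auto

text \<open>The higher product rule: \<open>leib b f g vs\<close> sums \<open>b (f us) (g ws)\<close> over all ways to distribute
  \<open>vs\<close> over two subsequences \<open>us\<close> and \<open>ws\<close>.  The vector in front is the newest direction of
  differentiation, so that the recursion below is the Leibniz rule itself.\<close>

primrec leib :: "('b \<Rightarrow> 'c \<Rightarrow> 'd::plus) \<Rightarrow> ('a list \<Rightarrow> 'b) \<Rightarrow> ('a list \<Rightarrow> 'c) \<Rightarrow> 'a list \<Rightarrow> 'd" where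
  "leib b f g [] = b (f []) (g [])"
| "leib b f g (v # vs) = leib b (\<lambda>us. f (v # us)) g vs + leib b f (\<lambda>ws. g (v # ws)) vs"

text \<open>The premises on \<open>f\<close> and \<open>g\<close> concern only lists no longer than
  \<open>vs'\<close>. As a congruence rule for recursive definitions this shows the termination
  proof of \<open>proj_derivs\<close> that the recursive calls act on shorter lists.\<close>

lemma leib_cong [fundef_cong]:
  "b = b' \<Longrightarrow> vs = vs' \<Longrightarrow> (\<And>us. length us \<le> length vs' \<Longrightarrow> f us = f' us) \<Longrightarrow>
    (\<And>ws. length ws \<le> length vs' \<Longrightarrow> g ws = g' ws) \<Longrightarrow> leib b f g vs = leib b' f' g' vs'"
proof (induction vs arbitrary: vs' f f' g g')
  case (Cons v vs)
  have "leib b (\<lambda>us. f (v # us)) g vs = leib b' (\<lambda>us. f' (v # us)) g' vs"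
    by (rule Cons.IH) (use Cons.prems in auto)
  moreover have "leib b f (\<lambda>us. g (v # us)) vs = leib b' f' (\<lambda>us. g' (v # us)) vs"
    by (rule Cons.IH) (use Cons.prems in auto)
  ultimately show ?case using Cons.prems(2) by auto
qed auto

lemma leib_add_left:
  "bounded_bilinear b \<Longrightarrow> leib b (\<lambda>us. f us + f' us) g vs = leib b f g vs + leib b f' g vs"
  by (induction vs arbitrary: f f' g) (simp_all add: bounded_bilinear.add_left)

lemma leib_add_right:
  "bounded_bilinear b \<Longrightarrow> leib b f (\<lambda>us. g us + g' us) vs = leib b f g vs + leib b f g' vs"
  by (induction vs arbitrary: f g g') (simp_all add: bounded_bilinear.add_right)

lemma leib_diff_left:
  "bounded_bilinear b \<Longrightarrow> leib b (\<lambda>us. f us - f' us) g vs = leib b f g vs - leib b f' g vs"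
  by (induction vs arbitrary: f f' g) (simp_all add: bounded_bilinear.diff_left)

lemma leib_diff_right:
  "bounded_bilinear b \<Longrightarrow> leib b f (\<lambda>us. g us - g' us) vs = leib b f g vs - leib b f g' vs"
  by (induction vs arbitrary: f g g') (simp_all add: bounded_bilinear.diff_right)

lemma leib_scaleR_left:
  "bounded_bilinear b \<Longrightarrow> leib b (\<lambda>us. r *\<^sub>R f us) g vs = r *\<^sub>R leib b f g vs"
  by (induction vs arbitrary: f g) (simp_all add: bounded_bilinear.scaleR_left scaleR_add_right)

lemma leib_scaleR_right:
  "bounded_bilinear b \<Longrightarrow> leib b f (\<lambda>us. r *\<^sub>R g us) vs = r *\<^sub>R leib b f g vs"
  by (induction vs arbitrary: f g) (simp_all add: bounded_bilinear.scaleR_right scaleR_add_right)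

lemma leib_linear_bilinear:
  assumes "\<And>p q. linear (\<lambda>h. b h p q)"
  shows "linear (\<lambda>h. leib (b h) f g vs)"
  by (induction vs arbitrary: f g) (auto intro: assms linear_compose_add)

text \<open>There is one summand for each of the \<open>2 ^ length vs\<close> distributions of the
  directions, and in each summand their norms multiply to \<open>norm_prod vs\<close>.\<close>

lemma leib_bound:
  assumes b: "\<And>p q. norm (b p q) \<le> B * norm p * norm q" and "0 \<le> B" "0 \<le> K" "0 \<le> L"
    and "\<And>us. length us \<le> length vs \<Longrightarrow> norm (f us) \<le> K * norm_prod us"
    and "\<And>us. length us \<le> length vs \<Longrightarrow> norm (g us) \<le> L * norm_prod us"
  shows "norm (leib b f g vs) \<le> 2 ^ length vs * (B * K * L) * norm_prod vs"
  using assms(3-)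
proof (induction vs arbitrary: f g K L)
  case Nil
  have "norm (b (f []) (g [])) \<le> B * norm (f []) * norm (g [])" by (rule b)
  also have "\<dots> \<le> B * K * L"
    using Nil(3)[of "[]"] Nil(4)[of "[]"] Nil(1,2) \<open>0 \<le> B\<close> by (intro mult_mono mult_nonneg_nonneg) auto
  finally show ?case by simp
next
  case (Cons v vs)
  have "norm (leib b (\<lambda>us. f (v # us)) g vs) \<le> 2 ^ length vs * (B * (K * norm v) * L) * norm_prod vs"
  proof (rule Cons.IH)
    show "norm (f (v # us)) \<le> K * norm v * norm_prod us" if "length us \<le> length vs" for us
      using Cons.prems(3)[of "v # us"] that by (simp add: mult.assoc)
  qed (use Cons.prems in simp_all)
  moreover have "norm (leib b f (\<lambda>us. g (v # us)) vs) \<le> 2 ^ length vs * (B * K * (L * norm v)) * norm_prod vs"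
  proof (rule Cons.IH)
    show "norm (g (v # us)) \<le> L * norm v * norm_prod us" if "length us \<le> length vs" for us
      using Cons.prems(4)[of "v # us"] that by (simp add: mult.assoc)
  qed (use Cons.prems in simp_all)
  ultimately show ?case
    using norm_triangle_ineq[of "leib b (\<lambda>us. f (v # us)) g vs" "leib b f (\<lambda>us. g (v # us)) vs"]
    by (simp add: algebra_simps)
qed

text \<open>Orders are not separated: a single function on lists carries all derivatives, and
  linearity is demanded in every slot of every list of length at most \<open>k\<close>.\<close>

definition multilin :: "nat \<Rightarrow> ('a::real_vector list \<Rightarrow> 'b::real_vector) \<Rightarrow> bool" where
  "multilin k m \<longleftrightarrow> (\<forall>us ws. length us + length ws < k \<longrightarrow> linear (\<lambda>x. m (us @ x # ws)))"

definition multibdd :: "nat \<Rightarrow> ('a::real_normed_vector list \<Rightarrow> 'b::real_normed_vector) \<Rightarrow> bool" where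
  "multibdd k m \<longleftrightarrow> (\<exists>K\<ge>0. \<forall>vs. length vs \<le> k \<longrightarrow> norm (m vs) \<le> K * norm_prod vs)"

text \<open>The estimate is uniform in the directions \<open>vs\<close>, so it expresses
  differentiability in the norm of multilinear maps and not just pointwise; one neighbourhood serves
  all orders up to \<open>k\<close>.\<close>

definition deriv_step ::
  "'a::real_normed_vector set \<Rightarrow> ('a \<Rightarrow> 'a list \<Rightarrow> 'b::real_normed_vector) \<Rightarrow> nat \<Rightarrow> 'a \<Rightarrow> bool" where
  "deriv_step V D k x \<longleftrightarrow> (\<forall>e>0. \<forall>\<^sub>F y in at x within V. \<forall>vs. length vs \<le> k \<longrightarrow>
     norm (D y vs - D x vs - D x ((y - x) # vs)) \<le> e * norm (y - x) * norm_prod vs)"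

text \<open>\<open>D x vs\<close> with \<open>length vs = k\<close> is the \<open>k\<close>-th derivative at \<open>x\<close> in the directions \<open>vs\<close>.\<close>

definition deriv_family ::
  "'a::real_normed_vector set \<Rightarrow> ('a \<Rightarrow> 'a list \<Rightarrow> 'b::real_normed_vector) \<Rightarrow> nat \<Rightarrow> bool" where
  "deriv_family V D k \<longleftrightarrow>
     (\<forall>x\<in>V. multilin (Suc k) (D x) \<and> multibdd (Suc k) (D x) \<and> deriv_step V D k x)"

section \<open>The product rule for families of derivatives\<close>

lemma multilin_Cons: "multilin (Suc k) f \<Longrightarrow> multilin k (\<lambda>us. f (v # us))"
  unfolding multilin_def
proof (intro allI impI)
  fix us ws :: "'a list"
  assume "\<forall>us ws. length us + length ws < Suc k \<longrightarrow> linear (\<lambda>x. f (us @ x # ws))"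
  from this[rule_format, of "v # us" ws] show "linear (\<lambda>x. f (v # us @ x # ws))"
    if "length us + length ws < k" using that by simp
qed

lemma multilin_hd: "multilin k f \<Longrightarrow> length us < k \<Longrightarrow> linear (\<lambda>v. f (v # us))"
  unfolding multilin_def by (drule spec[of _ "[]"]) simp

lemma multilin_leib:
  assumes b: "bounded_bilinear b" and f: "multilin k f" and g: "multilin k g"
  shows "multilin k (leib b f g)"
proof -
  have *: "linear (\<lambda>x. leib b f g (us @ x # ws))"
    if "length us + length ws < k" "multilin k f" "multilin k g" for us ws k f g
    using that
  proof (induction us arbitrary: f g k)
    case Nil
    have f: "linear (\<lambda>v. f (v # us))" and g: "linear (\<lambda>v. g (v # us))" if "length us \<le> length ws" for us
      using Nil that by (auto intro!: multilin_hd)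
    have "leib b (\<lambda>us. f ((x + y) # us)) g ws = leib b (\<lambda>us. f (x # us) + f (y # us)) g ws"
      "leib b f (\<lambda>us. g ((x + y) # us)) ws = leib b f (\<lambda>us. g (x # us) + g (y # us)) ws" for x y
      by (auto intro!: leib_cong linear_add[OF f] linear_add[OF g])
    moreover have "leib b (\<lambda>us. f ((r *\<^sub>R x) # us)) g ws = leib b (\<lambda>us. r *\<^sub>R f (x # us)) g ws"
      "leib b f (\<lambda>us. g ((r *\<^sub>R x) # us)) ws = leib b f (\<lambda>us. r *\<^sub>R g (x # us)) ws" for x r
      by (auto intro!: leib_cong linear_scale[OF f] linear_scale[OF g])
    ultimately show ?case
      by (intro linearI) (simp_all add: leib_add_left[OF b] leib_add_right[OF b]
          leib_scaleR_left[OF b] leib_scaleR_right[OF b] scaleR_add_right)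
  next
    case (Cons u us)
    then obtain j where k: "k = Suc j" by (cases k) auto
    have mono: "multilin j f" "multilin j g" using Cons.prems k by (auto simp: multilin_def)
    show ?case
      unfolding append_Cons leib.simps
      by (intro linear_compose_add Cons.IH[of j] multilin_Cons)
        (use Cons.prems k mono in auto)
  qed
  show ?thesis
    unfolding multilin_def[of k "leib b f g"] using *[OF _ f g] by blast
qed

text \<open>One neighbourhood of \<open>x\<close> works for all bilinear maps \<open>b\<close>
  simultaneously, with an error proportional to their bound \<open>B\<close>. This uniformity
  matters later, where \<open>b\<close> is \<open>sandwich h\<close> and \<open>h\<close> is itself
  one of the directions of differentiation.\<close>

lemma leib_deriv_step:
  fixes D1 :: "'a::real_normed_vector \<Rightarrow> 'a list \<Rightarrow> 'b::real_normed_vector"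
    and D2 :: "'a \<Rightarrow> 'a list \<Rightarrow> 'c::real_normed_vector"
  assumes D1: "deriv_family V D1 k" and D2: "deriv_family V D2 k" and x: "x \<in> V" and e: "e > 0"
  shows "\<forall>\<^sub>F y in at x within V.
    \<forall>(b :: 'b \<Rightarrow> 'c \<Rightarrow> 'd::real_normed_vector) B vs.
      bounded_bilinear b \<and> 0 \<le> B \<and> (\<forall>p q. norm (b p q) \<le> B * norm p * norm q) \<and> length vs \<le> k \<longrightarrow>
      norm (leib b (D1 y) (D2 y) vs - leib b (D1 x) (D2 x) vs - leib b (D1 x) (D2 x) ((y - x) # vs))
        \<le> e * B * norm (y - x) * norm_prod vs"
proof -
  obtain K1 where K1: "K1 \<ge> 0" "\<And>vs. length vs \<le> Suc k \<Longrightarrow> norm (D1 x vs) \<le> K1 * norm_prod vs"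
    using D1 x unfolding deriv_family_def multibdd_def by blast
  obtain K2 where K2: "K2 \<ge> 0" "\<And>vs. length vs \<le> Suc k \<Longrightarrow> norm (D2 x vs) \<le> K2 * norm_prod vs"
    using D2 x unfolding deriv_family_def multibdd_def by blast
  \<comment> \<open>\<open>L\<close> is the bound for the second factor near \<open>x\<close>: its
    increment is at most \<open>K2 + 1\<close> times a distance of at most 1. The three terms in
    \<open>C\<close> belong to the three parts of the remainder, and the last 1 makes
    \<open>C\<close> positive.\<close>
  define L where "L = 2 * K2 + 1"
  define C where "C = 2 ^ k * (L + K1 * (K2 + 1) + K1) + 1"
  have C: "C > 0" using K1 K2 by (auto simp: C_def L_def intro!: add_nonneg_pos mult_nonneg_nonneg)
  define d where "d = min 1 (e / C)"
  have d: "d > 0" "d \<le> 1" using e C by (auto simp: d_def)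
  have "d * C \<le> e" using C by (simp add: d_def min_def field_simps)
  moreover have "d * (2 ^ k * (L + K1 * (K2 + 1) + K1)) \<le> d * C" using d by (simp add: C_def)
  ultimately have dC: "2 ^ k * (d * L + K1 * ((K2 + 1) * d) + K1 * d) \<le> e" by (simp add: algebra_simps)
  have E: "\<forall>\<^sub>F y in at x within V. norm (y - x) < d"
    using d by (auto simp: eventually_at dist_norm)
  have E1: "\<forall>\<^sub>F y in at x within V. \<forall>vs. length vs \<le> k \<longrightarrow>
     norm (D1 y vs - D1 x vs - D1 x ((y - x) # vs)) \<le> d * norm (y - x) * norm_prod vs"
    using D1 x d unfolding deriv_family_def deriv_step_def by blast
  have E2: "\<forall>\<^sub>F y in at x within V. \<forall>vs. length vs \<le> k \<longrightarrow>
     norm (D2 y vs - D2 x vs - D2 x ((y - x) # vs)) \<le> d * norm (y - x) * norm_prod vs"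
    using D2 x d unfolding deriv_family_def deriv_step_def by blast
  show ?thesis
    using E E1 E2
  proof eventually_elim
    case (elim y)
    define n where "n = norm (y - x)"
    have n: "0 \<le> n" "n \<le> d" using elim(1) by (auto simp: n_def)
    show ?case
    proof (intro allI impI, elim conjE)
      fix b :: "'b \<Rightarrow> 'c \<Rightarrow> 'd" and B :: real and vs :: "'a list"
      assume b: "bounded_bilinear b" and B: "0 \<le> B" "\<forall>p q. norm (b p q) \<le> B * norm p * norm q"
        and vs: "length vs \<le> k"
      define f0 g0 f' g' where "f0 = D1 x" and "g0 = D2 x"
        and "f' = (\<lambda>us. D1 x ((y - x) # us))" and "g' = (\<lambda>us. D2 x ((y - x) # us))"
      define f1 g1 where "f1 = D1 y" and "g1 = D2 y"
      have np: "0 \<le> norm_prod us" for us :: "'a list" by (rule prod_list_nonneg) simp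
      have r1: "norm (f1 us - f0 us - f' us) \<le> (d * n) * norm_prod us" if "length us \<le> length vs" for us
        using elim(2) that vs by (simp add: f1_def f0_def f'_def n_def)
      have r2: "norm (g1 us - g0 us - g' us) \<le> (d * n) * norm_prod us" if "length us \<le> length vs" for us
        using elim(3) that vs by (simp add: g1_def g0_def g'_def n_def)
      have bf: "norm (f0 us) \<le> K1 * norm_prod us" and bg: "norm (g0 us) \<le> K2 * norm_prod us"
        and bf': "norm (f' us) \<le> (K1 * n) * norm_prod us" and bg': "norm (g' us) \<le> (K2 * n) * norm_prod us"
        if "length us \<le> length vs" for us
        using K1(2)[of us] K2(2)[of us] K1(2)[of "(y - x) # us"] K2(2)[of "(y - x) # us"] that vs
        by (simp_all add: f0_def g0_def f'_def g'_def n_def mult.assoc)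
      have dg: "norm (g1 us - g0 us) \<le> ((K2 + 1) * n) * norm_prod us" if us: "length us \<le> length vs" for us
      proof -
        have "norm (g1 us - g0 us) \<le> norm (g1 us - g0 us - g' us) + norm (g' us)"
          using norm_triangle_ineq[of "g1 us - g0 us - g' us" "g' us"] by simp
        also have "\<dots> \<le> (d * n) * norm_prod us + (K2 * n) * norm_prod us"
          by (intro add_mono r2 bg' us)
        also have "\<dots> = (d * n + K2 * n) * norm_prod us" by (simp add: distrib_right)
        also have "\<dots> \<le> ((K2 + 1) * n) * norm_prod us"
          using d n mult_right_mono[of d 1 n] by (intro mult_right_mono np) (simp add: distrib_right)
        finally show ?thesis .
      qed
      have g1b: "norm (g1 us) \<le> L * norm_prod us" if us: "length us \<le> length vs" for us
      proof -
        have "norm (g1 us) \<le> norm (g1 us - g0 us) + norm (g0 us)"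
          using norm_triangle_ineq[of "g1 us - g0 us" "g0 us"] by simp
        also have "\<dots> \<le> ((K2 + 1) * n) * norm_prod us + K2 * norm_prod us"
          by (intro add_mono dg bg us)
        also have "\<dots> = ((K2 + 1) * n + K2) * norm_prod us" by (simp add: distrib_right)
        also have "\<dots> \<le> L * norm_prod us"
          using mult_left_mono[of n 1 "K2 + 1"] d n K2(1)
          by (intro mult_right_mono np) (simp add: L_def)
        finally show ?thesis .
      qed
      \<comment> \<open>The remainder \<open>f1 g1 - f0 g0 - f' g0 - f0 g'\<close> is regrouped into
        small parts: two of them contain the remainder of one factor, the middle one multiplies two
        increments of first order.\<close>
      have "leib b (D1 y) (D2 y) vs - leib b (D1 x) (D2 x) vs - leib b (D1 x) (D2 x) ((y - x) # vs)
        = leib b (\<lambda>us. f1 us - f0 us - f' us) g1 vs + leib b f' (\<lambda>us. g1 us - g0 us) vs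
          + leib b f0 (\<lambda>us. g1 us - g0 us - g' us) vs" (is "?l = ?a1 + ?a2 + ?a3")
        by (simp add: leib_diff_left[OF b] leib_diff_right[OF b])
          (simp add: f0_def g0_def f'_def g'_def f1_def g1_def)
      then have "norm ?l = norm (?a1 + ?a2 + ?a3)" by simp
      also have "\<dots> \<le> norm ?a1 + norm ?a2 + norm ?a3"
        by (rule order_trans[OF norm_triangle_ineq add_right_mono[OF norm_triangle_ineq]])
      also have "\<dots> \<le> 2 ^ length vs * (B * (d * n) * L) * norm_prod vs
          + 2 ^ length vs * (B * (K1 * n) * ((K2 + 1) * n)) * norm_prod vs
          + 2 ^ length vs * (B * K1 * (d * n)) * norm_prod vs"
        by (intro add_mono leib_bound)
          (use B r1 r2 bf bf' dg g1b n d K1(1) K2(1) in \<open>auto simp: L_def\<close>)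
      also have "\<dots> = 2 ^ length vs * (d * L + K1 * ((K2 + 1) * n) + K1 * d) * (B * n * norm_prod vs)"
        by (simp add: algebra_simps)
      also have "\<dots> \<le> 2 ^ k * (d * L + K1 * ((K2 + 1) * d) + K1 * d) * (B * n * norm_prod vs)"
        using vs n d K1(1) K2(1) B np[of vs]
        by (intro mult_right_mono mult_mono add_mono mult_left_mono power_increasing)
          (auto simp: L_def)
      also have "\<dots> \<le> e * (B * n * norm_prod vs)"
        using n B np[of vs] by (intro mult_right_mono dC) auto
      finally show "norm ?l \<le> e * B * norm (y - x) * norm_prod vs" by (simp add: n_def mult.assoc)
    qed
  qed
qed

lemma multibdd_leib:
  assumes b: "bounded_bilinear b" and f: "multibdd k f" and g: "multibdd k g"
  shows "multibdd k (leib b f g)"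
proof -
  obtain B where B: "0 \<le> B" "\<And>p q. norm (b p q) \<le> norm p * norm q * B"
    using bounded_bilinear.nonneg_bounded[OF b] by blast
  obtain K where K: "0 \<le> K" "\<And>vs. length vs \<le> k \<Longrightarrow> norm (f vs) \<le> K * norm_prod vs"
    using f by (auto simp: multibdd_def)
  obtain L where L: "0 \<le> L" "\<And>vs. length vs \<le> k \<Longrightarrow> norm (g vs) \<le> L * norm_prod vs"
    using g by (auto simp: multibdd_def)
  have "norm (leib b f g vs) \<le> (2 ^ k * (B * K * L)) * norm_prod vs" if "length vs \<le> k" for vs
  proof -
    have "norm (leib b f g vs) \<le> 2 ^ length vs * (B * K * L) * norm_prod vs"
      by (rule leib_bound) (use B K L that in \<open>auto simp: mult_ac\<close>)
    also have "\<dots> \<le> (2 ^ k * (B * K * L)) * norm_prod vs"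
      using that B(1) K(1) L(1)
      by (intro mult_right_mono power_increasing prod_list_nonneg mult_nonneg_nonneg) auto
    finally show ?thesis .
  qed
  then show ?thesis
    unfolding multibdd_def using B(1) K(1) L(1) by (intro exI[of _ "2 ^ k * (B * K * L)"]) auto
qed

lemma deriv_family_leib:
  fixes b :: "'b::real_normed_vector \<Rightarrow> 'c::real_normed_vector \<Rightarrow> 'd::real_normed_vector"
  assumes b: "bounded_bilinear b" and D1: "deriv_family V D1 k" and D2: "deriv_family V D2 k"
  shows "deriv_family V (\<lambda>x. leib b (D1 x) (D2 x)) k"
  unfolding deriv_family_def
proof (intro ballI conjI)
  fix x assume x: "x \<in> V"
  show "multilin (Suc k) (leib b (D1 x) (D2 x))" "multibdd (Suc k) (leib b (D1 x) (D2 x))"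
    using D1 D2 x by (auto simp: deriv_family_def intro: multilin_leib[OF b] multibdd_leib[OF b])
  obtain B where B: "0 \<le> B" "\<And>p q. norm (b p q) \<le> norm p * norm q * B"
    using bounded_bilinear.nonneg_bounded[OF b] by blast
  show "deriv_step V (\<lambda>x. leib b (D1 x) (D2 x)) k x"
    unfolding deriv_step_def
  proof (intro allI impI)
    fix e :: real assume e: "e > 0"
    have e': "e / (B + 1) > 0" "e / (B + 1) * B \<le> e" using e B(1) by (auto simp: field_simps)
    show "\<forall>\<^sub>F y in at x within V. \<forall>vs. length vs \<le> k \<longrightarrow>
      norm (leib b (D1 y) (D2 y) vs - leib b (D1 x) (D2 x) vs - leib b (D1 x) (D2 x) ((y - x) # vs))
        \<le> e * norm (y - x) * norm_prod vs"
      using leib_deriv_step[OF D1 D2 x e'(1), where 'd = 'd]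
    proof eventually_elim
      case (elim y)
      show ?case
      proof (intro allI impI)
        fix vs :: "'a list" assume "length vs \<le> k"
        then have "norm (leib b (D1 y) (D2 y) vs - leib b (D1 x) (D2 x) vs
            - leib b (D1 x) (D2 x) ((y - x) # vs)) \<le> e / (B + 1) * B * norm (y - x) * norm_prod vs"
          using elim b B by (simp add: mult_ac)
        also have "\<dots> \<le> e * norm (y - x) * norm_prod vs"
          using e' by (intro mult_right_mono prod_list_nonneg) auto
        finally show "norm (leib b (D1 y) (D2 y) vs - leib b (D1 x) (D2 x) vs
            - leib b (D1 x) (D2 x) ((y - x) # vs)) \<le> e * norm (y - x) * norm_prod vs" .
      qed
    qed
  qed
qed

text \<open>The function that is \<open>c\<close> on the empty list and 0 elsewhere is the family of
  derivatives of the constant \<open>c\<close>, so the expression is the family of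
  \<open>c - f\<close>.\<close>

lemma multilin_const_diff:
  assumes "multilin k f" shows "multilin k (\<lambda>us. (if us = [] then c else 0) - f us)"
  using assms by (auto simp: multilin_def linear_compose_neg)

lemma multibdd_const_diff:
  assumes "multibdd k f" shows "multibdd k (\<lambda>us. (if us = [] then c else 0) - f us)"
proof -
  obtain K where K: "0 \<le> K" "\<And>vs. length vs \<le> k \<Longrightarrow> norm (f vs) \<le> K * norm_prod vs"
    using assms by (auto simp: multibdd_def)
  have "norm ((if us = [] then c else 0) - f us) \<le> (norm c + K) * norm_prod us" if "length us \<le> k" for us
  proof -
    have "norm ((if us = [] then c else 0) - f us) \<le> norm (if us = [] then c else 0) + norm (f us)"
      by (rule norm_triangle_ineq4)
    also have "\<dots> \<le> norm c * norm_prod us + K * norm_prod us"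
      using prod_list_nonneg[of us norm] by (intro add_mono K that) auto
    finally show ?thesis by (simp add: distrib_right)
  qed
  then show ?thesis unfolding multibdd_def using K(1) by (intro exI[of _ "norm c + K"]) auto
qed

lemma deriv_family_const_diff:
  assumes "deriv_family V D k"
  shows "deriv_family V (\<lambda>x us. (if us = [] then c else 0) - D x us) k"
proof -
  let ?E = "\<lambda>x us. (if us = [] then c else 0) - D x us"
  have "?E y vs - ?E x vs - ?E x (h # vs) = - (D y vs - D x vs - D x (h # vs))" for x y h vs
    by simp
  then have "norm (?E y vs - ?E x vs - ?E x (h # vs)) = norm (D y vs - D x vs - D x (h # vs))" for x y h vs
    by (metis norm_minus_cancel)
  then show ?thesis
    using assms unfolding deriv_family_def deriv_step_def
    by (auto simp only: intro!: multilin_const_diff multibdd_const_diff)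
qed

section \<open>The differential equation satisfied by projections\<close>

definition sandwich :: "('e::real_normed_vector \<Rightarrow>\<^sub>L 'e) \<Rightarrow> ('e \<Rightarrow>\<^sub>L 'e) \<Rightarrow> ('e \<Rightarrow>\<^sub>L 'e) \<Rightarrow> ('e \<Rightarrow>\<^sub>L 'e)" where
  "sandwich h p q = p o\<^sub>L h o\<^sub>L q"

lemma sandwich_bound: "norm (sandwich h p q) \<le> norm h * norm p * norm q"
proof -
  have "norm (p o\<^sub>L h o\<^sub>L q) \<le> norm (p o\<^sub>L h) * norm q" by (rule norm_blinfun_compose)
  also have "\<dots> \<le> (norm p * norm h) * norm q" by (intro mult_right_mono norm_blinfun_compose) simp
  finally show ?thesis by (simp add: sandwich_def mult_ac)
qed

lemma bounded_bilinear_sandwich: "bounded_bilinear (sandwich h)"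
proof
  show "\<exists>K. \<forall>p q. norm (sandwich h p q) \<le> norm p * norm q * K"
    using sandwich_bound[of h] by (intro exI[of _ "norm h"]) (simp add: mult_ac)
qed (auto simp: sandwich_def blinfun_eqI blinfun.bilinear_simps intro!: blinfun_eqI)

lemma linear_sandwich: "linear (\<lambda>h. sandwich h p q)"
  by (rule linearI) (auto simp: sandwich_def blinfun.bilinear_simps intro!: blinfun_eqI)

text \<open>The derivatives of a solution of \<open>f' h = (1 - f) h f\<close>.  The recursion removes the
  \<^emph>\<open>oldest\<close> direction, because differentiating the right-hand side adds new ones in front.\<close>

function proj_derivs ::
  "(('e::real_normed_vector \<Rightarrow>\<^sub>L 'e) \<Rightarrow> 'e \<Rightarrow>\<^sub>L 'e) \<Rightarrow> ('e \<Rightarrow>\<^sub>L 'e) \<Rightarrow> ('e \<Rightarrow>\<^sub>L 'e) list \<Rightarrow> 'e \<Rightarrow>\<^sub>L 'e" where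
  "proj_derivs f x vs = (if vs = [] then f x else
     leib (sandwich (last vs)) (\<lambda>us. (if us = [] then id_blinfun else 0) - proj_derivs f x us)
       (proj_derivs f x) (butlast vs))"
  by auto
termination
  by (relation "Wellfounded.measure (\<lambda>(f, x, vs). length vs)") (auto, (metis Suc_pred length_greater_0_conv less_Suc_eq_le)+)

declare proj_derivs.simps [simp del]

lemma proj_derivs_Nil: "proj_derivs f x [] = f x"
  by (subst proj_derivs.simps) simp

lemma proj_derivs_snoc: "proj_derivs f x (vs @ [h]) =
    leib (sandwich h) (\<lambda>us. (if us = [] then id_blinfun else 0) - proj_derivs f x us) (proj_derivs f x) vs"
  by (subst proj_derivs.simps) simp

text \<open>The last direction enters linearly through \<open>sandwich\<close>; every other slot
  lies inside the Leibniz sum, to which the induction hypothesis applies.\<close>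

lemma multilin_proj_derivs: "multilin k (proj_derivs f x)"
proof (induction k)
  case (Suc k)
  let ?E = "\<lambda>us. (if us = [] then id_blinfun else 0) - proj_derivs f x us"
  have L: "multilin k (leib (sandwich h) ?E (proj_derivs f x))" for h
    by (intro multilin_leib bounded_bilinear_sandwich multilin_const_diff Suc)
  show ?case
    unfolding multilin_def
  proof (intro allI impI)
    fix us ws :: "('a \<Rightarrow>\<^sub>L 'a) list" assume len: "length us + length ws < Suc k"
    show "linear (\<lambda>v. proj_derivs f x (us @ v # ws))"
    proof (cases ws rule: rev_cases)
      case Nil
      then show ?thesis
        by (simp add: proj_derivs_snoc leib_linear_bilinear linear_sandwich)
    next
      case (snoc ws' h)
      then have "proj_derivs f x (us @ v # ws) = leib (sandwich h) ?E (proj_derivs f x) (us @ v # ws')" for v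
        using proj_derivs_snoc[of f x "us @ v # ws'" h] by simp
      then show ?thesis using L[of h] len snoc by (simp add: multilin_def)
    qed
  qed
qed (simp add: multilin_def)

lemma multibdd_proj_derivs: "multibdd k (proj_derivs f x)"
proof (induction k)
  case 0
  show ?case by (auto simp: multibdd_def proj_derivs_Nil intro: exI[of _ "norm (f x)"])
next
  case (Suc k)
  let ?E = "\<lambda>us. (if us = [] then id_blinfun else 0) - proj_derivs f x us"
  obtain K where K: "0 \<le> K" "\<And>vs. length vs \<le> k \<Longrightarrow> norm (?E vs) \<le> K * norm_prod vs"
    using multibdd_const_diff[OF Suc, of id_blinfun] unfolding multibdd_def by blast
  obtain L where L: "0 \<le> L" "\<And>vs. length vs \<le> k \<Longrightarrow> norm (proj_derivs f x vs) \<le> L * norm_prod vs"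
    using Suc unfolding multibdd_def by blast
  have "norm (proj_derivs f x vs) \<le> (norm (f x) + 2 ^ k * (K * L)) * norm_prod vs" if "length vs \<le> Suc k" for vs
  proof (cases vs rule: rev_cases)
    case Nil
    then show ?thesis using K(1) L(1) by (simp add: proj_derivs_Nil)
  next
    case (snoc ws h)
    have "norm (proj_derivs f x vs) \<le> 2 ^ length ws * (norm h * K * L) * norm_prod ws"
      unfolding snoc proj_derivs_snoc
      by (rule leib_bound) (use K L that snoc sandwich_bound in auto)
    also have "\<dots> = 2 ^ length ws * (K * L) * norm_prod vs" by (simp add: snoc mult_ac)
    also have "\<dots> \<le> (norm (f x) + 2 ^ k * (K * L)) * norm_prod vs"
    proof (intro mult_right_mono prod_list_nonneg)
      have "2 ^ length ws * (K * L) \<le> 2 ^ k * (K * L)"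
        using that snoc K(1) L(1) by (intro mult_right_mono power_increasing) auto
      then show "2 ^ length ws * (K * L) \<le> norm (f x) + 2 ^ k * (K * L)"
        using norm_ge_zero[of "f x"] by linarith
    qed simp
    finally show ?thesis .
  qed
  then show ?case unfolding multibdd_def using K(1) L(1)
    by (intro exI[of _ "norm (f x) + 2 ^ k * (K * L)"]) auto
qed

text \<open>The identity in the hypothesis is exact but contains \<open>f y\<close> where the
  derivative has \<open>f x\<close>. Up to sign the error is
  \<open>sandwich (y - x) (f y - f x) (f x)\<close>, which is quadratic in \<open>y - x\<close> once
  \<open>1 - f\<close> is bounded near \<open>x\<close>. That bound is extracted from the identity
  itself: close to \<open>x\<close> it reads \<open>R \<le> Q + R / 2\<close>.\<close>

lemma deriv_step_proj_derivs_0: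
  assumes f: "\<And>x y. x \<in> V \<Longrightarrow> y \<in> V \<Longrightarrow> f y - f x = sandwich (y - x) (id_blinfun - f y) (f x)"
    and x: "x \<in> V"
  shows "deriv_step V (proj_derivs f) 0 x"
  unfolding deriv_step_def
proof (intro allI impI)
  fix e :: real assume e: "e > 0"
  define Q where "Q = norm (id_blinfun - f x)"
  define F where "F = norm (f x)"
  have QF: "Q \<ge> 0" "F \<ge> 0" by (auto simp: Q_def F_def)
  define W where "W = 2 * Q * F * F + 1"
  have W: "W > 0" unfolding W_def using QF by (intro add_nonneg_pos mult_nonneg_nonneg) auto
  \<comment> \<open>The first bound gives \<open>d * F \<le> 1/2\<close>, which allows the term with
    \<open>R\<close> to be absorbed; the second makes the quadratic error at most
    \<open>e * n\<close>.\<close>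
  define d where "d = min (1 / (2 * (F + 1))) (e / W)"
  have d: "d > 0" using e QF W by (auto simp: d_def)
  have "d * (F + 1) \<le> 1 / (2 * (F + 1)) * (F + 1)"
    using QF by (intro mult_right_mono) (auto simp: d_def)
  also have "\<dots> = 1/2" using QF by (simp add: divide_simps)
  finally have dF: "d * F \<le> 1/2" using d by (simp add: distrib_left)
  have "d * W \<le> e / W * W" using W by (intro mult_right_mono) (auto simp: d_def)
  then have "d * W \<le> e" using W by simp
  moreover have "d * (2 * Q * F * F) \<le> d * W" using d by (simp add: W_def)
  ultimately have dQ: "d * (2 * Q * F * F) \<le> e" by linarith
  have E: "\<forall>\<^sub>F y in at x within V. y \<in> V \<and> norm (y - x) < d"
    using d by (auto simp: eventually_at dist_norm)
  then show "\<forall>\<^sub>F y in at x within V. \<forall>vs. length vs \<le> 0 \<longrightarrow>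
      norm (proj_derivs f y vs - proj_derivs f x vs - proj_derivs f x ((y - x) # vs))
        \<le> e * norm (y - x) * norm_prod vs"
  proof eventually_elim
    case (elim y)
    define n where "n = norm (y - x)"
    have n: "0 \<le> n" "n \<le> d" using elim by (auto simp: n_def)
    define R where "R = norm (id_blinfun - f y)"
    have fd: "norm (f y - f x) \<le> n * R * F"
      using f[OF x, of y] elim sandwich_bound[of "y - x" "id_blinfun - f y" "f x"] by (simp add: n_def R_def F_def)
    have "R = norm ((id_blinfun - f x) - (f y - f x))" by (simp add: R_def)
    also have "\<dots> \<le> Q + n * R * F"
      using norm_triangle_ineq4[of "id_blinfun - f x" "f y - f x"] fd by (simp add: Q_def)
    also have "n * R * F \<le> R * (d * F)"
      using mult_left_mono[OF mult_right_mono[OF n(2) QF(2)], of R] by (simp add: R_def mult_ac)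
    also have "R * (d * F) \<le> R * (1/2)" using dF by (intro mult_left_mono) (auto simp: R_def)
    finally have R: "R \<le> 2 * Q" by simp
    have "f y - f x - sandwich (y - x) (id_blinfun - f x) (f x) = - sandwich (y - x) (f y - f x) (f x)"
      using f[OF x, of y] elim
      by (simp add: bounded_bilinear.diff_left[OF bounded_bilinear_sandwich[of "y - x"]] algebra_simps)
    then have "norm (f y - f x - sandwich (y - x) (id_blinfun - f x) (f x)) \<le> n * norm (f y - f x) * F"
      using sandwich_bound[of "y - x" "f y - f x" "f x"] by (simp add: n_def F_def)
    also have "\<dots> \<le> n * (n * R * F) * F" by (intro mult_right_mono mult_left_mono fd n QF)
    also have "\<dots> = (n * R * F * F) * n" by (simp add: mult_ac)
    also have "\<dots> \<le> (d * (2 * Q) * F * F) * n"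
      using n R QF d by (intro mult_right_mono mult_mono) (auto simp: R_def)
    also have "\<dots> = (d * (2 * Q * F * F)) * n" by (simp add: mult_ac)
    also have "\<dots> \<le> e * n" using n by (intro mult_right_mono dQ)
    finally have "norm (f y - f x - sandwich (y - x) (id_blinfun - f x) (f x)) \<le> e * n" .
    then show ?case
      using proj_derivs_snoc[of f x "[]" "y - x"] by (simp add: proj_derivs_Nil n_def)
  qed
qed

text \<open>On a nonempty list of length at most \<open>Suc k\<close> ending in \<open>h\<close> the
  family is a Leibniz sum for \<open>sandwich h\<close> over a list of length at most
  \<open>k\<close>, whose factors are covered by induction. The estimate for Leibniz sums is uniform
  in the bilinear map, here bounded by \<open>norm h\<close>, and so supplies the missing factor of
  \<open>norm_prod\<close>.\<close>

lemma deriv_family_proj_derivs: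
  assumes f: "\<And>x y. x \<in> V \<Longrightarrow> y \<in> V \<Longrightarrow> f y - f x = sandwich (y - x) (id_blinfun - f y) (f x)"
  shows "deriv_family V (proj_derivs f) k"
proof (induction k)
  case 0
  show ?case
    unfolding deriv_family_def
    using multilin_proj_derivs multibdd_proj_derivs deriv_step_proj_derivs_0[of V f, OF f] by blast
next
  case (Suc k)
  let ?D = "proj_derivs f"
  let ?E = "\<lambda>x us. (if us = [] then id_blinfun else 0) - ?D x us"
  have E: "deriv_family V ?E k" by (rule deriv_family_const_diff[OF Suc])
  have "deriv_step V ?D (Suc k) x" if x: "x \<in> V" for x
    unfolding deriv_step_def
  proof (intro allI impI)
    fix e :: real assume e: "e > 0"
    have "\<forall>\<^sub>F y in at x within V. \<forall>vs. length vs \<le> 0 \<longrightarrow>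
        norm (?D y vs - ?D x vs - ?D x ((y - x) # vs)) \<le> e * norm (y - x) * norm_prod vs"
      using deriv_step_proj_derivs_0[of V f, OF f x] e unfolding deriv_step_def by blast
    then show "\<forall>\<^sub>F y in at x within V. \<forall>vs. length vs \<le> Suc k \<longrightarrow>
        norm (?D y vs - ?D x vs - ?D x ((y - x) # vs)) \<le> e * norm (y - x) * norm_prod vs"
      using leib_deriv_step[OF E Suc x e, where 'd = "'a \<Rightarrow>\<^sub>L 'a"]
    proof eventually_elim
      case (elim y)
      show ?case
      proof (intro allI impI)
        fix vs :: "('a \<Rightarrow>\<^sub>L 'a) list" assume len: "length vs \<le> Suc k"
        show "norm (?D y vs - ?D x vs - ?D x ((y - x) # vs)) \<le> e * norm (y - x) * norm_prod vs"
        proof (cases vs rule: rev_cases)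
          case Nil
          then show ?thesis using elim(1) by simp
        next
          case (snoc ws h)
          have "norm (leib (sandwich h) (?E y) (?D y) ws - leib (sandwich h) (?E x) (?D x) ws
              - leib (sandwich h) (?E x) (?D x) ((y - x) # ws)) \<le> e * norm h * norm (y - x) * norm_prod ws"
            by (rule elim(2)[rule_format])
              (use len snoc in \<open>auto intro: bounded_bilinear_sandwich sandwich_bound\<close>)
          then show ?thesis
            using proj_derivs_snoc[of f x "(y - x) # ws" h]
            by (simp add: snoc proj_derivs_snoc mult_ac)
        qed
      qed
    qed
  qed
  then show ?case
    unfolding deriv_family_def using multilin_proj_derivs multibdd_proj_derivs by blast
qed

section \<open>Transfer of smoothness to spaces with carriers\<close>

lemma nrm_mlmaps_le:
  assumes NX: "normed_space X" and "0 \<le> C"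
    and b: "\<And>vs. length vs = k \<Longrightarrow> set vs \<subseteq> carr X \<Longrightarrow> nrm Y (m vs) \<le> C * prod_list (map (nrm X) vs)"
  shows "nrm (mlmaps k X Y) m \<le> C"
  unfolding mlmaps_def nspace.simps
proof (rule cSup_least)
  note X = normed_spaceD[OF NX]
  have "nrm Y (m (replicate k 0)) \<in> {nrm Y (m vs) |vs. length vs = k \<and> set vs \<subseteq> carr X \<and> (\<forall>v\<in>set vs. nrm X v \<le> 1)}"
    using X(9,10) by force
  then show "{nrm Y (m vs) |vs. length vs = k \<and> set vs \<subseteq> carr X \<and> (\<forall>v\<in>set vs. nrm X v \<le> 1)} \<noteq> {}" by blast
  fix r assume "r \<in> {nrm Y (m vs) |vs. length vs = k \<and> set vs \<subseteq> carr X \<and> (\<forall>v\<in>set vs. nrm X v \<le> 1)}"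
  then obtain vs where vs: "length vs = k" "set vs \<subseteq> carr X" "\<forall>v\<in>set vs. nrm X v \<le> 1" "r = nrm Y (m vs)"
    by blast
  have "prod_list (map (nrm X) vs) \<le> 1 \<and> 0 \<le> prod_list (map (nrm X) vs)"
    using vs(2,3) X(2) by (induction vs) (auto intro: mult_le_one)
  then show "r \<le> C" using b[OF vs(1,2)] vs(4) mult_left_le[of "prod_list (map (nrm X) vs)" C] assms(2) by simp
qed

text \<open>The calculus so far lives on normed types, whereas charts use carriers. A bounded linear
  map \<open>\<iota>\<close> leads into a type and another one, \<open>\<rho>\<close>, leads out;
  derivatives on the image of \<open>U\<close> are composed with both.\<close>

locale smooth_transfer =
  fixes X :: "'v::real_vector nspace" and Y :: "'w::real_vector nspace"
    and U :: "'v set" and \<iota> :: "'v \<Rightarrow> 'a::real_normed_vector"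
    and \<rho> :: "'b::real_normed_vector \<Rightarrow> 'w" and D :: "'a \<Rightarrow> 'a list \<Rightarrow> 'b" and I R :: real
  assumes NX: "normed_space X" and NY: "normed_space Y" and U: "openin (ntop X) U"
    and \<iota>: "lin_on (carr X) UNIV \<iota>" "\<And>x. x \<in> carr X \<Longrightarrow> norm (\<iota> x) \<le> I * nrm X x" "0 \<le> I"
    and \<rho>: "lin_on UNIV (carr Y) \<rho>" "\<And>z. nrm Y (\<rho> z) \<le> R * norm z" "0 \<le> R"
    and D: "\<And>k. deriv_family (\<iota> ` U) D k"
begin

definition kderiv :: "nat \<Rightarrow> 'v \<Rightarrow> 'v list \<Rightarrow> 'w" where
  "kderiv k x vs = (if length vs = k \<and> set vs \<subseteq> carr X then \<rho> (D (\<iota> x) (map \<iota> vs)) else 0)"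

lemma U_subset: "U \<subseteq> carr X" using U by (simp add: openin_ntop[OF NX])

lemma norm_prod_le:
  "set vs \<subseteq> carr X \<Longrightarrow> norm_prod (map \<iota> vs) \<le> I ^ length vs * prod_list (map (nrm X) vs)"
proof (induction vs)
  case (Cons v vs)
  have "norm (\<iota> v) * norm_prod (map \<iota> vs) \<le> (I * nrm X v) * (I ^ length vs * prod_list (map (nrm X) vs))"
  proof (rule mult_mono)
    show "norm (\<iota> v) \<le> I * nrm X v" "0 \<le> I * nrm X v"
      using Cons.prems \<iota>(2)[of v] \<iota>(3) normed_spaceD(2)[OF NX, of v] by auto
    show "norm_prod (map \<iota> vs) \<le> I ^ length vs * prod_list (map (nrm X) vs)" using Cons by simp
    show "0 \<le> norm_prod (map \<iota> vs)" by (rule prod_list_nonneg) simp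
  qed
  then show ?case by (simp add: mult_ac)
qed simp

lemma D_linear: "x \<in> U \<Longrightarrow> linear (\<lambda>v. D (\<iota> x) (us @ v # ws))"
  using D[of "length us + length ws"] by (auto simp: deriv_family_def multilin_def)

lemma \<rho>_simps: "\<rho> (a + b) = \<rho> a + \<rho> b" "\<rho> (r *\<^sub>R a) = r *\<^sub>R \<rho> a" "\<rho> a \<in> carr Y" "\<rho> (a - b) = \<rho> a - \<rho> b"
  using lin_onD[OF \<rho>(1)] lin_on_diff[OF \<rho>(1) subspace_UNIV] by auto

lemma kderiv_lin:
  assumes "x \<in> U" "set us \<subseteq> carr X" "set ws \<subseteq> carr X" "length us + Suc (length ws) = k"
  shows "lin_on (carr X) (carr Y) (\<lambda>v. kderiv k x (us @ v # ws))"
  using assms normed_spaceD(6,8)[OF NX] lin_onD(2,3)[OF \<iota>(1)]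
    linear_add[OF D_linear[OF assms(1)]] linear_scale[OF D_linear[OF assms(1)]]
  by (auto simp: lin_on_def kderiv_def \<rho>_simps)

lemma kderiv_bound:
  assumes "x \<in> U"
  obtains K where "0 \<le> K" "\<And>vs. length vs = k \<Longrightarrow> set vs \<subseteq> carr X \<Longrightarrow>
    nrm Y (kderiv k x vs) \<le> K * prod_list (map (nrm X) vs)"
proof -
  obtain K where K: "K \<ge> 0" "\<And>vs. length vs \<le> Suc k \<Longrightarrow> norm (D (\<iota> x) vs) \<le> K * norm_prod vs"
    using D[of k] assms unfolding deriv_family_def multibdd_def by blast
  show thesis
  proof (rule that[of "R * (K * I ^ k)"])
    fix vs assume vs: "length vs = k" "set vs \<subseteq> carr X"
    have "nrm Y (kderiv k x vs) \<le> R * norm (D (\<iota> x) (map \<iota> vs))" using vs \<rho>(2) by (simp add: kderiv_def)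
    also have "\<dots> \<le> R * (K * norm_prod (map \<iota> vs))"
      using vs \<rho>(3) by (intro mult_left_mono K) auto
    also have "\<dots> \<le> R * (K * (I ^ k * prod_list (map (nrm X) vs)))"
      using vs norm_prod_le[OF vs(2)] \<rho>(3) K(1) by (intro mult_left_mono) auto
    finally show "nrm Y (kderiv k x vs) \<le> R * (K * I ^ k) * prod_list (map (nrm X) vs)" by (simp add: mult_ac)
  qed (use K \<rho> \<iota> in auto)
qed

lemma kderiv_carr: "x \<in> U \<Longrightarrow> kderiv k x \<in> carr (mlmaps k X Y)"
  unfolding mlmaps_def nspace.simps mem_Collect_eq
proof (intro conjI allI impI; (elim conjE)?)
  assume x: "x \<in> U"
  show "kderiv k x vs = 0" if "\<not> (length vs = k \<and> set vs \<subseteq> carr X)" for vs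
    using that by (auto simp: kderiv_def)
  show "kderiv k x vs \<in> carr Y" if "length vs = k" "set vs \<subseteq> carr X" for vs
    using that by (simp add: kderiv_def \<rho>_simps)
  show "\<exists>K. \<forall>vs. length vs = k \<and> set vs \<subseteq> carr X \<longrightarrow> nrm Y (kderiv k x vs) \<le> K * prod_list (map (nrm X) vs)"
    using kderiv_bound[OF x] by metis
qed (use kderiv_lin in auto)

lemma kderiv_Cons_carr:
  assumes x: "x \<in> U"
  shows "(\<lambda>h vs. kderiv (Suc k) x (h # vs)) \<in> carr (blmaps X (mlmaps k X Y))"
proof -
  obtain K where K: "0 \<le> K" "\<And>vs. length vs = Suc k \<Longrightarrow> set vs \<subseteq> carr X \<Longrightarrow>
    nrm Y (kderiv (Suc k) x vs) \<le> K * prod_list (map (nrm X) vs)" using kderiv_bound[OF x] by metis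
  have Kh: "nrm Y (kderiv (Suc k) x (h # vs)) \<le> (K * nrm X h) * prod_list (map (nrm X) vs)"
    if "h \<in> carr X" "length vs = k" "set vs \<subseteq> carr X" for h vs
    using K(2)[of "h # vs"] that by (simp add: mult.assoc)
  show ?thesis
  proof (rule blmaps_carrI[of _ _ _ K])
    have c: "(\<lambda>vs. kderiv (Suc k) x (h # vs)) \<in> carr (mlmaps k X Y)" if h: "h \<in> carr X" for h
      unfolding mlmaps_def nspace.simps mem_Collect_eq
    proof (intro conjI allI impI; (elim conjE)?)
      show "kderiv (Suc k) x (h # vs) = 0" if "\<not> (length vs = k \<and> set vs \<subseteq> carr X)" for vs
        using that by (auto simp: kderiv_def)
      show "kderiv (Suc k) x (h # vs) \<in> carr Y" if "length vs = k" "set vs \<subseteq> carr X" for vs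
        using that h by (simp add: kderiv_def \<rho>_simps)
      show "\<exists>K. \<forall>vs. length vs = k \<and> set vs \<subseteq> carr X \<longrightarrow>
          nrm Y (kderiv (Suc k) x (h # vs)) \<le> K * prod_list (map (nrm X) vs)"
        using Kh[OF h] by blast
      show "lin_on (carr X) (carr Y) (\<lambda>v. kderiv (Suc k) x (h # us @ v # ws))"
        if "length us + Suc (length ws) = k" "set us \<subseteq> carr X" "set ws \<subseteq> carr X" for us ws
        using kderiv_lin[OF x, of "h # us" ws "Suc k"] that h by simp
    qed
    have zero: "kderiv (Suc k) x (h # vs) = 0" if "\<not> (length vs = k \<and> set vs \<subseteq> carr X)" for h vs
      using that by (auto simp: kderiv_def)
    have lin: "lin_on (carr X) (carr Y) (\<lambda>h. kderiv (Suc k) x (h # vs))" if "length vs = k \<and> set vs \<subseteq> carr X" for vs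
      using kderiv_lin[OF x, of "[]" vs "Suc k"] that by simp
    show "lin_on (carr X) (carr (mlmaps k X Y)) (\<lambda>h vs. kderiv (Suc k) x (h # vs))"
      unfolding lin_on_def
    proof (intro conjI ballI allI c ext)
      fix h h' vs assume "h \<in> carr X" "h' \<in> carr X"
      then show "kderiv (Suc k) x ((h + h') # vs) = ((\<lambda>vs. kderiv (Suc k) x (h # vs)) + (\<lambda>vs. kderiv (Suc k) x (h' # vs))) vs"
        using lin_onD(2)[OF lin[of vs]] zero[of vs] by (cases "length vs = k \<and> set vs \<subseteq> carr X") auto
    next
      fix r h vs assume "h \<in> carr X"
      then show "kderiv (Suc k) x ((r *\<^sub>R h) # vs) = (r *\<^sub>R (\<lambda>vs. kderiv (Suc k) x (h # vs))) vs"
        using lin_onD(3)[OF lin[of vs]] zero[of vs]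
        by (cases "length vs = k \<and> set vs \<subseteq> carr X") (auto simp: scaleR_fun_apply)
    qed
    show "(\<lambda>vs. kderiv (Suc k) x (h # vs)) = 0" if "h \<notin> carr X" for h
      using that by (auto simp: kderiv_def fun_eq_iff)
    show "nrm (mlmaps k X Y) (\<lambda>vs. kderiv (Suc k) x (h # vs)) \<le> K * nrm X h" if "h \<in> carr X" for h
      by (rule nrm_mlmaps_le[OF NX]) (use that K(1) Kh normed_spaceD(2)[OF NX] in auto)
  qed
qed

lemma kderiv_step:
  assumes x: "x \<in> U" and e: "e > 0"
  obtains d where "d > 0" "\<And>h vs. h \<in> carr X \<Longrightarrow> nrm X h < d \<Longrightarrow> x + h \<in> U \<Longrightarrow>
    length vs = k \<Longrightarrow> set vs \<subseteq> carr X \<Longrightarrow>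
    nrm Y (kderiv k (x + h) vs - kderiv k x vs - kderiv (Suc k) x (h # vs)) \<le> e * nrm X h * prod_list (map (nrm X) vs)"
proof -
  note X = normed_spaceD[OF NX]
  define C where "C = R * (I * I ^ k) + 1"
  have C: "C > 0" "R * (I * I ^ k) \<le> C"
    unfolding C_def using mult_nonneg_nonneg[OF \<rho>(3) mult_nonneg_nonneg[OF \<iota>(3) zero_le_power[OF \<iota>(3)]], of k]
    by auto
  have "e / C > 0" using e C by simp
  then have "\<forall>\<^sub>F y in at (\<iota> x) within \<iota> ` U. \<forall>vs. length vs \<le> k \<longrightarrow>
      norm (D y vs - D (\<iota> x) vs - D (\<iota> x) ((y - \<iota> x) # vs)) \<le> e / C * norm (y - \<iota> x) * norm_prod vs"
    using D[of k] x unfolding deriv_family_def deriv_step_def by blast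
  then obtain d where d: "d > 0" "\<And>y vs. y \<in> \<iota> ` U \<Longrightarrow> y \<noteq> \<iota> x \<Longrightarrow> dist y (\<iota> x) < d \<Longrightarrow> length vs \<le> k \<Longrightarrow>
      norm (D y vs - D (\<iota> x) vs - D (\<iota> x) ((y - \<iota> x) # vs)) \<le> e / C * norm (y - \<iota> x) * norm_prod vs"
    unfolding eventually_at by blast
  show thesis
  proof (rule that[of "d / (I + 1)"])
    show "d / (I + 1) > 0" using d \<iota>(3) by simp
    fix h vs assume h: "h \<in> carr X" "nrm X h < d / (I + 1)" "x + h \<in> U" and vs: "length vs = k" "set vs \<subseteq> carr X"
    have xh: "\<iota> (x + h) = \<iota> x + \<iota> h" using lin_onD(2)[OF \<iota>(1)] U_subset x h by auto
    have np: "0 \<le> norm_prod (map \<iota> vs)" by (rule prod_list_nonneg) simp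
    have "norm (\<iota> h) \<le> I * nrm X h" by (rule \<iota>(2)[OF h(1)])
    also have "\<dots> \<le> (I + 1) * nrm X h" using X(2)[OF h(1)] by (simp add: distrib_right)
    also have "\<dots> < d" using h(2) \<iota>(3) by (simp add: pos_less_divide_eq mult.commute)
    finally have lt: "norm (\<iota> h) < d" .
    have main: "norm (D (\<iota> (x + h)) (map \<iota> vs) - D (\<iota> x) (map \<iota> vs) - D (\<iota> x) (\<iota> h # map \<iota> vs))
        \<le> e / C * norm (\<iota> h) * norm_prod (map \<iota> vs)"
    \<comment> \<open>The punctured filter yields the estimate only away from
      \<open>\<iota> x\<close>. If \<open>\<iota> h\<close> vanishes, the left-hand side is zero by
      linearity.\<close>
    proof (cases "\<iota> h = 0")
      case True
      then show ?thesis using linear_0[OF D_linear[OF x, of "[]" "map \<iota> vs"]] by (simp add: xh)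
    next
      case False
      moreover have "\<iota> x + \<iota> h \<in> \<iota> ` U" using h(3) xh by (metis imageI)
      ultimately show ?thesis
        using d(2)[of "\<iota> (x + h)" "map \<iota> vs"] lt vs by (simp add: xh dist_norm)
    qed
    have "kderiv k (x + h) vs - kderiv k x vs - kderiv (Suc k) x (h # vs) =
        \<rho> (D (\<iota> (x + h)) (map \<iota> vs) - D (\<iota> x) (map \<iota> vs) - D (\<iota> x) (\<iota> h # map \<iota> vs))"
      using vs h by (simp add: kderiv_def \<rho>_simps)
    then have "nrm Y (kderiv k (x + h) vs - kderiv k x vs - kderiv (Suc k) x (h # vs)) \<le>
        R * norm (D (\<iota> (x + h)) (map \<iota> vs) - D (\<iota> x) (map \<iota> vs) - D (\<iota> x) (\<iota> h # map \<iota> vs))"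
      using \<rho>(2) by metis
    also have "\<dots> \<le> R * (e / C * norm (\<iota> h) * norm_prod (map \<iota> vs))"
      by (rule mult_left_mono[OF main \<rho>(3)])
    also have "\<dots> \<le> R * (e / C * (I * nrm X h) * (I ^ k * prod_list (map (nrm X) vs)))"
      using e C \<rho>(3) \<iota>(2)[OF h(1)] norm_prod_le[OF vs(2)] vs np \<iota>(3) X(2)[OF h(1)]
      by (intro mult_left_mono mult_mono mult_nonneg_nonneg) auto
    also have "\<dots> = (R * (I * I ^ k)) * (e / C * (nrm X h * prod_list (map (nrm X) vs)))"
      by (simp add: mult_ac)
    also have "\<dots> \<le> C * (e / C * (nrm X h * prod_list (map (nrm X) vs)))"
      using e C(1) X(2) h(1) vs(2)
      by (intro mult_right_mono C mult_nonneg_nonneg prod_list_nonneg) auto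
    also have "\<dots> = e * nrm X h * prod_list (map (nrm X) vs)" using C by simp
    finally show "nrm Y (kderiv k (x + h) vs - kderiv k x vs - kderiv (Suc k) x (h # vs))
        \<le> e * nrm X h * prod_list (map (nrm X) vs)" .
  qed
qed

lemma smooth_on_transfer: "smooth_on X Y U (\<lambda>x. \<rho> (D (\<iota> x) []))"
  unfolding smooth_on_def
proof (intro conjI U ballI exI[of _ kderiv] allI kderiv_carr)
  note X = normed_spaceD[OF NX]
  show "\<rho> (D (\<iota> x) []) \<in> carr Y" for x by (rule \<rho>_simps)
  show "kderiv 0 x [] = \<rho> (D (\<iota> x) [])" for x by (simp add: kderiv_def)
  fix k x assume x: "x \<in> U"
  show "has_fderiv X (mlmaps k X Y) U (kderiv k) x (\<lambda>h vs. kderiv (Suc k) x (h # vs))"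
    unfolding has_fderiv_def
  proof (intro conjI kderiv_Cons_carr x allI impI)
    fix e :: real assume "e > 0"
    then obtain d where d: "d > 0" "\<And>h vs. h \<in> carr X \<Longrightarrow> nrm X h < d \<Longrightarrow> x + h \<in> U \<Longrightarrow>
      length vs = k \<Longrightarrow> set vs \<subseteq> carr X \<Longrightarrow>
      nrm Y (kderiv k (x + h) vs - kderiv k x vs - kderiv (Suc k) x (h # vs)) \<le> e * nrm X h * prod_list (map (nrm X) vs)"
      using kderiv_step[OF x, of e k] by metis
    have "nrm (mlmaps k X Y) (kderiv k (x + h) - kderiv k x - (\<lambda>vs. kderiv (Suc k) x (h # vs))) \<le> e * nrm X h"
      if "h \<in> carr X" "nrm X h < d \<and> x + h \<in> U" for h
      by (rule nrm_mlmaps_le[OF NX]) (use that d X(2) \<open>e > 0\<close> in auto)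
    then show "\<exists>d>0. \<forall>h\<in>carr X. nrm X h < d \<and> x + h \<in> U \<longrightarrow>
        nrm (mlmaps k X Y) (kderiv k (x + h) - kderiv k x - (\<lambda>vs. kderiv (Suc k) x (h # vs))) \<le> e * nrm X h"
      using d(1) by blast
  qed
qed

text \<open>Besides smoothness a formula for the first derivative is needed, in order to recognize
  \<open>gr_J\<close> as the derivative of the transitions.\<close>

lemma has_fderiv_transfer:
  assumes x: "x \<in> U"
  shows "has_fderiv X Y U (\<lambda>x. \<rho> (D (\<iota> x) [])) x (zero_ext (carr X) (\<lambda>h. \<rho> (D (\<iota> x) [\<iota> h])))"
  unfolding has_fderiv_def
proof (intro conjI allI impI)
  have eq: "zero_ext (carr X) (\<lambda>h. \<rho> (D (\<iota> x) [\<iota> h])) = (\<lambda>h. kderiv 1 x [h])"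
    by (auto simp: kderiv_def zero_ext_def)
  obtain K where K: "\<And>vs. length vs = 1 \<Longrightarrow> set vs \<subseteq> carr X \<Longrightarrow>
    nrm Y (kderiv 1 x vs) \<le> K * prod_list (map (nrm X) vs)" using kderiv_bound[OF x] by metis
  show "zero_ext (carr X) (\<lambda>h. \<rho> (D (\<iota> x) [\<iota> h])) \<in> carr (blmaps X Y)"
    unfolding eq
  proof (rule blmaps_carrI)
    show "lin_on (carr X) (carr Y) (\<lambda>h. kderiv 1 x [h])" using kderiv_lin[OF x, of "[]" "[]" 1] by simp
    show "kderiv 1 x [h] = 0" if "h \<notin> carr X" for h using that by (simp add: kderiv_def)
    show "nrm Y (kderiv 1 x [h]) \<le> K * nrm X h" if "h \<in> carr X" for h using K[of "[h]"] that by simp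
  qed
  fix e :: real assume "e > 0"
  then obtain d where d: "d > 0" "\<And>h vs. h \<in> carr X \<Longrightarrow> nrm X h < d \<Longrightarrow> x + h \<in> U \<Longrightarrow>
    length vs = 0 \<Longrightarrow> set vs \<subseteq> carr X \<Longrightarrow>
    nrm Y (kderiv 0 (x + h) vs - kderiv 0 x vs - kderiv (Suc 0) x (h # vs)) \<le> e * nrm X h * prod_list (map (nrm X) vs)"
    using kderiv_step[OF x, of e 0] by metis
  show "\<exists>d>0. \<forall>h\<in>carr X. nrm X h < d \<and> x + h \<in> U \<longrightarrow>
      nrm Y (\<rho> (D (\<iota> (x + h)) []) - \<rho> (D (\<iota> x) []) - zero_ext (carr X) (\<lambda>h. \<rho> (D (\<iota> x) [\<iota> h])) h) \<le> e * nrm X h"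
  proof (intro exI[of _ d] conjI d(1) ballI impI)
    fix h assume "h \<in> carr X" "nrm X h < d \<and> x + h \<in> U"
    then show "nrm Y (\<rho> (D (\<iota> (x + h)) []) - \<rho> (D (\<iota> x) []) - zero_ext (carr X) (\<lambda>h. \<rho> (D (\<iota> x) [\<iota> h])) h)
        \<le> e * nrm X h"
      using d(2)[of h "[]"] by (simp add: kderiv_def zero_ext_def)
  qed
qed

end

section \<open>Charts of the Grassmannian\<close>

definition proj :: "'e::banach set \<Rightarrow> 'e set \<Rightarrow> 'e \<Rightarrow>\<^sub>L 'e" where
  "proj K R = Blinfun (proj_along K R)"

lemma proj_apply: "closed_compl K R \<Longrightarrow> proj K R x = proj_along K R x"
  by (simp add: proj_def bounded_linear_Blinfun_apply bounded_linear_proj_along)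

lemma proj_in:
  assumes "closed_compl K R"
  shows "proj K R x \<in> R" "x - proj K R x \<in> K"
    "proj K R x - x \<in> K"
proof -
  show "proj K R x \<in> R" and *: "x - proj K R x \<in> K"
    using proj_along_in[OF assms] by (simp_all add: proj_apply[OF assms])
  show "proj K R x - x \<in> K"
    using subspace_neg[OF closed_complD(1)[OF assms] *] by simp
qed

lemma proj_unique: "closed_compl K R \<Longrightarrow> g \<in> R \<Longrightarrow> x - g \<in> K \<Longrightarrow> proj K R x = g"
  by (simp add: proj_apply proj_along_unique)

lemma proj_id: "closed_compl K R \<Longrightarrow> x \<in> R \<Longrightarrow> proj K R x = x"
  by (rule proj_unique) (auto simp: subspace_0 closed_complD)

lemma proj_zero: "closed_compl K R \<Longrightarrow> x \<in> K \<Longrightarrow> proj K R x = 0"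
  by (rule proj_unique) (auto simp: subspace_0 closed_complD)

lemma proj_cong:
  assumes "closed_compl K R" "x - y \<in> K"
  shows "proj K R x = proj K R y"
  using proj_zero[OF assms] by (simp add: blinfun.diff_right)

lemma range_proj: "closed_compl K R \<Longrightarrow> range (blinfun_apply (proj K R)) = R"
  using proj_in(1) proj_id by (metis image_subset_iff rangeI subsetI subset_antisym)

lemma proj_compl:
  "closed_compl K R \<Longrightarrow> proj R K x = x - proj K R x"
  by (rule proj_unique[OF closed_compl_sym]) (auto simp: proj_in)

abbreviation Lsp :: "'e::banach set \<Rightarrow> 'e set \<Rightarrow> ('e \<Rightarrow> 'e) nspace" where
  "Lsp F G \<equiv> blmaps (nspace_of F) (nspace_of G)"

text \<open>\<open>L(F,G)\<close> is identified with a complemented subspace of \<open>L(E,E)\<close>: \<open>ext_op F G\<close> embeds it,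
  and \<open>restr_op F G\<close> is a left inverse.\<close>

definition ext_op :: "'e::banach set \<Rightarrow> 'e set \<Rightarrow> ('e \<Rightarrow> 'e) \<Rightarrow> 'e \<Rightarrow>\<^sub>L 'e" where
  "ext_op F G A = Blinfun (\<lambda>x. A (proj G F x))"

definition restr_op :: "'e::banach set \<Rightarrow> 'e set \<Rightarrow> ('e \<Rightarrow>\<^sub>L 'e) \<Rightarrow> 'e \<Rightarrow> 'e" where
  "restr_op F G \<Theta> = zero_ext F (\<lambda>f. proj F G (\<Theta> f))"

context
  fixes F G :: "'e::banach set"
  assumes FG: "closed_compl F G"
begin

lemma normed_F: "normed_space (nspace_of F)" and normed_G: "normed_space (nspace_of G)"
  using normed_space_nspace_of closed_complD[OF FG] by auto

lemma banach_Lsp: "banach_space (Lsp F G)"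
  using banach_space_blmaps[OF normed_F banach_space_nspace_of] closed_complD[OF FG] by auto

lemma normed_Lsp: "normed_space (Lsp F G)"
  using banach_Lsp by (simp add: banach_space_def)

lemma GF: "closed_compl G F" by (rule closed_compl_sym[OF FG])

lemma LspD:
  assumes "A \<in> carr (Lsp F G)"
  shows "f \<in> F \<Longrightarrow> A f \<in> G" "f \<in> F \<Longrightarrow> g \<in> F \<Longrightarrow> A (f + g) = A f + A g"
    "f \<in> F \<Longrightarrow> A (r *\<^sub>R f) = r *\<^sub>R A f" "f \<in> F \<Longrightarrow> norm (A f) \<le> nrm (Lsp F G) A * norm f"
    "f \<notin> F \<Longrightarrow> A f = 0"
  using blmaps_carrD[OF assms] lin_onD[OF blmaps_carrD(1)[OF assms]]
    blmaps_bound[OF normed_F normed_G assms] by auto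

lemma comp_proj_bound:
  assumes "A \<in> carr (Lsp F G)"
  shows "norm (A (proj G F x)) \<le> norm (proj G F) * nrm (Lsp F G) A * norm x"
proof -
  have "norm (A (proj G F x)) \<le> nrm (Lsp F G) A * norm (proj G F x)"
    by (rule LspD(4)[OF assms proj_in(1)[OF GF]])
  also have "\<dots> \<le> nrm (Lsp F G) A * (norm (proj G F) * norm x)"
    by (intro mult_left_mono norm_blinfun normed_spaceD(2)[OF normed_Lsp assms])
  finally show ?thesis by (simp add: mult_ac)
qed

lemma ext_op_apply:
  assumes "A \<in> carr (Lsp F G)"
  shows "ext_op F G A x = A (proj G F x)"
proof -
  note P = proj_in(1)[OF GF]
  have "bounded_linear (\<lambda>x. A (proj G F x))"
    by (rule bounded_linear_intro[of _ "norm (proj G F) * nrm (Lsp F G) A"])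
      (use comp_proj_bound[OF assms] in \<open>simp_all add: blinfun.add_right blinfun.scaleR_right
        LspD(2,3)[OF assms] P mult.commute mult.left_commute\<close>)
  then show ?thesis by (simp add: ext_op_def bounded_linear_Blinfun_apply)
qed

lemma norm_ext_op:
  assumes "A \<in> carr (Lsp F G)"
  shows "norm (ext_op F G A) \<le> norm (proj G F) * nrm (Lsp F G) A"
  by (rule norm_blinfun_bound)
    (use comp_proj_bound[OF assms] normed_spaceD(2)[OF normed_Lsp assms] in \<open>simp_all add: ext_op_apply[OF assms]\<close>)

lemma lin_ext_op: "lin_on (carr (Lsp F G)) UNIV (ext_op F G)"
  unfolding lin_on_def
  using normed_spaceD(6,8)[OF normed_Lsp]
  by (auto intro!: blinfun_eqI simp: ext_op_apply blinfun.bilinear_simps scaleR_fun_apply)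

lemma restr_op_apply: "f \<in> F \<Longrightarrow> restr_op F G \<Theta> f = proj F G (\<Theta> f)"
  by (simp add: restr_op_def zero_ext_def)

lemma restr_op_bound: "f \<in> F \<Longrightarrow> norm (restr_op F G \<Theta> f) \<le> norm (proj F G) * norm \<Theta> * norm f"
  using order_trans[OF norm_blinfun mult_left_mono[OF norm_blinfun]]
  by (simp add: restr_op_apply mult.assoc)

lemma restr_op_carr: "restr_op F G \<Theta> \<in> carr (Lsp F G)"
proof (rule blmaps_carrI)
  show "lin_on (carr (nspace_of F)) (carr (nspace_of G)) (restr_op F G \<Theta>)"
    using closed_complD(1)[OF FG] proj_in(1)[OF FG]
    by (auto simp: lin_on_def restr_op_apply subspace_add subspace_scale blinfun.bilinear_simps)
  show "restr_op F G \<Theta> f = 0" if "f \<notin> carr (nspace_of F)" for f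
    using that by (simp add: restr_op_def zero_ext_def)
  show "nrm (nspace_of G) (restr_op F G \<Theta> f) \<le> norm (proj F G) * norm \<Theta> * nrm (nspace_of F) f"
    if "f \<in> carr (nspace_of F)" for f
    using restr_op_bound that by simp
qed

lemma lin_restr_op: "lin_on UNIV (carr (Lsp F G)) (restr_op F G)"
  unfolding lin_on_def
  using restr_op_carr
  by (auto simp: restr_op_def zero_ext_def fun_eq_iff blinfun.bilinear_simps scaleR_fun_apply)

lemma nrm_restr_op: "nrm (Lsp F G) (restr_op F G \<Theta>) \<le> norm (proj F G) * norm \<Theta>"
  by (rule nrm_blmaps_le[OF normed_F normed_G]) (use restr_op_bound in auto)

lemma gr_chart_simps:
  "cdom (gr_chart F G) = {H. closed_compl H G}" "cmodel (gr_chart F G) = Lsp F G"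
  by (auto simp: gr_chart_def Gr_def)

text \<open>For \<open>f\<close> in \<open>F\<close> the vectors \<open>f\<close> and
  \<open>proj G H f\<close> differ by an element of \<open>G\<close>, so on \<open>F\<close> the
  operator \<open>proj G H\<close> inverts the projection of \<open>H\<close> to \<open>F\<close>.
  This makes the chart a bounded linear function of \<open>proj G H\<close>.\<close>

lemma cmap_gr_chart:
  assumes H: "closed_compl H G"
  shows "cmap (gr_chart F G) H = restr_op F G (proj G H)"
proof
  fix f
  note GH = closed_compl_sym[OF H]
  show "cmap (gr_chart F G) H f = restr_op F G (proj G H) f"
  proof (cases "f \<in> F")
    case True
    have "inv_into H (proj_along G F) f = proj G H f"
    proof (rule inv_into_f_eq)
      show "inj_on (proj_along G F) H"
      proof (rule inj_onI)
        fix h k assume hk: "h \<in> H" "k \<in> H" "proj_along G F h = proj_along G F k"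
        have "h - proj_along G F h - (k - proj_along G F k) \<in> G"
          by (intro subspace_diff closed_complD[OF GF] proj_along_in[OF GF])
        then have "h - k \<in> G" using hk by simp
        moreover have "h - k \<in> H" using hk closed_complD[OF H] by (simp add: subspace_diff)
        ultimately show "h = k" using closed_complD(5)[OF H, of "h - k"] by simp
      qed
      show "proj G H f \<in> H" by (rule proj_in[OF GH])
      show "proj_along G F (proj G H f) = f"
        using proj_unique[OF GF True proj_in(3)[OF GH]] by (simp add: proj_apply[OF GF])
    qed
    then show ?thesis
      using True by (simp add: gr_chart_def zero_ext_def restr_op_apply proj_apply[OF FG])
  qed (simp add: gr_chart_def restr_op_def zero_ext_def)
qed

lemma cmap_carr: "closed_compl H G \<Longrightarrow> cmap (gr_chart F G) H \<in> carr (Lsp F G)"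
  by (simp add: cmap_gr_chart restr_op_carr)

text \<open>The point of \<open>H\<close> above \<open>f\<close> in \<open>F\<close> is
  \<open>f + A f\<close>, where \<open>A\<close> is the coordinate of \<open>H\<close>. So the
  projection onto \<open>H\<close> along \<open>G\<close> is affine in the coordinate, and its range
  recovers \<open>H\<close>.\<close>

lemma proj_graph:
  assumes H: "closed_compl H G"
  shows "proj G H = proj G F + ext_op F G (cmap (gr_chart F G) H)"
proof (rule blinfun_eqI)
  fix x
  note GH = closed_compl_sym[OF H]
  let ?f = "proj G F x"
  have f: "?f \<in> F" by (rule proj_in[OF GF])
  have "proj F G (proj G H ?f) = proj G H ?f - ?f"
    using f closed_complD(1)[OF FG] by (intro proj_unique[OF FG] proj_in[OF GH]) (auto simp: subspace_neg)
  moreover have "proj G H ?f = proj G H x"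
    by (intro proj_cong[OF GH] proj_in[OF GF])
  ultimately show "proj G H x
      = blinfun_apply (proj G F + ext_op F G (cmap (gr_chart F G) H)) x"
    using f by (simp add: blinfun.add_left ext_op_apply[OF cmap_carr[OF H]])
      (simp add: cmap_gr_chart[OF H] restr_op_apply)
qed

lemma inj_on_cmap: "inj_on (cmap (gr_chart F G)) (cdom (gr_chart F G))"
proof (rule inj_onI)
  fix H K assume HK: "H \<in> cdom (gr_chart F G)" "K \<in> cdom (gr_chart F G)"
    "cmap (gr_chart F G) H = cmap (gr_chart F G) K"
  then have c: "closed_compl H G" "closed_compl K G" by (simp_all add: gr_chart_simps)
  then have "proj G H = proj G K" using HK(3) by (simp add: proj_graph)
  then show "H = K" using range_proj[OF closed_compl_sym] c by metis
qed

lemma graph_compl: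
  assumes A: "A \<in> carr (Lsp F G)"
  obtains H where "closed_compl H G" "cmap (gr_chart F G) H = A"
proof -
  note L = LspD[OF A]
  let ?E = "blinfun_apply (ext_op F G A)"
  \<comment> \<open>The graph is written as a kernel, since closedness then follows from
    continuity.\<close>
  define H where "H = {x. blinfun_apply (proj F G - ext_op F G A) x = 0}"
  have E: "?E x = A (proj G F x)" for x by (rule ext_op_apply[OF A])
  have EG: "?E x \<in> G" for x unfolding E by (intro L proj_in[OF GF])
  have HI: "f + A f \<in> H" if f: "f \<in> F" for f
  proof -
    have "proj F G (f + A f) = A f" "proj G F (f + A f) = f"
      using f L(1)[OF f] proj_zero[OF FG f] proj_id[OF FG L(1)[OF f]] proj_id[OF GF f] proj_zero[OF GF L(1)[OF f]]
      by (simp_all add: blinfun.add_right)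
    then show ?thesis by (simp add: H_def E blinfun.diff_left)
  qed
  have H: "closed_compl H G"
    unfolding closed_compl_def
  proof (intro conjI closed_complD[OF FG] allI)
    show "subspace H" by (rule subspaceI) (auto simp: H_def blinfun.bilinear_simps)
    have "H = blinfun_apply (proj F G - ext_op F G A) -` {0}" by (auto simp: H_def)
    then show "closed H"
      by (simp add: continuous_closed_vimage linear_continuous_at blinfun.bounded_linear_right)
    show "H \<inter> G = {0}"
    proof
      show "H \<inter> G \<subseteq> {0}"
      proof
        fix x assume x: "x \<in> H \<inter> G"
        then have "?E x = A 0" using proj_zero[OF GF] by (simp add: E)
        then have "?E x = 0" using L(3)[of 0 0] subspace_0[OF closed_complD(1)[OF FG]] by simp
        then show "x \<in> {0}" using x proj_id[OF FG, of x] by (simp add: H_def blinfun.diff_left)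
      qed
    qed (use closed_complD(2)[OF FG] in \<open>simp add: H_def subspace_0\<close>)
    fix x
    let ?f = "proj G F x"
    have "x = (?f + A ?f) + (proj F G x - A ?f)" by (simp add: proj_compl[OF FG])
    moreover have "proj F G x - A ?f \<in> G"
      using EG[of x] by (intro subspace_diff closed_complD[OF FG] proj_in[OF FG]) (simp add: E)
    ultimately show "\<exists>h\<in>H. \<exists>g\<in>G. x = h + g" using HI[OF proj_in(1)[OF GF]] by blast
  qed
  have "cmap (gr_chart F G) H = A"
  proof
    fix f show "cmap (gr_chart F G) H f = A f"
    proof (cases "f \<in> F")
      case True
      have "proj G H f = f + A f"
        by (rule proj_unique[OF closed_compl_sym[OF H] HI[OF True]])
          (use L(1)[OF True] subspace_neg[OF closed_complD(2)[OF FG]] in simp)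
      then show ?thesis
        using True proj_zero[OF FG True] proj_id[OF FG L(1)[OF True]]
        by (simp add: cmap_gr_chart[OF H] restr_op_apply blinfun.add_right)
    qed (simp add: L(5) cmap_gr_chart[OF H] restr_op_def zero_ext_def)
  qed
  then show thesis using H that by blast
qed

end

text \<open>A solution is a fixed point of the contraction
  \<open>w \<mapsto> x - T w\<close>.\<close>

lemma bij_id_plus_small:
  fixes T :: "'e::banach \<Rightarrow>\<^sub>L 'e"
  assumes "norm T < 1"
  shows "\<exists>!w. w + T w = x"
proof -
  have "\<exists>!w. x - T w = w"
  proof (rule banach_fix_type[of "norm T"])
    show "\<forall>a b. dist (x - T a) (x - T b) \<le> norm T * dist a b"
    proof (intro allI)
      fix a b show "dist (x - T a) (x - T b) \<le> norm T * dist a b"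
        using norm_blinfun[of T "b - a"] by (simp add: dist_norm norm_minus_commute[of a b] blinfun.diff_right)
    qed
  qed (use assms in auto)
  moreover have "x - T w = w \<longleftrightarrow> w + T w = x" for w by (metis diff_eq_eq)
  ultimately show ?thesis by simp
qed

text \<open>If \<open>B\<close> is close to \<open>A\<close>, then \<open>1 + (B - A) \<Pi>\<close> with \<open>\<Pi>\<close> the projection onto the graph
  of \<open>A\<close> along \<open>G'\<close> is an automorphism which fixes \<open>G'\<close> and maps the graph of \<open>A\<close> to that of \<open>B\<close>.\<close>

lemma openin_chart_overlap:
  fixes F G G' :: "'e::banach set"
  assumes FG: "closed_compl F G"
  shows "openin (ntop (Lsp F G)) (cmap (gr_chart F G) ` {H. closed_compl H G \<and> closed_compl H G'})"
  unfolding openin_ntop[OF normed_Lsp[OF FG]]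
proof (intro conjI ballI)
  let ?\<phi> = "cmap (gr_chart F G)"
  show "?\<phi> ` {H. closed_compl H G \<and> closed_compl H G'} \<subseteq> carr (Lsp F G)"
    using cmap_carr[OF FG] by auto
  fix A assume "A \<in> ?\<phi> ` {H. closed_compl H G \<and> closed_compl H G'}"
  then obtain H where H: "closed_compl H G" "closed_compl H G'" and A: "A = ?\<phi> H" by auto
  note GH = closed_compl_sym[OF H(1)] and G'H = closed_compl_sym[OF H(2)]
  note N = normed_spaceD[OF normed_Lsp[OF FG]]
  \<comment> \<open>Chosen to make the norm of the operator \<open>T\<close> below less than 1; the
    summand 1 keeps the divisor positive.\<close>
  define r where "r = 1 / (norm (proj G F) * norm (proj G' H) + 1)"
  have p: "norm (proj G F) * norm (proj G' H) + 1 > 0" by (simp add: add_nonneg_pos)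
  show "\<exists>r>0. \<forall>h\<in>carr (Lsp F G). nrm (Lsp F G) h < r \<longrightarrow>
      A + h \<in> ?\<phi> ` {H. closed_compl H G \<and> closed_compl H G'}"
  proof (intro exI[of _ r] conjI ballI impI)
    show "r > 0" using p by (simp add: r_def)
    fix h assume h: "h \<in> carr (Lsp F G)" and hr: "nrm (Lsp F G) h < r"
    have AL: "A \<in> carr (Lsp F G)" using A cmap_carr[OF FG H(1)] by simp
    obtain K where K: "closed_compl K G" "?\<phi> K = A + h" using graph_compl[OF FG N(6)[OF AL h]] by blast
    note GK = closed_compl_sym[OF K(1)]
    have PK: "proj G K x = proj G H x + ext_op F G h x" for x
      unfolding proj_graph[OF FG H(1)] proj_graph[OF FG K(1)] K(2) A[symmetric]
      using lin_onD(2)[OF lin_ext_op[OF FG] AL h] by (simp add: blinfun.add_left)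
    define T where "T = ext_op F G h o\<^sub>L proj G' H"
    have "norm T \<le> norm (ext_op F G h) * norm (proj G' H)" unfolding T_def by (rule norm_blinfun_compose)
    also have "\<dots> \<le> (norm (proj G F) * nrm (Lsp F G) h) * norm (proj G' H)"
      by (intro mult_right_mono norm_ext_op FG h) simp
    also have "\<dots> \<le> nrm (Lsp F G) h * (norm (proj G F) * norm (proj G' H) + 1)"
      using N(2)[OF h] by (simp add: algebra_simps)
    also have "\<dots> < 1" using hr p by (simp add: r_def pos_less_divide_eq)
    finally have bij: "\<exists>!w. w + T w = x" for x by (rule bij_id_plus_small)
    have TH: "x + T x = proj G K x" if "x \<in> H" for x
      using that by (simp add: T_def PK proj_id[OF G'H] proj_id[OF GH])
    have TG: "T x = 0" if "x \<in> G'" for x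
      using that by (simp add: T_def proj_zero[OF G'H] blinfun.zero_right)
    have "closed_compl K G'"
      unfolding closed_compl_def
    proof (intro conjI closed_complD(1,3)[OF K(1)] closed_complD(2,4)[OF H(2)] allI)
      show "K \<inter> G' = {0}"
      proof
        show "K \<inter> G' \<subseteq> {0}"
        proof
          fix z assume z: "z \<in> K \<inter> G'"
          \<comment> \<open>Both \<open>?w\<close> and \<open>z\<close> solve
            \<open>w + T w = z\<close>: the former by \<open>TH\<close>, because it lies in
            \<open>H\<close> and its point in \<open>K\<close> is \<open>z\<close>, the latter
            because \<open>T\<close> vanishes on \<open>G'\<close>. Uniqueness puts \<open>z\<close>
            into \<open>H\<close> as well as \<open>G'\<close>.\<close>
          let ?w = "proj G H z"
          have wH: "?w \<in> H" by (rule proj_in[OF GH])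
          have "?w + T ?w = proj G K z"
            unfolding TH[OF wH] by (intro proj_cong[OF GK] proj_in[OF GH])
          also have "\<dots> = z" using z proj_id[OF GK] by simp
          finally have "z = ?w" using bij[of z] TG[of z] z by (metis IntD2 add.right_neutral)
          then show "z \<in> {0}" using wH z closed_complD(5)[OF H(2), of z] by simp
        qed
      qed (use closed_complD(1)[OF K(1)] closed_complD(2)[OF H(2)] in \<open>simp add: subspace_0\<close>)
      fix x
      obtain w where w: "w + T w = x" using bij by blast
      obtain a b where ab: "a \<in> H" "b \<in> G'" "w = a + b" using closed_complD(6)[OF H(2)] by blast
      have "x = proj G K a + b"
        using w ab(3) TG[OF ab(2)] by (simp add: TH[OF ab(1), symmetric] blinfun.add_right algebra_simps)
      then show "\<exists>f\<in>K. \<exists>g\<in>G'. x = f + g" using proj_in(1)[OF GK] ab(2) by blast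
    qed
    then show "A + h \<in> ?\<phi> ` {H. closed_compl H G \<and> closed_compl H G'}" using K by (metis (mono_tags, lifting) imageI mem_Collect_eq)
  qed
qed

section \<open>Transitions of the Grassmannian\<close>

text \<open>If \<open>T\<close> extends the coordinate of \<open>H\<close>, the range is
  \<open>H\<close> itself. The projection onto \<open>H\<close> along \<open>G'\<close> thus becomes
  a function of an operator, as the calculus requires.\<close>

definition graph_proj :: "'e::banach set \<Rightarrow> 'e set \<Rightarrow> 'e set \<Rightarrow> ('e \<Rightarrow>\<^sub>L 'e) \<Rightarrow> 'e \<Rightarrow>\<^sub>L 'e" where
  "graph_proj F G G' T = proj G' (range (blinfun_apply (proj G F + T)))"

lemma graph_proj_chart:
  assumes "closed_compl F G" "closed_compl H G"
  shows "graph_proj F G G' (ext_op F G (cmap (gr_chart F G) H)) = proj G' H"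
  using proj_graph[OF assms] range_proj[OF closed_compl_sym[OF assms(2)]]
  by (simp add: graph_proj_def)

text \<open>The projections \<open>\<Pi>\<close> onto \<open>H\<close> along \<open>G'\<close> satisfy a resolvent identity with respect to the
  projections \<open>R\<close> onto \<open>H\<close> along \<open>G\<close>, which are affine in the coordinate of \<open>H\<close>:
  \<open>\<Pi>\<^sub>K - \<Pi>\<^sub>H = (1 - \<Pi>\<^sub>K) (R\<^sub>K - R\<^sub>H) \<Pi>\<^sub>H\<close>.\<close>

lemma graph_proj_resolvent:
  assumes FG: "closed_compl F G" and H: "closed_compl H G" "closed_compl H G'"
    and K: "closed_compl K G" "closed_compl K G'"
  defines "X \<equiv> ext_op F G (cmap (gr_chart F G) H)" and "Y \<equiv> ext_op F G (cmap (gr_chart F G) K)"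
  shows "graph_proj F G G' Y - graph_proj F G G' X =
    sandwich (Y - X) (id_blinfun - graph_proj F G G' Y) (graph_proj F G G' X)"
proof (rule blinfun_eqI)
  fix x
  note GH = closed_compl_sym[OF H(1)] and G'H = closed_compl_sym[OF H(2)]
    and GK = closed_compl_sym[OF K(1)] and G'K = closed_compl_sym[OF K(2)]
  have YX: "Y - X = proj G K - proj G H"
    unfolding X_def Y_def proj_graph[OF FG H(1)] proj_graph[OF FG K(1)] by simp
  let ?h = "proj G' H x"
  \<comment> \<open>Everything is evaluated at the point \<open>?h\<close> of \<open>H\<close>:
    \<open>proj G H\<close> fixes it, and \<open>proj G' K\<close> does not distinguish it from
    \<open>x\<close>.\<close>
  have "proj G H ?h = ?h" by (intro proj_id[OF GH] proj_in[OF G'H])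
  moreover have "proj G' K (proj G K ?h) = proj G K ?h"
    by (intro proj_id[OF G'K] proj_in[OF GK])
  moreover have "proj G' K ?h = proj G' K x"
    by (intro proj_cong[OF G'K] proj_in[OF G'H])
  moreover have "graph_proj F G G' X = proj G' H" "graph_proj F G G' Y = proj G' K"
    unfolding X_def Y_def by (intro graph_proj_chart FG H K)+
  ultimately show "blinfun_apply (graph_proj F G G' Y - graph_proj F G G' X) x =
      blinfun_apply (sandwich (Y - X) (id_blinfun - graph_proj F G G' Y) (graph_proj F G G' X)) x"
    by (simp add: sandwich_def YX blinfun.bilinear_simps)
qed

lemma deriv_family_graph_proj:
  assumes FG: "closed_compl F G"
    and U: "U \<subseteq> cmap (gr_chart F G) ` {H. closed_compl H G \<and> closed_compl H G'}"
  shows "deriv_family (ext_op F G ` U) (proj_derivs (graph_proj F G G')) k"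
proof (rule deriv_family_proj_derivs)
  fix X Y assume "X \<in> ext_op F G ` U" "Y \<in> ext_op F G ` U"
  then obtain H K where "closed_compl H G" "closed_compl H G'" "closed_compl K G" "closed_compl K G'"
    "X = ext_op F G (cmap (gr_chart F G) H)" "Y = ext_op F G (cmap (gr_chart F G) K)"
    using U by (auto simp: image_iff) blast
  then show "graph_proj F G G' Y - graph_proj F G G' X =
      sandwich (Y - X) (id_blinfun - graph_proj F G G' Y) (graph_proj F G G' X)"
    using graph_proj_resolvent[OF FG, of H G' K] by simp
qed

section \<open>Transposed derivatives as bounded operators\<close>

definition conj_op :: "('e::real_normed_vector \<Rightarrow>\<^sub>L 'e) \<Rightarrow> ('e \<Rightarrow>\<^sub>L 'e) \<Rightarrow> ('e \<Rightarrow>\<^sub>L 'e) \<Rightarrow>\<^sub>L ('e \<Rightarrow>\<^sub>L 'e)" where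
  "conj_op p q = Blinfun (\<lambda>h. sandwich h p q)"

lemma conj_op_apply: "blinfun_apply (conj_op p q) h = sandwich h p q"
proof -
  have "bounded_linear (\<lambda>h. sandwich h p q)"
    by (rule bounded_linear_intro[of _ "norm p * norm q"])
      (use sandwich_bound linear_add[OF linear_sandwich] linear_scale[OF linear_sandwich] in \<open>auto simp: mult.assoc\<close>)
  then show ?thesis by (simp add: conj_op_def bounded_linear_Blinfun_apply)
qed

lemma bounded_bilinear_conj_op: "bounded_bilinear conj_op"
proof
  show "\<exists>K. \<forall>p q :: 'a \<Rightarrow>\<^sub>L 'a. norm (conj_op p q) \<le> norm p * norm q * K"
  proof (intro exI[of _ 1] allI)
    fix p q :: "'a \<Rightarrow>\<^sub>L 'a"
    have "norm (conj_op p q) \<le> norm p * norm q"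
      by (rule norm_blinfun_bound) (use sandwich_bound in \<open>auto simp: conj_op_apply mult_ac\<close>)
    then show "norm (conj_op p q) \<le> norm p * norm q * 1" by simp
  qed
qed (auto intro!: blinfun_eqI simp: conj_op_apply sandwich_def blinfun.bilinear_simps)

text \<open>The transpose of \<open>\<Theta>\<close>, read between the model spaces and taken as a
  linear function of \<open>\<Theta>\<close>. It serves as \<open>\<rho>\<close> in
  \<open>smooth_transfer\<close>, with \<open>\<Theta>\<close> the bilinear expression
  \<open>conj_op (1 - \<Pi>) \<Pi>\<close>.\<close>

definition conj_dual where
  "conj_dual F G F' G' \<Theta> = zero_ext (carr (ndual (Lsp F G)))
     (\<lambda>\<mu>. zero_ext (carr (Lsp F' G')) (\<lambda>v. \<mu> (restr_op F G (blinfun_apply \<Theta> (ext_op F' G' v)))))"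

lemma conj_dual_blmaps:
  fixes F G F' G' :: "'e::banach set"
  assumes FG: "closed_compl F G" and FG': "closed_compl F' G'"
  shows "lin_on UNIV (carr (blmaps (ndual (Lsp F G)) (ndual (Lsp F' G')))) (conj_dual F G F' G')"
    and "nrm (blmaps (ndual (Lsp F G)) (ndual (Lsp F' G'))) (conj_dual F G F' G' \<Theta>)
      \<le> norm (proj F G) * norm (proj G' F') * norm \<Theta>"
proof -
  note NL = normed_Lsp[OF FG] and NL' = normed_Lsp[OF FG']
  note ND = normed_space_ndual[OF NL] and ND' = normed_space_ndual[OF NL']
  let ?c = "norm (proj F G) * norm (proj G' F')"
  let ?B = "blmaps (ndual (Lsp F G)) (ndual (Lsp F' G'))"
  let ?w = "\<lambda>\<Theta> v. restr_op F G (blinfun_apply \<Theta> (ext_op F' G' v))"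
  have app: "conj_dual F G F' G' \<Theta> \<mu> v = \<mu> (?w \<Theta> v)"
    if "\<mu> \<in> carr (ndual (Lsp F G))" "v \<in> carr (Lsp F' G')" for \<Theta> \<mu> v
    using that by (simp add: conj_dual_def zero_ext_def)
  have zero1: "conj_dual F G F' G' \<Theta> \<mu> = 0" if "\<mu> \<notin> carr (ndual (Lsp F G))" for \<Theta> \<mu>
    using that by (simp add: conj_dual_def zero_ext_def)
  have zero2: "conj_dual F G F' G' \<Theta> \<mu> v = 0" if "v \<notin> carr (Lsp F' G')" for \<Theta> \<mu> v
    using that by (simp add: conj_dual_def zero_ext_def)
  have wc: "?w \<Theta> v \<in> carr (Lsp F G)" for \<Theta> v by (rule restr_op_carr[OF FG])
  have bd: "\<bar>conj_dual F G F' G' \<Theta> \<mu> v\<bar> \<le> (?c * norm \<Theta> * nrm (ndual (Lsp F G)) \<mu>) * nrm (Lsp F' G') v"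
    if m: "\<mu> \<in> carr (ndual (Lsp F G))" and v: "v \<in> carr (Lsp F' G')" for \<Theta> \<mu> v
  proof -
    have "nrm (Lsp F G) (?w \<Theta> v) \<le> norm (proj F G) * norm (blinfun_apply \<Theta> (ext_op F' G' v))"
      by (rule nrm_restr_op[OF FG])
    also have "\<dots> \<le> norm (proj F G) * (norm \<Theta> * norm (ext_op F' G' v))"
      by (intro mult_left_mono norm_blinfun) simp
    also have "\<dots> \<le> norm (proj F G) * (norm \<Theta> * (norm (proj G' F') * nrm (Lsp F' G') v))"
      by (intro mult_left_mono norm_ext_op[OF FG' v]) simp_all
    finally have le: "nrm (Lsp F G) (?w \<Theta> v) \<le>
        norm (proj F G) * (norm \<Theta> * (norm (proj G' F') * nrm (Lsp F' G') v))" .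
    have "\<bar>conj_dual F G F' G' \<Theta> \<mu> v\<bar> \<le> nrm (ndual (Lsp F G)) \<mu> * nrm (Lsp F G) (?w \<Theta> v)"
      unfolding app[OF m v] by (rule ndual_bound[OF NL m wc])
    also note mult_left_mono[OF le normed_spaceD(2)[OF ND m]]
    finally show ?thesis by (simp add: mult_ac)
  qed
  have lin2: "lin_on (carr (Lsp F' G')) UNIV (conj_dual F G F' G' \<Theta> \<mu>)"
    if m: "\<mu> \<in> carr (ndual (Lsp F G))" for \<Theta> \<mu>
    unfolding lin_on_def
    using normed_spaceD(6,8)[OF NL'] lin_onD(2,3)[OF lin_ext_op[OF FG']] wc
      lin_onD(2,3)[OF lin_restr_op[OF FG]] lin_onD(2,3)[OF ndual_carrD(1)[OF m]]
    by (auto simp: app[OF m] blinfun.bilinear_simps)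
  have c2: "conj_dual F G F' G' \<Theta> \<mu> \<in> carr (ndual (Lsp F' G'))" if m: "\<mu> \<in> carr (ndual (Lsp F G))" for \<Theta> \<mu>
    by (rule ndual_carrI[OF lin2[OF m] zero2 bd[OF m]])
  have n2: "nrm (ndual (Lsp F' G')) (conj_dual F G F' G' \<Theta> \<mu>) \<le> (?c * norm \<Theta>) * nrm (ndual (Lsp F G)) \<mu>"
    if m: "\<mu> \<in> carr (ndual (Lsp F G))" for \<Theta> \<mu>
    by (rule ndual_le[OF NL' _ bd[OF m]]) (use normed_spaceD(2)[OF ND m] in simp)
  have lin1: "lin_on (carr (ndual (Lsp F G))) (carr (ndual (Lsp F' G'))) (conj_dual F G F' G' \<Theta>)" for \<Theta>
    unfolding lin_on_def
  proof (intro conjI ballI allI c2 ext)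
    fix \<mu> \<nu> v assume "\<mu> \<in> carr (ndual (Lsp F G))" "\<nu> \<in> carr (ndual (Lsp F G))"
    then show "conj_dual F G F' G' \<Theta> (\<mu> + \<nu>) v = (conj_dual F G F' G' \<Theta> \<mu> + conj_dual F G F' G' \<Theta> \<nu>) v"
      using normed_spaceD(6)[OF ND] by (cases "v \<in> carr (Lsp F' G')") (auto simp: app zero2)
  next
    fix r \<mu> v assume "\<mu> \<in> carr (ndual (Lsp F G))"
    then show "conj_dual F G F' G' \<Theta> (r *\<^sub>R \<mu>) v = (r *\<^sub>R conj_dual F G F' G' \<Theta> \<mu>) v"
      using normed_spaceD(8)[OF ND] by (cases "v \<in> carr (Lsp F' G')") (auto simp: app zero2 scaleR_fun_apply)
  qed
  have c1: "conj_dual F G F' G' \<Theta> \<in> carr ?B" for \<Theta>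
    by (rule blmaps_carrI[OF lin1 zero1 n2])
  show "nrm ?B (conj_dual F G F' G' \<Theta>) \<le> ?c * norm \<Theta>"
    by (rule nrm_blmaps_le[OF ND ND' _ n2]) simp
  show "lin_on UNIV (carr ?B) (conj_dual F G F' G')"
    unfolding lin_on_def
  proof (intro conjI ballI allI c1 ext)
    fix \<Theta> \<Theta>' \<mu> v
    show "conj_dual F G F' G' (\<Theta> + \<Theta>') \<mu> v = (conj_dual F G F' G' \<Theta> + conj_dual F G F' G' \<Theta>') \<mu> v"
      using wc lin_onD(2)[OF lin_restr_op[OF FG]] lin_onD(2)[OF ndual_carrD(1), of \<mu> "Lsp F G"]
      by (cases "v \<in> carr (Lsp F' G')"; cases "\<mu> \<in> carr (ndual (Lsp F G))")
        (auto simp: app zero2 zero1 blinfun.bilinear_simps)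
  next
    fix r \<Theta> \<mu> v
    show "conj_dual F G F' G' (r *\<^sub>R \<Theta>) \<mu> v = (r *\<^sub>R conj_dual F G F' G' \<Theta>) \<mu> v"
      using wc lin_onD(3)[OF lin_restr_op[OF FG]] lin_onD(3)[OF ndual_carrD(1), of \<mu> "Lsp F G"]
      by (cases "v \<in> carr (Lsp F' G')"; cases "\<mu> \<in> carr (ndual (Lsp F G))")
        (auto simp: app zero2 zero1 blinfun.bilinear_simps scaleR_fun_apply)
  qed
qed

text \<open>A chart record does not store the pair \<open>(F,G)\<close> it was built from; a choice is made here.\<close>

definition chart_pair :: "('e::banach set, 'e \<Rightarrow> 'e) chart \<Rightarrow> 'e set \<times> 'e set" where
  "chart_pair c = (SOME FG. closed_compl (fst FG) (snd FG) \<and> c = gr_chart (fst FG) (snd FG))"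

definition cF where "cF c = fst (chart_pair c)"
definition cG where "cG c = snd (chart_pair c)"

lemma gr_atlasD:
  assumes "c \<in> gr_atlas"
  shows "closed_compl (cF c) (cG c)" "gr_chart (cF c) (cG c) = c"
proof -
  obtain F G where "closed_compl F G" "c = gr_chart F G" using assms by (auto simp: gr_atlas_def)
  then have "\<exists>FG. closed_compl (fst FG) (snd FG) \<and> c = gr_chart (fst FG) (snd FG)" by auto
  from someI_ex[OF this] show "closed_compl (cF c) (cG c)" "gr_chart (cF c) (cG c) = c"
    by (simp_all add: cF_def cG_def chart_pair_def)
qed

lemma gr_atlas_simps:
  assumes "c \<in> gr_atlas"
  shows "cdom c = {H. closed_compl H (cG c)}" "cmodel c = Lsp (cF c) (cG c)"
  using gr_chart_simps[OF gr_atlasD(1)[OF assms]] by (simp_all add: gr_atlasD(2)[OF assms])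

section \<open>Derivatives of the transitions and their cocycle rules\<close>

definition gr_J where
  "gr_J c d p = zero_ext (carr (cmodel c)) (\<lambda>v. restr_op (cF d) (cG d)
     (sandwich (ext_op (cF c) (cG c) v) (id_blinfun - proj (cG d) p) (proj (cG d) p)))"

lemma gr_J_apply:
  assumes "d \<in> gr_atlas" "closed_compl p (cG d)" "v \<in> carr (cmodel c)" "f \<in> cF d"
  shows "gr_J c d p v f = blinfun_apply (id_blinfun - proj (cG d) p)
    (ext_op (cF c) (cG c) v (proj (cG d) p f))"
    and "gr_J c d p v f \<in> cG d"
proof -
  note FG = gr_atlasD(1)[OF assms(1)]
  let ?y = "blinfun_apply (id_blinfun - proj (cG d) p)
    (ext_op (cF c) (cG c) v (proj (cG d) p f))"
  have "?y \<in> cG d" by (simp add: blinfun.diff_left proj_in(2)[OF closed_compl_sym[OF assms(2)]])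
  then show "gr_J c d p v f = ?y" "gr_J c d p v f \<in> cG d"
    using proj_id[OF FG] assms by (simp_all add: gr_J_def zero_ext_def restr_op_apply[OF FG] sandwich_def)
qed

lemma gr_J_Lsp:
  assumes "d \<in> gr_atlas" "v \<in> carr (cmodel c)"
  shows "gr_J c d p v \<in> carr (cmodel d)"
  using restr_op_carr[OF gr_atlasD(1)[OF assms(1)]] assms by (simp add: gr_J_def zero_ext_def gr_atlas_simps)

lemma gr_J_id:
  assumes "c \<in> gr_atlas" "p \<in> cdom c" "v \<in> carr (cmodel c)"
  shows "gr_J c c p v = v"
proof
  fix f
  note FG = gr_atlasD(1)[OF assms(1)]
  have v: "v \<in> carr (Lsp (cF c) (cG c))" and p: "closed_compl p (cG c)" using assms by (auto simp: gr_atlas_simps)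
  note GF = closed_compl_sym[OF FG] and Gp = closed_compl_sym[OF p]
  show "gr_J c c p v f = v f"
  proof (cases "f \<in> cF c")
    case True
    have "proj (cG c) (cF c) (proj (cG c) p f) = f"
      by (intro proj_unique[OF GF True] proj_in[OF Gp])
    then show ?thesis
      using proj_zero[OF Gp LspD(1)[OF FG v True]]
      by (simp add: gr_J_apply(1)[OF assms(1) p assms(3) True] ext_op_apply[OF FG v] blinfun.diff_left)
  next
    case False
    have l: "gr_J c c p v \<in> carr (Lsp (cF c) (cG c))"
      using gr_J_Lsp[OF assms(1,3)] assms(1) by (simp add: gr_atlas_simps)
    show ?thesis using LspD(5)[OF FG l False] LspD(5)[OF FG v False] by simp
  qed
qed

text \<open>In the chart \<open>d\<close>, \<open>gr_J c d p v\<close> represents the map that sends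
  \<open>x\<close> in \<open>p\<close> to the class of \<open>ext_op (cF c) (cG c) v x\<close>
  modulo \<open>p\<close>. Passing through \<open>d\<close> changes the values on \<open>p\<close>
  only by elements of \<open>p\<close>, and \<open>1 - proj (cG e) p\<close> kills these.\<close>

lemma gr_J_comp:
  assumes "c \<in> gr_atlas" "d \<in> gr_atlas" "e \<in> gr_atlas" "p \<in> cdom c" "p \<in> cdom d" "p \<in> cdom e"
    and v: "v \<in> carr (cmodel c)"
  shows "gr_J d e p (gr_J c d p v) = gr_J c e p v"
proof
  fix f
  note FGd = gr_atlasD(1)[OF assms(2)] and FGe = gr_atlasD(1)[OF assms(3)]
  have pd: "closed_compl p (cG d)" and pe: "closed_compl p (cG e)" using assms by (auto simp: gr_atlas_simps)
  note Gpd = closed_compl_sym[OF pd] and Gpe = closed_compl_sym[OF pe] and GFd = closed_compl_sym[OF FGd]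
  note w = gr_J_Lsp[OF assms(2) v, of p]
  show "gr_J d e p (gr_J c d p v) f = gr_J c e p v f"
  proof (cases "f \<in> cF e")
    case True
    let ?x = "proj (cG e) p f"
    let ?y = "ext_op (cF c) (cG c) v ?x"
    have x: "?x \<in> p" by (rule proj_in[OF Gpe])
    have "proj (cG d) p (proj (cG d) (cF d) ?x) = ?x"
      by (intro proj_unique[OF Gpd x] proj_in[OF GFd])
    then have "blinfun_apply (ext_op (cF d) (cG d) (gr_J c d p v)) ?x = ?y - proj (cG d) p ?y"
      using w assms(2) by (simp add: ext_op_apply[OF FGd] gr_atlas_simps
          gr_J_apply(1)[OF assms(2) pd v proj_in(1)[OF GFd]] blinfun.diff_left)
    moreover have "proj (cG d) p ?y \<in> p" by (rule proj_in[OF Gpd])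
    ultimately show ?thesis
      using proj_id[OF Gpe, of "proj (cG d) p ?y"]
      by (simp add: gr_J_apply(1)[OF assms(3) pe w True] gr_J_apply(1)[OF assms(3) pe v True]
          blinfun.bilinear_simps)
  next
    case False
    have l: "gr_J d e p (gr_J c d p v) \<in> carr (Lsp (cF e) (cG e))" and r: "gr_J c e p v \<in> carr (Lsp (cF e) (cG e))"
      using gr_J_Lsp[OF assms(3) v, of p] gr_J_Lsp[OF assms(3) w, of p] assms(3)
      by (simp_all add: gr_atlas_simps)
    show ?thesis using LspD(5)[OF FGe l False] LspD(5)[OF FGe r False] by simp
  qed
qed

lemma inj_on_chart:
  fixes c :: "('e::banach set, 'e \<Rightarrow> 'e) chart"
  assumes "c \<in> gr_atlas" shows "inj_on (cmap c) (cdom c)"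
  using inj_on_cmap[OF gr_atlasD(1)[OF assms]] by (simp add: gr_atlasD(2)[OF assms])

lemma cinv_chart:
  fixes c :: "('e::banach set, 'e \<Rightarrow> 'e) chart"
  assumes "c \<in> gr_atlas" "H \<in> cdom c" shows "cinv c (cmap c H) = H"
  unfolding cinv_def by (rule inv_into_f_f[OF inj_on_chart[OF assms(1)] assms(2)])

lemma openin_overlap:
  fixes c d :: "('e::banach set, 'e \<Rightarrow> 'e) chart"
  assumes c: "c \<in> gr_atlas" and d: "d \<in> gr_atlas"
  shows "openin (ntop (cmodel c)) (cmap c ` (cdom c \<inter> cdom d))"
  using openin_chart_overlap[OF gr_atlasD(1)[OF c], of "cG d"]
  by (simp add: gr_atlasD(2)[OF c] gr_atlas_simps c d Collect_conj_eq)

text \<open>By injectivity of the chart, the image is the intersection of the images of two pairwise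
  overlaps.\<close>

lemma openin_overlap3:
  fixes c d e :: "('e::banach set, 'e \<Rightarrow> 'e) chart"
  assumes c: "c \<in> gr_atlas" and d: "d \<in> gr_atlas" and e: "e \<in> gr_atlas"
  shows "openin (ntop (cmodel c)) (cmap c ` (cdom c \<inter> cdom d \<inter> cdom e))"
proof -
  have "cdom c \<inter> cdom d \<inter> cdom e = (cdom c \<inter> cdom d) \<inter> (cdom c \<inter> cdom e)" by blast
  then have "cmap c ` (cdom c \<inter> cdom d \<inter> cdom e) = cmap c ` (cdom c \<inter> cdom d) \<inter> cmap c ` (cdom c \<inter> cdom e)"
    using inj_on_image_Int[OF inj_on_chart[OF c], of "cdom c \<inter> cdom d" "cdom c \<inter> cdom e"] by simp
  then show ?thesis using openin_overlap[OF c d] openin_overlap[OF c e] by (simp add: openin_Int)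
qed

section \<open>Smoothness of the transitions of points and covectors\<close>

context
  fixes c d :: "('e::banach set, 'e \<Rightarrow> 'e) chart"
  assumes c: "c \<in> gr_atlas" and d: "d \<in> gr_atlas"
begin

lemma transfer_transition:
  "smooth_transfer (cmodel c) (cmodel d) (cmap c ` (cdom c \<inter> cdom d)) (ext_op (cF c) (cG c))
    (restr_op (cF d) (cG d)) (proj_derivs (graph_proj (cF c) (cG c) (cG d)))
    (norm (proj (cG c) (cF c))) (norm (proj (cF d) (cG d)))"
proof
  note FG = gr_atlasD(1)[OF c] and FG' = gr_atlasD(1)[OF d]
  show "normed_space (cmodel c)" "normed_space (cmodel d)"
    using normed_Lsp FG FG' by (simp_all add: gr_atlas_simps c d)
  show "openin (ntop (cmodel c)) (cmap c ` (cdom c \<inter> cdom d))" by (rule openin_overlap[OF c d])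
  show "lin_on (carr (cmodel c)) UNIV (ext_op (cF c) (cG c))"
    using lin_ext_op[OF FG] by (simp add: gr_atlas_simps c)
  show "norm (ext_op (cF c) (cG c) x) \<le> norm (proj (cG c) (cF c)) * nrm (cmodel c) x"
    if "x \<in> carr (cmodel c)" for x
    using norm_ext_op[OF FG] that by (simp add: gr_atlas_simps c)
  show "lin_on UNIV (carr (cmodel d)) (restr_op (cF d) (cG d))"
    using lin_restr_op[OF FG'] by (simp add: gr_atlas_simps d)
  show "nrm (cmodel d) (restr_op (cF d) (cG d) z) \<le> norm (proj (cF d) (cG d)) * norm z" for z
    using nrm_restr_op[OF FG'] by (simp add: gr_atlas_simps d)
  show "deriv_family (ext_op (cF c) (cG c) ` cmap c ` (cdom c \<inter> cdom d))
      (proj_derivs (graph_proj (cF c) (cG c) (cG d))) k" for k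
    by (rule deriv_family_graph_proj[OF FG]) (auto simp: gr_atlasD(2)[OF c] gr_atlas_simps c d)
qed simp_all

lemma transition_eq:
  assumes "x \<in> cmap c ` (cdom c \<inter> cdom d)"
  shows "restr_op (cF d) (cG d) (proj_derivs (graph_proj (cF c) (cG c) (cG d)) (ext_op (cF c) (cG c) x) [])
    = transition c d x"
proof -
  note FG = gr_atlasD(1)[OF c] and FG' = gr_atlasD(1)[OF d]
  obtain H where H: "x = cmap c H" "H \<in> cdom c" "H \<in> cdom d" using assms by auto
  then have "closed_compl H (cG c)" "closed_compl H (cG d)" by (auto simp: gr_atlas_simps c d)
  then show ?thesis
    using graph_proj_chart[OF FG, of H] cmap_gr_chart[OF FG', of H] H
    by (simp add: proj_derivs_Nil transition_def cinv_chart c gr_atlasD(2)[OF c] gr_atlasD(2)[OF d])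
qed

lemma smooth_on_transition:
  "smooth_on (cmodel c) (cmodel d) (cmap c ` (cdom c \<inter> cdom d)) (transition c d)"
  by (rule smooth_on_cong[OF smooth_transfer.smooth_on_transfer[OF transfer_transition] transition_eq])

lemma has_fderiv_transition:
  assumes "p \<in> cdom c" "p \<in> cdom d"
  shows "has_fderiv (cmodel c) (cmodel d) (cmap c ` (cdom c \<inter> cdom d)) (transition c d) (cmap c p) (gr_J c d p)"
proof -
  note FG = gr_atlasD(1)[OF c]
  let ?U = "cmap c ` (cdom c \<inter> cdom d)" and ?x = "cmap c p"
  let ?D = "proj_derivs (graph_proj (cF c) (cG c) (cG d))"
  have x: "?x \<in> ?U" using assms by auto
  have "closed_compl p (cG c)" using assms by (simp add: gr_atlas_simps c)
  then have "?D (ext_op (cF c) (cG c) ?x) [h] = sandwich h (id_blinfun - proj (cG d) p) (proj (cG d) p)" for h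
    using proj_derivs_snoc[of _ _ "[]" h] graph_proj_chart[OF FG, of p "cG d"]
    by (simp add: proj_derivs_Nil gr_atlasD(2)[OF c])
  then have J: "zero_ext (carr (cmodel c)) (\<lambda>h. restr_op (cF d) (cG d)
      (?D (ext_op (cF c) (cG c) ?x) [ext_op (cF c) (cG c) h])) = gr_J c d p"
    by (simp add: gr_J_def)
  have "has_fderiv (cmodel c) (cmodel d) ?U
      (\<lambda>x. restr_op (cF d) (cG d) (?D (ext_op (cF c) (cG c) x) [])) ?x (gr_J c d p)"
    using smooth_transfer.has_fderiv_transfer[OF transfer_transition x] by (simp only: J)
  then show ?thesis
    using x unfolding has_fderiv_def by (auto simp: transition_eq)
qed

end

lemma banach_manifold_Gr: "banach_manifold (Gr :: 'e::banach set set) gr_atlas"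
  unfolding banach_manifold_def
proof (intro conjI ballI smooth_on_transition)
  show "(\<Union>c\<in>gr_atlas. cdom c) = (Gr :: 'e set set)"
  proof
    show "(\<Union>c\<in>gr_atlas. cdom c) \<subseteq> (Gr :: 'e set set)" by (auto simp: gr_atlas_def gr_chart_def)
    show "(Gr :: 'e set set) \<subseteq> (\<Union>c\<in>gr_atlas. cdom c)"
    proof
      fix H :: "'e set" assume "H \<in> Gr"
      then obtain G where G: "closed_compl H G" by (auto simp: Gr_def)
      then have "gr_chart H G \<in> gr_atlas" by (auto simp: gr_atlas_def)
      moreover have "H \<in> cdom (gr_chart H G)" using G by (simp add: gr_chart_simps[OF G])
      ultimately show "H \<in> (\<Union>c\<in>gr_atlas. cdom c)" by blast
    qed
  qed
  fix c :: "('e set, 'e \<Rightarrow> 'e) chart" assume c: "c \<in> gr_atlas"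
  note FG = gr_atlasD(1)[OF c]
  show "banach_space (cmodel c)" using banach_Lsp[OF FG] by (simp add: gr_atlas_simps c)
  show "inj_on (cmap c) (cdom c)" by (rule inj_on_chart[OF c])
  show "openin (ntop (cmodel c)) (cmap c ` cdom c)" using openin_overlap[OF c c] by simp
qed

interpretation gr: atlas_cocycle "Gr :: 'e::banach set set" gr_atlas gr_J
  by unfold_locales
    (simp_all add: banach_manifold_Gr has_fderiv_transition gr_J_id gr_J_comp)

text \<open>At \<open>p\<close> the coordinate change is \<open>conj_dual\<close> of
  \<open>conj_op (1 - \<Pi>) \<Pi>\<close> with \<open>\<Pi> = proj (cG c) p\<close>; the complement
  is \<open>cG c\<close> because the transposed derivative leads from \<open>d\<close> to
  \<open>c\<close>. The product rule and the derivatives of \<open>\<Pi>\<close> in the chart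
  \<open>e\<close> do the rest.\<close>

lemma smooth_on_codiff:
  fixes c d e :: "('e::banach set, 'e \<Rightarrow> 'e) chart"
  assumes c: "c \<in> gr_atlas" and d: "d \<in> gr_atlas" and e: "e \<in> gr_atlas"
  shows "smooth_on (cmodel e) (blmaps (ndual (cmodel c)) (ndual (cmodel d)))
      (cmap e ` (cdom e \<inter> cdom c \<inter> cdom d)) (\<lambda>x. gr.codiff c d (cinv e x))"
proof -
  note FGc = gr_atlasD(1)[OF c] and FGd = gr_atlasD(1)[OF d] and FGe = gr_atlasD(1)[OF e]
  let ?U = "cmap e ` (cdom e \<inter> cdom c \<inter> cdom d)"
  let ?D = "proj_derivs (graph_proj (cF e) (cG e) (cG c))"
  let ?E = "\<lambda>x us. (if us = [] then id_blinfun else 0) - ?D x us"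
  let ?\<rho> = "conj_dual (cF c) (cG c) (cF d) (cG d)"
  have "smooth_transfer (cmodel e) (blmaps (ndual (cmodel c)) (ndual (cmodel d))) ?U (ext_op (cF e) (cG e))
     ?\<rho> (\<lambda>x. leib conj_op (?E x) (?D x)) (norm (proj (cG e) (cF e)))
     (norm (proj (cF c) (cG c)) * norm (proj (cG d) (cF d)))"
  proof
    show "normed_space (cmodel e)" using normed_Lsp FGe by (simp add: gr_atlas_simps e)
    show "normed_space (blmaps (ndual (cmodel c)) (ndual (cmodel d)))"
      unfolding gr_atlas_simps[OF c] gr_atlas_simps[OF d]
      by (intro normed_space_blmaps normed_space_ndual normed_Lsp FGc FGd)
    show "openin (ntop (cmodel e)) ?U" by (rule openin_overlap3[OF e c d])
    show "lin_on (carr (cmodel e)) UNIV (ext_op (cF e) (cG e))"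
      using lin_ext_op[OF FGe] by (simp add: gr_atlas_simps e)
    show "norm (ext_op (cF e) (cG e) x) \<le> norm (proj (cG e) (cF e)) * nrm (cmodel e) x"
      if "x \<in> carr (cmodel e)" for x
      using norm_ext_op[OF FGe] that by (simp add: gr_atlas_simps e)
    show "lin_on UNIV (carr (blmaps (ndual (cmodel c)) (ndual (cmodel d)))) ?\<rho>"
      using conj_dual_blmaps(1)[OF FGc FGd] by (simp add: gr_atlas_simps c d)
    show "nrm (blmaps (ndual (cmodel c)) (ndual (cmodel d))) (?\<rho> z)
        \<le> norm (proj (cF c) (cG c)) * norm (proj (cG d) (cF d)) * norm z" for z
      using conj_dual_blmaps(2)[OF FGc FGd] by (simp add: gr_atlas_simps c d)
    have D: "deriv_family (ext_op (cF e) (cG e) ` ?U) ?D k" for k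
      by (rule deriv_family_graph_proj[OF FGe]) (auto simp: gr_atlasD(2)[OF e] gr_atlas_simps c e)
    show "deriv_family (ext_op (cF e) (cG e) ` ?U) (\<lambda>x. leib conj_op (?E x) (?D x)) k" for k
      by (intro deriv_family_leib bounded_bilinear_conj_op deriv_family_const_diff D)
  qed simp_all
  from smooth_transfer.smooth_on_transfer[OF this] show ?thesis
  proof (rule smooth_on_cong)
    fix x assume "x \<in> ?U"
    then obtain p where p: "p \<in> cdom e" "p \<in> cdom c" "p \<in> cdom d" "x = cmap e p" by auto
    then have g: "graph_proj (cF e) (cG e) (cG c) (ext_op (cF e) (cG e) x) = proj (cG c) p"
      using graph_proj_chart[OF FGe, of p "cG c"] by (simp add: gr_atlasD(2)[OF e] gr_atlas_simps e)
    have i: "cinv e x = p" using p e by (simp add: cinv_chart)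
    show "?\<rho> (leib conj_op (?E (ext_op (cF e) (cG e) x)) (?D (ext_op (cF e) (cG e) x)) [])
        = gr.codiff c d (cinv e x)"
      by (auto simp: fun_eq_iff proj_derivs_Nil g i conj_dual_def gr.codiff_def
          gr_J_def zero_ext_def conj_op_apply gr_atlas_simps c d)
  qed
qed

interpretation gr: smooth_atlas_cocycle "Gr :: 'e::banach set set" gr_atlas gr_J
  by unfold_locales (rule smooth_on_codiff)

section \<open>The predual of the space of operators\<close>

definition tens :: "'e::banach set \<Rightarrow> 'e set \<Rightarrow> ('e \<Rightarrow>\<^sub>L real) \<Rightarrow> 'e \<Rightarrow> ('e \<Rightarrow> 'e) \<Rightarrow> real" where
  "tens F G \<gamma> f = zero_ext (carr (Lsp F G)) (\<lambda>A. blinfun_apply \<gamma> (A f))"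

definition tensors where
  "tensors F G = {tens F G \<gamma> f | \<gamma> f. f \<in> F}"

text \<open>This is the image of the projective tensor product of \<open>F\<close> and the dual of \<open>G\<close>: since \<open>G\<close> is
  complemented, every functional on \<open>G\<close> extends to one on \<open>E\<close>.\<close>

definition Lpredual where
  "Lpredual F G = nclosure (ndual (Lsp F G)) (span (tensors F G))"

context
  fixes F G :: "'e::banach set"
  assumes FG: "closed_compl F G"
begin

lemma tens_apply: "A \<in> carr (Lsp F G) \<Longrightarrow> tens F G \<gamma> f A = blinfun_apply \<gamma> (A f)"
  by (simp add: tens_def zero_ext_def)

lemma tens_bound:
  assumes "f \<in> F" "A \<in> carr (Lsp F G)"
  shows "\<bar>tens F G \<gamma> f A\<bar> \<le> (norm \<gamma> * norm f) * nrm (Lsp F G) A"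
proof -
  have "\<bar>tens F G \<gamma> f A\<bar> \<le> norm \<gamma> * norm (A f)"
    using norm_blinfun[of \<gamma> "A f"] by (simp add: tens_apply[OF assms(2)])
  also have "\<dots> \<le> norm \<gamma> * (nrm (Lsp F G) A * norm f)"
    by (intro mult_left_mono LspD(4)[OF FG assms(2,1)]) simp
  finally show ?thesis by (simp add: mult_ac)
qed

lemma tens_ndual: "f \<in> F \<Longrightarrow> tens F G \<gamma> f \<in> carr (ndual (Lsp F G))"
proof (rule ndual_carrI[OF _ _ tens_bound])
  show "lin_on (carr (Lsp F G)) UNIV (tens F G \<gamma> f)"
    using normed_spaceD(6,8)[OF normed_Lsp[OF FG]]
    by (auto simp: lin_on_def tens_apply blinfun.bilinear_simps scaleR_fun_apply)
qed (simp_all add: tens_def zero_ext_def)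

lemma nrm_tens: "f \<in> F \<Longrightarrow> nrm (ndual (Lsp F G)) (tens F G \<gamma> f) \<le> norm \<gamma> * norm f"
  by (rule ndual_le[OF normed_Lsp[OF FG] _ tens_bound]) auto

lemma span_tensors: "span (tensors F G) \<subseteq> carr (ndual (Lsp F G))"
  by (rule span_minimal) (use tens_ndual normed_spaceD(1)[OF normed_space_ndual[OF normed_Lsp[OF FG]]]
      in \<open>auto simp: tensors_def\<close>)

lemma span_Lpredual: "span (tensors F G) \<subseteq> Lpredual F G"
  unfolding Lpredual_def by (rule subset_nclosure[OF normed_space_ndual[OF normed_Lsp[OF FG]] span_tensors])

lemma tens_Lpredual: "f \<in> F \<Longrightarrow> tens F G \<gamma> f \<in> Lpredual F G"
  using span_Lpredual by (auto simp: tensors_def intro!: span_base)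

lemma Lpredual_subset: "Lpredual F G \<subseteq> carr (ndual (Lsp F G))"
  by (auto simp: Lpredual_def nclosure_def)

lemma Lpredual_approx:
  assumes "\<mu> \<in> Lpredual F G" "e > 0"
  obtains \<tau> where "\<tau> \<in> span (tensors F G)" "\<And>v. v \<in> carr (Lsp F G) \<Longrightarrow> \<bar>\<mu> v - \<tau> v\<bar> \<le> e * nrm (Lsp F G) v"
proof -
  note NL = normed_Lsp[OF FG]
  obtain \<tau> where t: "\<tau> \<in> span (tensors F G)" "nrm (ndual (Lsp F G)) (\<mu> - \<tau>) \<le> e"
    using assms by (auto simp: Lpredual_def nclosure_def)
  then have "\<mu> - \<tau> \<in> carr (ndual (Lsp F G))"
    using assms(1) Lpredual_subset span_tensors normed_spaceD(7)[OF normed_space_ndual[OF NL]] by blast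
  from ndual_bound[OF NL this] mult_right_mono[OF t(2) normed_spaceD(2)[OF NL]]
  have "\<bar>\<mu> v - \<tau> v\<bar> \<le> e * nrm (Lsp F G) v" if "v \<in> carr (Lsp F G)" for v
    using that by fastforce
  then show thesis by (rule that[OF t(1)])
qed

lemma subspace_Lpredual: "subspace (Lpredual F G)"
  unfolding Lpredual_def
  by (rule subspace_nclosure[OF normed_space_ndual[OF normed_Lsp[OF FG]] subspace_span span_tensors])

lemma closed_Lpredual: "closedin (ntop (ndual (Lsp F G))) (Lpredual F G)"
  unfolding Lpredual_def by (rule closedin_nclosure[OF normed_space_ndual[OF normed_Lsp[OF FG]] span_tensors])

text \<open>Elementary functionals suffice: paired with \<open>f\<close>, a norming functional of
  \<open>A f\<close> gives the bound at \<open>f\<close>, with constant 1.\<close>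

lemma Lpredual_norming:
  assumes A: "A \<in> carr (Lsp F G)" and "0 \<le> C"
    and b: "\<And>\<mu>. \<mu> \<in> Lpredual F G \<Longrightarrow> \<bar>\<mu> A\<bar> \<le> C * nrm (ndual (Lsp F G)) \<mu>"
  shows "nrm (Lsp F G) A \<le> C"
proof (rule nrm_blmaps_le[OF normed_F[OF FG] normed_G[OF FG] \<open>0 \<le> C\<close>])
  fix f assume "f \<in> carr (nspace_of F)"
  then have f: "f \<in> F" by simp
  obtain \<gamma> :: "'e \<Rightarrow>\<^sub>L real" where g: "norm \<gamma> \<le> 1" "blinfun_apply \<gamma> (A f) = norm (A f)"
    by (rule norming_functional)
  have "norm (A f) = \<bar>tens F G \<gamma> f A\<bar>" using g by (simp add: tens_apply[OF A])
  also have "\<dots> \<le> C * nrm (ndual (Lsp F G)) (tens F G \<gamma> f)" by (rule b[OF tens_Lpredual[OF f]])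
  also have "\<dots> \<le> C * (norm \<gamma> * norm f)" by (intro mult_left_mono nrm_tens f \<open>0 \<le> C\<close>)
  also have "\<dots> \<le> C * (1 * norm f)" by (intro mult_left_mono mult_right_mono g \<open>0 \<le> C\<close>) simp
  finally show "nrm (nspace_of G) (A f) \<le> C * nrm (nspace_of F) f" by simp
qed

lemma Lpredual_dual:
  assumes refl: "reflexive_space TYPE('e)"
    and lin: "lin_on (Lpredual F G) UNIV \<phi>"
    and b: "\<And>\<mu>. \<mu> \<in> Lpredual F G \<Longrightarrow> \<bar>\<phi> \<mu>\<bar> \<le> C * nrm (ndual (Lsp F G)) \<mu>"
  shows "\<exists>A\<in>carr (Lsp F G). \<forall>\<mu>\<in>Lpredual F G. \<phi> \<mu> = \<mu> A"
proof -
  note NL = normed_Lsp[OF FG] and ND = normed_space_ndual[OF normed_Lsp[OF FG]]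
  note L = lin_onD(2,3)[OF lin]
  \<comment> \<open>The constant \<open>C\<close> may be negative.\<close>
  define K where "K = \<bar>C\<bar>"
  have K0: "K \<ge> 0" by (simp add: K_def)
  have bK: "\<bar>\<phi> \<mu>\<bar> \<le> K * nrm (ndual (Lsp F G)) \<mu>" if "\<mu> \<in> Lpredual F G" for \<mu>
  proof -
    have "C * nrm (ndual (Lsp F G)) \<mu> \<le> K * nrm (ndual (Lsp F G)) \<mu>"
      using normed_spaceD(2)[OF ND] that Lpredual_subset by (intro mult_right_mono) (auto simp: K_def)
    then show ?thesis using b[OF that] by simp
  qed
  have tadd: "tens F G (\<gamma> + \<delta>) f = tens F G \<gamma> f + tens F G \<delta> f" for \<gamma> \<delta> f
    by (auto simp: tens_def zero_ext_def fun_eq_iff blinfun.add_left)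
  have tscl: "tens F G (r *\<^sub>R \<gamma>) f = r *\<^sub>R tens F G \<gamma> f" for r \<gamma> f
    by (auto simp: tens_def zero_ext_def fun_eq_iff blinfun.scaleR_left scaleR_fun_apply)
  have tb: "\<bar>\<phi> (tens F G \<gamma> f)\<bar> \<le> K * (norm \<gamma> * norm f)" if f: "f \<in> F" for \<gamma> f
    using bK[OF tens_Lpredual[OF f], of \<gamma>] mult_left_mono[OF nrm_tens[OF f, of \<gamma>] K0] by simp
  have "\<exists>x. \<forall>\<gamma>. \<phi> (tens F G \<gamma> f) = blinfun_apply \<gamma> x" if f: "f \<in> F" for f
  proof -
    have "bounded_linear (\<lambda>\<gamma>. \<phi> (tens F G \<gamma> f))"
      by (rule bounded_linear_intro[of _ "K * norm f"])
        (use L tens_Lpredual[OF f] tb[OF f] in \<open>auto simp: tadd tscl mult_ac\<close>)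
    then show ?thesis
      using refl unfolding reflexive_space_def by (metis bounded_linear_Blinfun_apply)
  qed
  then obtain X where X: "\<And>f \<gamma>. f \<in> F \<Longrightarrow> \<phi> (tens F G \<gamma> f) = blinfun_apply \<gamma> (X f)" by metis
  \<comment> \<open>The vectors \<open>X f\<close> are only known to lie in the whole space;
    projecting them puts the values into \<open>G\<close>. Pairings do not change, because
    \<open>\<gamma>\<close> and its composition with \<open>proj F G\<close> agree on
    \<open>G\<close>.\<close>
  define A where "A = zero_ext F (\<lambda>f. proj F G (X f))"
  have gA: "blinfun_apply \<gamma> (A f) = \<phi> (tens F G \<gamma> f)" if f: "f \<in> F" for \<gamma> f
  proof -
    have "tens F G (\<gamma> o\<^sub>L proj F G) f = tens F G \<gamma> f"
      using proj_id[OF FG LspD(1)[OF FG _ f]] by (auto simp: tens_def zero_ext_def fun_eq_iff)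
    then show ?thesis using X[OF f, of "\<gamma> o\<^sub>L proj F G"] f by (simp add: A_def zero_ext_def)
  qed
  have FS: "f + g \<in> F" "r *\<^sub>R f \<in> F" if "f \<in> F" "g \<in> F" for f g r
    using that closed_complD(1)[OF FG] by (auto simp: subspace_add subspace_scale)
  have AL: "A \<in> carr (Lsp F G)"
  proof (rule blmaps_carrI)
    \<comment> \<open>The vectors \<open>X f\<close> were obtained one by one. Linearity of
      \<open>A\<close> is recovered by testing against functionals, since the elementary functionals
      are linear in \<open>f\<close>.\<close>
    have "A (f + g) = A f + A g" if "f \<in> F" "g \<in> F" for f g
    proof (rule functionals_separate)
      fix \<gamma> :: "'e \<Rightarrow>\<^sub>L real"
      have "tens F G \<gamma> (f + g) = tens F G \<gamma> f + tens F G \<gamma> g"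
      proof
        fix B show "tens F G \<gamma> (f + g) B = (tens F G \<gamma> f + tens F G \<gamma> g) B"
          using LspD(2)[OF FG _ that, of B]
          by (cases "B \<in> carr (Lsp F G)") (auto simp: tens_def zero_ext_def blinfun.add_right)
      qed
      then show "blinfun_apply \<gamma> (A (f + g)) = blinfun_apply \<gamma> (A f + A g)"
        using that FS L(1)[OF tens_Lpredual tens_Lpredual] by (simp add: gA blinfun.add_right)
    qed
    moreover have "A (r *\<^sub>R f) = r *\<^sub>R A f" if "f \<in> F" for r f
    proof (rule functionals_separate)
      fix \<gamma> :: "'e \<Rightarrow>\<^sub>L real"
      have "tens F G \<gamma> (r *\<^sub>R f) = r *\<^sub>R tens F G \<gamma> f"
      proof
        fix B show "tens F G \<gamma> (r *\<^sub>R f) B = (r *\<^sub>R tens F G \<gamma> f) B"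
          using LspD(3)[OF FG _ that, of B r]
          by (cases "B \<in> carr (Lsp F G)")
            (auto simp: tens_def zero_ext_def blinfun.scaleR_right scaleR_fun_apply)
      qed
      then show "blinfun_apply \<gamma> (A (r *\<^sub>R f)) = blinfun_apply \<gamma> (r *\<^sub>R A f)"
        using that FS L(2)[OF tens_Lpredual] by (simp add: gA blinfun.scaleR_right)
    qed
    moreover have "A f \<in> G" if "f \<in> F" for f using that proj_in(1)[OF FG] by (simp add: A_def zero_ext_def)
    ultimately show "lin_on (carr (nspace_of F)) (carr (nspace_of G)) A" by (simp add: lin_on_def)
    show "A f = 0" if "f \<notin> carr (nspace_of F)" for f using that by (simp add: A_def zero_ext_def)
    fix f assume "f \<in> carr (nspace_of F)"
    then have f: "f \<in> F" by simp
    obtain \<gamma> :: "'e \<Rightarrow>\<^sub>L real" where g: "norm \<gamma> \<le> 1" "blinfun_apply \<gamma> (A f) = norm (A f)"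
      by (rule norming_functional)
    have "norm (A f) \<le> K * (norm \<gamma> * norm f)" using tb[OF f, of \<gamma>] gA[OF f, of \<gamma>] g(2) by simp
    also have "\<dots> \<le> K * (1 * norm f)" by (intro mult_left_mono mult_right_mono g K0) simp
    finally show "nrm (nspace_of G) (A f) \<le> K * nrm (nspace_of F) f" by simp
  qed
  have span: "\<phi> \<tau> = \<tau> A" if "\<tau> \<in> span (tensors F G)" for \<tau>
  proof -
    have "span (tensors F G) \<subseteq> {\<tau> \<in> Lpredual F G. \<phi> \<tau> = \<tau> A}"
    proof (rule span_minimal)
      show "tensors F G \<subseteq> {\<tau> \<in> Lpredual F G. \<phi> \<tau> = \<tau> A}"
        using tens_Lpredual by (auto simp: tensors_def tens_apply[OF AL] gA)
      have "\<phi> 0 = 0" using lin_on_0[OF lin subspace_0[OF subspace_Lpredual]] .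
      then show "subspace {\<tau> \<in> Lpredual F G. \<phi> \<tau> = \<tau> A}"
        using L subspace_Lpredual
        by (intro subspaceI) (auto simp: subspace_0 subspace_add subspace_scale scaleR_fun_apply)
    qed
    then show ?thesis using that by blast
  qed
  have "\<phi> \<mu> = \<mu> A" if m: "\<mu> \<in> Lpredual F G" for \<mu>
  proof -
    define N where "N = nrm (Lsp F G) A"
    have N: "N \<ge> 0" unfolding N_def by (rule normed_spaceD(2)[OF NL AL])
    have "\<bar>\<phi> \<mu> - \<mu> A\<bar> \<le> 0"
    proof (rule field_le_epsilon)
      fix e :: real assume "e > 0"
      \<comment> \<open>When \<open>\<mu>\<close> is replaced by an element of the span at distance
        \<open>d\<close>, \<open>K * d\<close> bounds the change of \<open>\<phi>\<close> and
        \<open>N * d\<close> that of the evaluation at \<open>A\<close>.\<close>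
      define d where "d = e / (K + N + 1)"
      have p: "K + N + 1 > 0" using K0 N by simp
      have d: "d > 0" "(K + N) * d \<le> e" using \<open>e > 0\<close> p by (auto simp: d_def field_simps)
      obtain \<tau> where t: "\<tau> \<in> span (tensors F G)" "\<And>v. v \<in> carr (Lsp F G) \<Longrightarrow> \<bar>\<mu> v - \<tau> v\<bar> \<le> d * nrm (Lsp F G) v"
        using Lpredual_approx[OF m d(1)] by blast
      have tL: "\<tau> \<in> Lpredual F G" using t(1) span_Lpredual by blast
      have dL: "\<mu> - \<tau> \<in> Lpredual F G" by (rule subspace_diff[OF subspace_Lpredual m tL])
      have "\<bar>\<phi> (\<mu> - \<tau>)\<bar> \<le> K * nrm (ndual (Lsp F G)) (\<mu> - \<tau>)" by (rule bK[OF dL])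
      also have "\<dots> \<le> K * d" using d t(2) by (intro mult_left_mono K0 ndual_le[OF NL]) auto
      finally have "\<bar>\<phi> \<mu> - \<phi> \<tau>\<bar> \<le> K * d" using lin_on_diff[OF lin subspace_Lpredual m tL] by simp
      moreover have "\<bar>\<mu> A - \<tau> A\<bar> \<le> d * N" unfolding N_def by (rule t(2)[OF AL])
      ultimately have "\<bar>\<phi> \<mu> - \<mu> A\<bar> \<le> K * d + d * N" using span[OF t(1)] by (simp add: abs_le_iff)
      then show "\<bar>\<phi> \<mu> - \<mu> A\<bar> \<le> 0 + e" using d(2) by (simp add: algebra_simps)
    qed
    then show ?thesis by simp
  qed
  then show ?thesis using AL by blast
qed

end

text \<open>Elementary functionals go to elementary functionals, so the span goes into the span.
  Errors grow at most by the norm \<open>K\<close> of the derivative, hence approximation in the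
  dual norm survives and the closure goes into the closure.\<close>

lemma codiff_Lpredual:
  fixes c d :: "('e::banach set, 'e \<Rightarrow> 'e) chart"
  assumes c: "c \<in> gr_atlas" and d: "d \<in> gr_atlas" and p: "p \<in> cdom c" "p \<in> cdom d"
    and m: "\<mu> \<in> Lpredual (cF c) (cG c)"
  shows "gr.codiff c d p \<mu> \<in> Lpredual (cF d) (cG d)"
proof -
  note FG = gr_atlasD(1)[OF c] and FG' = gr_atlasD(1)[OF d]
  note sc = gr_atlas_simps[OF c] and sd = gr_atlas_simps[OF d]
  let ?J = "gr_J d c p"
  have pc: "closed_compl p (cG c)" using p by (simp add: sc)
  have JL: "?J v \<in> carr (Lsp (cF c) (cG c))" if "v \<in> carr (Lsp (cF d) (cG d))" for v
    using gr_J_Lsp[OF c, of v d p] that by (simp add: sc sd)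
  have co: "gr.codiff c d p \<nu> v = \<nu> (?J v)"
    if "\<nu> \<in> carr (ndual (Lsp (cF c) (cG c)))" "v \<in> carr (Lsp (cF d) (cG d))" for \<nu> v
    using that by (simp add: gr.codiff_def zero_ext_def sc sd)
  \<comment> \<open>\<open>T\<close> is the formula of \<open>codiff\<close> without the restriction
    to bounded functionals. It is therefore linear on the whole function type, as the minimality of
    the span requires.\<close>
  define T where "T \<tau> = zero_ext (carr (Lsp (cF d) (cG d))) (\<lambda>v. \<tau> (?J v))" for \<tau> :: "('e \<Rightarrow> 'e) \<Rightarrow> real"
  have "span (tensors (cF c) (cG c)) \<subseteq> {\<tau>. T \<tau> \<in> span (tensors (cF d) (cG d))}"
  proof (rule span_minimal)
    show "tensors (cF c) (cG c) \<subseteq> {\<tau>. T \<tau> \<in> span (tensors (cF d) (cG d))}"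
    proof
      fix \<tau> assume "\<tau> \<in> tensors (cF c) (cG c)"
      then obtain \<gamma> f where t: "\<tau> = tens (cF c) (cG c) \<gamma> f" "f \<in> cF c" by (auto simp: tensors_def)
      let ?f = "proj (cG d) (cF d) (proj (cG c) p f)"
      have "T \<tau> = tens (cF d) (cG d) (\<gamma> o\<^sub>L (id_blinfun - proj (cG c) p)) ?f"
        using t(2) by (auto simp: fun_eq_iff T_def t(1) tens_def zero_ext_def JL sd
            gr_J_apply(1)[OF c pc] ext_op_apply[OF FG'])
      then have "T \<tau> \<in> tensors (cF d) (cG d)"
        using proj_in(1)[OF closed_compl_sym[OF FG']] by (auto simp: tensors_def)
      then show "\<tau> \<in> {\<tau>. T \<tau> \<in> span (tensors (cF d) (cG d))}" by (simp add: span_base)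
    qed
    have "T 0 = 0" "T (\<sigma> + \<tau>) = T \<sigma> + T \<tau>" "T (r *\<^sub>R \<tau>) = r *\<^sub>R T \<tau>" for \<sigma> \<tau> r
      by (auto simp: T_def zero_ext_def fun_eq_iff scaleR_fun_apply)
    then show "subspace {\<tau>. T \<tau> \<in> span (tensors (cF d) (cG d))}"
      by (intro subspaceI) (auto simp: span_zero span_add span_scale)
  qed
  then have TS: "T \<tau> \<in> span (tensors (cF d) (cG d))" if "\<tau> \<in> span (tensors (cF c) (cG c))" for \<tau>
    using that by blast
  have mc: "\<mu> \<in> carr (ndual (Lsp (cF c) (cG c)))" using m Lpredual_subset[OF FG] by blast
  have JB: "?J \<in> carr (blmaps (Lsp (cF d) (cG d)) (Lsp (cF c) (cG c)))"
    using gr.J_blmaps[OF d c p(2,1)] by (simp add: sc sd)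
  define K where "K = nrm (blmaps (Lsp (cF d) (cG d)) (Lsp (cF c) (cG c))) ?J"
  have K: "K \<ge> 0" "\<And>v. v \<in> carr (Lsp (cF d) (cG d)) \<Longrightarrow> nrm (Lsp (cF c) (cG c)) (?J v) \<le> K * nrm (Lsp (cF d) (cG d)) v"
    unfolding K_def using nrm_blmaps_nonneg[OF normed_Lsp[OF FG'] normed_Lsp[OF FG] JB]
      blmaps_bound[OF normed_Lsp[OF FG'] normed_Lsp[OF FG] JB] by auto
  show ?thesis
    unfolding Lpredual_def nclosure_def
  proof (intro CollectI conjI allI impI)
    show "gr.codiff c d p \<mu> \<in> carr (ndual (Lsp (cF d) (cG d)))"
      using gr.codiff_carr[OF c p(1) d p(2)] mc by (simp add: sc sd)
    fix e :: real assume e: "e > 0"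
    have e': "e / (K + 1) > 0" "e / (K + 1) * K \<le> e" using e K(1) by (auto simp: field_simps)
    obtain \<tau> where t: "\<tau> \<in> span (tensors (cF c) (cG c))"
        "\<And>v. v \<in> carr (Lsp (cF c) (cG c)) \<Longrightarrow> \<bar>\<mu> v - \<tau> v\<bar> \<le> e / (K + 1) * nrm (Lsp (cF c) (cG c)) v"
      using Lpredual_approx[OF FG m e'(1)] by blast
    have "nrm (ndual (Lsp (cF d) (cG d))) (gr.codiff c d p \<mu> - T \<tau>) \<le> e"
    proof (rule ndual_le[OF normed_Lsp[OF FG'] less_imp_le[OF e]])
      fix v assume v: "v \<in> carr (Lsp (cF d) (cG d))"
      have "\<bar>(gr.codiff c d p \<mu> - T \<tau>) v\<bar> \<le> e / (K + 1) * nrm (Lsp (cF c) (cG c)) (?J v)"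
        using t(2)[OF JL[OF v]] v by (simp add: co[OF mc v] T_def zero_ext_def)
      also have "\<dots> \<le> e / (K + 1) * (K * nrm (Lsp (cF d) (cG d)) v)"
        using e'(1) by (intro mult_left_mono K v) simp
      also have "\<dots> = e / (K + 1) * K * nrm (Lsp (cF d) (cG d)) v" by simp
      also have "\<dots> \<le> e * nrm (Lsp (cF d) (cG d)) v"
        by (intro mult_right_mono e' normed_spaceD(2)[OF normed_Lsp[OF FG'] v])
      finally show "\<bar>(gr.codiff c d p \<mu> - T \<tau>) v\<bar> \<le> e * nrm (Lsp (cF d) (cG d)) v" .
    qed
    then show "\<exists>\<tau>\<in>span (tensors (cF d) (cG d)). nrm (ndual (Lsp (cF d) (cG d))) (gr.codiff c d p \<mu> - \<tau>) \<le> e"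
      using TS[OF t(1)] by blast
  qed
qed

theorem theorem5:
  assumes "reflexive_space TYPE('e::banach)"
  shows "\<exists>P. precotangent_bundle (Gr :: 'e set set) gr_atlas P"
proof -
  interpret pre: predual_cocycle "Gr :: 'e set set" gr_atlas gr_J "\<lambda>c. Lpredual (cF c) (cG c)"
  proof
    fix c :: "('e set, 'e \<Rightarrow> 'e) chart" assume c: "c \<in> gr_atlas"
    note FG = gr_atlasD(1)[OF c]
    note s = gr_atlas_simps(2)[OF c]
    show "subspace (Lpredual (cF c) (cG c))" by (rule subspace_Lpredual[OF FG])
    show "Lpredual (cF c) (cG c) \<subseteq> carr (ndual (cmodel c))" unfolding s by (rule Lpredual_subset[OF FG])
    show "closedin (ntop (ndual (cmodel c))) (Lpredual (cF c) (cG c))"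
      unfolding s by (rule closed_Lpredual[OF FG])
    show "\<exists>K. \<forall>C v. v \<in> carr (cmodel c) \<and> 0 \<le> C \<and>
        (\<forall>\<mu>\<in>Lpredual (cF c) (cG c). \<bar>\<mu> v\<bar> \<le> C * nrm (ndual (cmodel c)) \<mu>) \<longrightarrow> nrm (cmodel c) v \<le> K * C"
      unfolding s using Lpredual_norming[OF FG] by (intro exI[of _ 1]) auto
    show "\<exists>v\<in>carr (cmodel c). \<forall>\<mu>\<in>Lpredual (cF c) (cG c). \<phi> \<mu> = \<mu> v"
      if "lin_on (Lpredual (cF c) (cG c)) UNIV \<phi>"
        "\<And>\<mu>. \<mu> \<in> Lpredual (cF c) (cG c) \<Longrightarrow> \<bar>\<phi> \<mu>\<bar> \<le> C * nrm (ndual (cmodel c)) \<mu>" for \<phi> C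
      using Lpredual_dual[OF FG assms that[unfolded s]] unfolding s .
  qed (rule codiff_Lpredual)
  show ?thesis using pre.precotangent_bundle by blast
qed

end
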